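(* Let $n\ge 1$, let $\Omega\subset\mathbb{R}^n$ be a bounded and connected open set with $C^2$ boundary and let $\varphi:\mathbb{R}^n\to\mathbb{R}$ be such that $$\varphi\in L^\infty_{loc}(\mathbb{R}^n)\quad\text{and}\quad \overline{\alpha}\big(\mathcal{S}g(\varphi)\big)<\frac{\omega_{n+1}}{2}.$$ Assume that either a) $\psi\in C^2(\overline\Omega)$ and there exist $\varrho,a>0$ such that $\varphi\in C^0(\Omega_{2\varrho}\setminus\Omega)$ and for every $x_0\in\partial\Omega$ $$\varphi(x)\le\psi(x_0)+\nabla\psi(x_0)\cdot(x-x_0)+\frac a2|x-x_0|^2\qquad\text{for all }x\in B_\varrho(x_0)\setminus\Omega,$$ or b) $\psi\in C(\overline\Omega)\cap C^2(\Omega)$ is such that $$\mathfrak{O}:=\{(x,t)\in\Omega\times\mathbb{R}\,:\,t>\psi(x)\}$$ is an open set with $C^2$ boundary. For every $s\in(0,1)$ let $u_s\in\mathcal{W}^s_{\varphi,\psi}(\Omega,\Omega)$ be the unique solution of the obstacle problem in $\Omega$ with exterior data $\varphi$ and obstacle $\psi$ in $A=\Omega$. Then there exists $s_0\in(0,1)$ such that $$u_s=\psi\quad\text{a.e. in }\Omega,$$ for every $s\in(0,s_0)$.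
   Context: Notation. $\omega_{n+1}=\mathcal{H}^n(\partial\mathcal{B}_1)=\frac{2\pi^{(n+1)/2}}{\Gamma((n+1)/2)}$, where $\mathcal{B}_1$ is the unit ball of $\mathbb{R}^{n+1}$ centered at the origin; $B_r(x)$ is the open ball in $\mathbb{R}^n$. The subgraph of $u:\mathbb{R}^n\to\mathbb{R}$ is $\mathcal{S}g(u)=\{(x,x_{n+1})\in\mathbb{R}^{n}\times\mathbb{R}: x_{n+1}<u(x)\}$. For a measurable $E\subset\mathbb{R}^{n+1}$, $$\overline\alpha(E):=\limsup_{s\to0^+}s\int_{\mathbb{R}^{n+1}\setminus\mathcal{B}_1}\frac{\chi_E(Y)}{|Y|^{n+1+s}}\,dY.$$ For $\delta\in\mathbb{R}$, $\Omega_\delta:=\{x\in\mathbb{R}^n:\bar d_\Omega(x)<\delta\}$, where $\bar d_\Omega(x)=d(x,\Omega)-d(x,\mathbb{R}^n\setminus\Omega)$ is the signed distance from $\partial\Omega$, negative inside $\Omega$. Obstacle problem. For $s\in(0,1)$ set $g_s(t)=(1+t^2)^{-\frac{n+1+s}{2}}$, $G_s(t)=\int_0^t g_s(\tau)\,d\tau$, $\mathcal{G}_s(t)=\int_0^tG_s(\tau)\,d\tau$, and $Q(\Omega)=\mathbb{R}^{2n}\setminus(\mathbb{R}^n\setminus\Omega)^2$. Functions are measurable and identified when equal a.e. $\mathcal{W}^s(\Omega)$ is the set of $u:\mathbb{R}^n\to\mathbb{R}$ with $u|_\Omega\in W^{s,1}(\Omega)$, i.e. $\|u\|_{L^1(\Omega)}+\int_\Omega\int_\Omega\frac{|u(x)-u(y)|}{|x-y|^{n+s}}\,dx\,dy<\infty$.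 For $A\subset\Omega$ open and $\psi\in L^\infty(A)$, $$\mathcal{W}^s_{\varphi,\psi}(\Omega,A):=\{u\in\mathcal{W}^s(\Omega):u=\varphi\text{ on }\mathbb{R}^n\setminus\Omega,\ u\ge\psi\text{ a.e. in }A\}.$$ A function $u$ solves the obstacle problem (in $\Omega$, with exterior data $\varphi$ and obstacle $\psi$ in $A$) if $u\in\mathcal{W}^s_{\varphi,\psi}(\Omega,A)$ and for every $v\in\mathcal{W}^s_{\varphi,\psi}(\Omega,A)$ $$\iint_{Q(\Omega)}\left\{\mathcal{G}_s\Big(\tfrac{u(x)-u(y)}{|x-y|}\Big)-\mathcal{G}_s\Big(\tfrac{v(x)-v(y)}{|x-y|}\Big)\right\}\frac{dx\,dy}{|x-y|^{n-1+s}}\le0.$$ Under the stated hypotheses such a solution exists and is unique for every $s\in(0,1)$. *)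

theory Defs
  imports "HOL-Analysis.Analysis"
begin

text \<open>
  \<open>real ^ 'n\<close> plays the role of \<open>\<real>\<^sup>n\<close>, and \<open>(real ^ 'n) \<times> real\<close> (with its Euclidean product
  norm) that of \<open>\<real>\<^sup>n\<^sup>+\<^sup>1\<close>. Measurability, integrals and ``almost everywhere'' refer to the
  (complete) Lebesgue measure.
\<close>

definition C2_with_derivs ::
    "'a::euclidean_space set \<Rightarrow> ('a \<Rightarrow> real) \<Rightarrow> ('a \<Rightarrow> 'a) \<Rightarrow> ('a \<Rightarrow> 'a \<Rightarrow>\<^sub>L 'a) \<Rightarrow> bool" where
  "C2_with_derivs U f g H \<longleftrightarrow>
     (\<forall>x\<in>U. GDERIV f x :> g x) \<and>
     (\<forall>x\<in>U. (g has_derivative blinfun_apply (H x)) (at x)) \<and>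
     continuous_on U H"

definition C2_on :: "'a::euclidean_space set \<Rightarrow> ('a \<Rightarrow> real) \<Rightarrow> bool" where
  "C2_on U f \<longleftrightarrow> (\<exists>g H. C2_with_derivs U f g H)"

text \<open>
  \<open>f \<in> C\<^sup>2(closure U)\<close>: \<open>f\<close> is \<open>C\<^sup>2\<close> in the open set \<open>U\<close>, and \<open>f\<close> and its derivatives up to
  order 2 extend continuously to the closure. The argument \<open>g\<close> is the continuous extension of
  the gradient; it is determined by \<open>f\<close> on \<open>closure U\<close> and gives the meaning of the gradient
  at boundary points.
\<close>

definition C2_closure_with_grad ::
    "'a::euclidean_space set \<Rightarrow> ('a \<Rightarrow> real) \<Rightarrow> ('a \<Rightarrow> 'a) \<Rightarrow> bool" where
  "C2_closure_with_grad U f g \<longleftrightarrow>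
     continuous_on (closure U) f \<and> continuous_on (closure U) g \<and>
     (\<exists>H. C2_with_derivs U f g H \<and> continuous_on (closure U) H)"

text \<open>
  Near each boundary point the set is, in suitable orthonormal coordinates, the strict
  epigraph of a \<open>C\<^sup>2\<close> function over the hyperplane orthogonal to a unit vector \<open>e\<close>. The
  function \<open>\<gamma>\<close> is only ever evaluated on that hyperplane; in dimension one it is a constant.
\<close>

definition C2_boundary :: "'a::euclidean_space set \<Rightarrow> bool" where
  "C2_boundary U \<longleftrightarrow>
     (\<forall>p\<in>frontier U. \<exists>r>0. \<exists>e \<gamma>. norm e = 1 \<and> C2_on UNIV \<gamma> \<and>
        U \<inter> ball p r = {x \<in> ball p r. \<gamma> (x - (x \<bullet> e) *\<^sub>R e) < x \<bullet> e})"

text \<open>The surface measure of the unit sphere in dimension \<open>d\<close>.\<close>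

definition omega :: "nat \<Rightarrow> real" where
  "omega d = 2 * pi powr (real d / 2) / Gamma (real d / 2)"

definition subgraph :: "('a \<Rightarrow> real) \<Rightarrow> ('a \<times> real) set" where
  "subgraph u = {(x, t). t < u x}"

definition alpha_bar :: "'b::euclidean_space set \<Rightarrow> ereal" where
  "alpha_bar E = Limsup (at_right 0) (\<lambda>s::real. ereal
     (s * set_lebesgue_integral lebesgue (- ball 0 1)
            (\<lambda>Y. indicator E Y / norm Y powr (real DIM('b) + s))))"

definition signed_dist :: "'a::metric_space set \<Rightarrow> 'a \<Rightarrow> real" where
  "signed_dist \<Omega> x = infdist x \<Omega> - infdist x (- \<Omega>)"

definition nbhd :: "'a::metric_space set \<Rightarrow> real \<Rightarrow> 'a set" where
  "nbhd \<Omega> \<delta> = {x. signed_dist \<Omega> x < \<delta>}"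

definition Linf_loc :: "('a::euclidean_space \<Rightarrow> real) \<Rightarrow> bool" where
  "Linf_loc f \<longleftrightarrow> f \<in> borel_measurable lebesgue \<and>
     (\<forall>K. compact K \<longrightarrow> (\<exists>M. AE x in lebesgue. x \<in> K \<longrightarrow> \<bar>f x\<bar> \<le> M))"

text \<open>In the next three functions \<open>n\<close> is the dimension; the integrals are oriented.\<close>

definition g_fun :: "nat \<Rightarrow> real \<Rightarrow> real \<Rightarrow> real" where
  "g_fun n s t = (1 + t\<^sup>2) powr (- (real n + 1 + s) / 2)"

definition G_fun :: "nat \<Rightarrow> real \<Rightarrow> real \<Rightarrow> real" where
  "G_fun n s t = (LBINT \<tau>=0..t. g_fun n s \<tau>)"

definition calG :: "nat \<Rightarrow> real \<Rightarrow> real \<Rightarrow> real" where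
  "calG n s t = (LBINT \<tau>=0..t. G_fun n s \<tau>)"

definition Q_set :: "'a set \<Rightarrow> ('a \<times> 'a) set" where
  "Q_set \<Omega> = UNIV - (UNIV - \<Omega>) \<times> (UNIV - \<Omega>)"

definition W_space :: "real \<Rightarrow> 'a::euclidean_space set \<Rightarrow> ('a \<Rightarrow> real) set" where
  "W_space s \<Omega> = {u. u \<in> borel_measurable lebesgue \<and>
     set_integrable lebesgue \<Omega> u \<and>
     set_integrable lebesgue (\<Omega> \<times> \<Omega>)
       (\<lambda>(x, y). \<bar>u x - u y\<bar> / norm (x - y) powr (real DIM('a) + s))}"

definition W_obst :: "real \<Rightarrow> 'a::euclidean_space set \<Rightarrow> 'a set \<Rightarrow>
    ('a \<Rightarrow> real) \<Rightarrow> ('a \<Rightarrow> real) \<Rightarrow> ('a \<Rightarrow> real) set" where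
  "W_obst s \<Omega> A \<phi> \<psi> = {u \<in> W_space s \<Omega>.
     (AE x in lebesgue. x \<notin> \<Omega> \<longrightarrow> u x = \<phi> x) \<and>
     (AE x in lebesgue. x \<in> A \<longrightarrow> \<psi> x \<le> u x)}"

text \<open>
  For bounded \<open>\<Omega>\<close> with Lipschitz boundary the integrand below is absolutely integrable:
  \<open>G_fun\<close> is bounded, \<open>u = v\<close> a.e. outside \<open>\<Omega>\<close>, and a fractional Hardy inequality handles the
  interaction between \<open>\<Omega>\<close> and its complement.
\<close>

definition solves_obstacle :: "real \<Rightarrow> 'a::euclidean_space set \<Rightarrow> 'a set \<Rightarrow>
    ('a \<Rightarrow> real) \<Rightarrow> ('a \<Rightarrow> real) \<Rightarrow> ('a \<Rightarrow> real) \<Rightarrow> bool" where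
  "solves_obstacle s \<Omega> A \<phi> \<psi> u \<longleftrightarrow> u \<in> W_obst s \<Omega> A \<phi> \<psi> \<and>
     (\<forall>v \<in> W_obst s \<Omega> A \<phi> \<psi>.
        set_lebesgue_integral lebesgue (Q_set \<Omega>)
          (\<lambda>(x, y). (calG DIM('a) s ((u x - u y) / norm (x - y))
                   - calG DIM('a) s ((v x - v y) / norm (x - y)))
                  / norm (x - y) powr (real DIM('a) - 1 + s)) \<le> 0)"

end

theory Submission
  imports Defs
begin

text \<open>
  Let \<open>w\<close> be \<open>\<psi>\<close> in \<open>\<Omega>\<close> and \<open>\<phi>\<close> outside, and write \<open>n\<close> for the dimension. The first variation of the
  energy at \<open>w\<close> is the fractional mean curvature of the subgraph of \<open>w\<close>, an integral over
  \<open>\<real>\<^sup>n\<^sup>+\<^sup>1\<close>, centred at a point of the graph, of the kernel \<open>1 / \<bar>Z\<bar>\<^sup>n\<^sup>+\<^sup>1\<^sup>+\<^sup>s\<close> with sign \<open>+1\<close> above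
  the graph and \<open>-1\<close> below it. As \<open>s \<rightarrow> 0\<close> the kernel moves to infinity: the part outside a fixed
  ball is about \<open>(\<omega> - 2 \<alpha>) / s\<close>, where \<open>\<omega> / s\<close> is the mass of the kernel outside the unit ball and \<open>\<alpha>\<close>, the upper
  limit of \<open>s\<close> times the mass of the subgraph, is below \<open>\<omega> / 2\<close> by hypothesis
  (\<open>far_field_bound\<close>). The part inside the ball is bounded below, uniformly in \<open>s\<close> and in the point,
  as soon as a ball of fixed size touches the graph from above: the touching ball and its mirror
  image cancel at worst, and what is left between the two is thin (\<open>nn_integral_tangent_gap\<close>).
  So for small \<open>s\<close> the curvature is at least 1 at every point of \<open>\<Omega>\<close> (\<open>curv_eventually_ge_1\<close>).
  Both alternatives on \<open>\<psi>\<close> serve only to produce the touching balls. If the epigraph has \<open>C\<^sup>2\<close>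
  boundary they are its interior balls; if \<open>\<psi>\<close> is \<open>C\<^sup>2\<close> up to the boundary, Taylor's formula inside
  \<open>\<Omega>\<close> and the quadratic bound on \<open>\<phi>\<close> outside give a paraboloid above the graph.

  Thus \<open>w\<close> is a strict supersolution, and by convexity of the energy the solution, which lies above
  \<open>w\<close>, must equal \<open>w\<close>. To compare the two without knowing that \<open>w\<close> has finite energy, or that the
  interaction of \<open>\<Omega>\<close> with its complement is integrable, the solution \<open>u\<close> is lowered only to
  \<open>u - \<zeta>\<close> with \<open>\<zeta> = min (u - w) \<eta>\<close>, where the cutoff \<open>\<eta>\<close> vanishes within distance \<open>\<delta>\<close> of the
  boundary and is 1 beyond \<open>2 \<delta>\<close>. Truncation destroys the monotonicity of the first variation only
  at points where \<open>\<eta> < 1\<close>, and the total error is of order \<open>\<delta>\<^sup>-\<^sup>s\<close> times the volume of a boundary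
  layer of width \<open>2 \<delta>\<close>, hence of order \<open>\<delta>\<^sup>1\<^sup>-\<^sup>s\<close> (\<open>obstacle_gap_estimate\<close>,
  \<open>boundary_layer_measure\<close>). Letting \<open>\<delta> \<rightarrow> 0\<close> gives \<open>\<integral> \<zeta> = 0\<close>.
\<close>

section \<open>Radial integrals\<close>

text \<open>
  Since \<open>x / 0 = 0\<close>, the value at the origin is 0. This makes the kernel harmless on the diagonal.
\<close>
definition riesz :: "real \<Rightarrow> 'a::real_normed_vector \<Rightarrow> real" where
  "riesz p z = 1 / norm z powr p"

abbreviation frac_kernel :: "real \<Rightarrow> 'a::euclidean_space \<Rightarrow> real" where
  "frac_kernel s \<equiv> riesz (real DIM('a) + s)"

lemma riesz_nonneg [simp]: "0 \<le> riesz p z"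
  by (simp add: riesz_def)

lemma riesz_uminus [simp]: "riesz p (- z) = riesz p z"
  by (simp add: riesz_def)

lemma riesz_measurable [measurable]: "riesz p \<in> borel_measurable borel"
  unfolding riesz_def by measurable

lemma omega_eq:
  assumes "0 < d"
  shows "omega d = d * unit_ball_vol (real d)"
proof -
  have "real d / 2 \<notin> \<int>\<^sub>\<le>\<^sub>0"
    using assms by (auto simp: nonpos_Ints_def)
  then have "Gamma (real d / 2 + 1) = real d / 2 * Gamma (real d / 2)"
    by (rule Gamma_plus1)
  then show ?thesis
    using assms unfolding omega_def unit_ball_vol_def by (simp only:) simp
qed

lemma omega_pos: "0 < d \<Longrightarrow> 0 < omega d"
  by (simp add: omega_eq)

text \<open>
  Polar coordinates without a measure on the sphere: a measure on the line is determined by its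
  values on the half-lines \<open>{..a}\<close>, which here are the volumes of balls. Integrals of radial
  functions thereby become integrals over the half-line.
\<close>
lemma distr_norm_lborel:
  "distr (lborel :: 'a::euclidean_space measure) borel norm =
    density lborel (\<lambda>t. ennreal (omega DIM('a) * t ^ (DIM('a) - 1)) * indicator {0..} t)"
proof (rule measure_eqI_generator_eq[where E="range atMost" and \<Omega>=UNIV and A="\<lambda>i. {..real i}"])
  show "Int_stable (range (atMost :: real \<Rightarrow> _))"
    by (auto simp: Int_stable_def)
  show sets: "sets (distr (lborel :: 'a measure) borel norm) = sigma_sets UNIV (range atMost)"
    by (simp add: borel_eq_atMost)
  show "sets (density lborel (\<lambda>t. ennreal (omega DIM('a) * t ^ (DIM('a) - 1)) * indicator {0..} t))
      = sigma_sets UNIV (range atMost)"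
    by (simp add: borel_eq_atMost)
  show "(\<Union>i. {..real i}) = UNIV"
    by (auto simp: real_arch_simple)
  show "emeasure (distr (lborel :: 'a measure) borel norm) {..real i} \<noteq> \<infinity>" for i
  proof -
    have "norm -` {..real i} = cball (0::'a) (real i)" by auto
    then show ?thesis by (simp add: emeasure_distr emeasure_cball)
  qed
  show "emeasure (distr (lborel :: 'a measure) borel norm) X =
     emeasure (density lborel (\<lambda>t. ennreal (omega DIM('a) * t ^ (DIM('a) - 1)) * indicator {0..} t)) X"
    if X: "X \<in> range atMost" for X
  proof -
    obtain a where a: "X = {..a}" using X by auto
    show ?thesis
    proof (cases "a < 0")
      case True
      then have "norm -` {..a} = ({} :: 'a set)"
        using norm_ge_zero[where 'a='a] by (fastforce dest: order_trans[OF norm_ge_zero])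
      moreover have "(\<integral>\<^sup>+ t. ennreal (omega DIM('a) * t ^ (DIM('a) - 1)) * indicator {0..} t * indicator {..a} t \<partial>lborel)
          = (\<integral>\<^sup>+ (t::real). 0 \<partial>lborel)"
        using True by (intro nn_integral_cong) (auto simp: indicator_def)
      ultimately show ?thesis
        by (simp add: a emeasure_distr emeasure_density)
    next
      case False
      have L: "norm -` {..a} = cball (0::'a) a" by auto
      have "(\<integral>\<^sup>+ t. ennreal (omega DIM('a) * t ^ (DIM('a) - 1)) * indicator {0..} t * indicator {..a} t \<partial>lborel)
         = (\<integral>\<^sup>+ t. ennreal (omega DIM('a) * t ^ (DIM('a) - 1)) * indicator {0..a} t \<partial>lborel)"
        by (intro nn_integral_cong) (auto simp: indicator_def)
      also have "\<dots> = ennreal (unit_ball_vol DIM('a) * a ^ DIM('a) - unit_ball_vol DIM('a) * 0 ^ DIM('a))"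
        using False
        by (intro nn_integral_FTC_Icc)
           (auto intro!: derivative_eq_intros simp: omega_eq)
      also have "\<dots> = emeasure lborel (cball (0::'a) a)"
        using False by (simp add: emeasure_cball)
      finally show ?thesis
        using False by (simp add: a emeasure_distr emeasure_density L)
    qed
  qed
qed auto

lemma nn_integral_radial:
  fixes f :: "real \<Rightarrow> ennreal"
  assumes [measurable]: "f \<in> borel_measurable borel"
  shows "(\<integral>\<^sup>+ z. f (norm z) \<partial>(lborel :: 'a::euclidean_space measure)) =
    (\<integral>\<^sup>+ t. ennreal (omega DIM('a) * t ^ (DIM('a) - 1)) * indicator {0..} t * f t \<partial>lborel)"
proof -
  have "(\<integral>\<^sup>+ z. f (norm z) \<partial>(lborel :: 'a measure)) = (\<integral>\<^sup>+ t. f t \<partial>distr (lborel :: 'a measure) borel norm)"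
    by (subst nn_integral_distr) auto
  then show ?thesis
    by (simp add: distr_norm_lborel nn_integral_density)
qed

lemma polar_density_mult_riesz:
  assumes "t > 0" "d > 0"
  shows "t ^ (d - 1) * (1 / t powr (real d + s)) = t powr (- 1 - s)"
proof -
  have "t ^ (d - 1) = t powr (real d - 1)"
    using assms by (simp add: powr_realpow[symmetric] of_nat_diff)
  then show ?thesis
    using assms by (simp add: powr_minus_divide[symmetric] powr_add[symmetric])
qed

text \<open>
  For \<open>r = 1\<close> this is where the constant \<open>\<omega>\<close> in the hypothesis on the exterior data comes from.
\<close>
lemma nn_integral_riesz_outside:
  assumes s: "0 < s" and r: "0 < r"
  shows "(\<integral>\<^sup>+ z. ennreal (frac_kernel s z) * indicator {z. r \<le> norm z} z \<partial>(lborel :: 'a::euclidean_space measure))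
     = ennreal (omega DIM('a) * r powr (- s) / s)"
proof -
  have "(\<integral>\<^sup>+ z. ennreal (frac_kernel s z) * indicator {z. r \<le> norm z} z \<partial>(lborel :: 'a measure))
    = (\<integral>\<^sup>+ (z::'a). (\<lambda>t::real. ennreal (1 / t powr (real DIM('a) + s)) * indicator {r..} t) (norm z) \<partial>lborel)"
    by (intro nn_integral_cong) (auto simp: riesz_def indicator_def)
  also have "\<dots> = (\<integral>\<^sup>+ t. ennreal (omega DIM('a) * t ^ (DIM('a) - 1)) * indicator {0..} t *
      (ennreal (1 / t powr (real DIM('a) + s)) * indicator {r..} t) \<partial>lborel)"
    by (subst nn_integral_radial) auto
  also have "\<dots> = (\<integral>\<^sup>+ t. ennreal (omega DIM('a) * t powr (-1 - s)) * indicator {r..} t \<partial>lborel)"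
    using r polar_density_mult_riesz[of _ "DIM('a)" s]
    by (intro nn_integral_cong)
       (auto simp: indicator_def ennreal_mult[symmetric] omega_pos less_imp_le simp flip: times_divide_eq_right)
  also have "\<dots> = ennreal (omega DIM('a) * (- (r powr (- 1 - s + 1)) / (-1 - s + 1)))"
    using s r omega_pos[of "DIM('a)"]
    by (intro nn_integral_has_integral_lebesgue' has_integral_mult_right has_integral_powr_to_inf) auto
  finally show ?thesis by simp
qed

text \<open>
  A function with values in \<open>[0, 1]\<close> and Lipschitz constant \<open>1 / \<delta>\<close> has increments at most
  \<open>min 1 (\<bar>z\<bar> / \<delta>)\<close>. The integral converges at the origin because \<open>s < 1\<close> and at infinity because
  \<open>s > 0\<close>; the power of \<open>\<delta>\<close> is dictated by scaling.
\<close>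
lemma nn_integral_lipschitz_kernel:
  assumes s: "0 < s" "s < 1" and d: "0 < \<delta>"
  shows "(\<integral>\<^sup>+ z. ennreal (min 1 (norm z / \<delta>) * frac_kernel s z) \<partial>(lborel :: 'a::euclidean_space measure))
     \<le> ennreal (omega DIM('a) * (1 / (1 - s) + 1 / s) * \<delta> powr (- s))"
proof -
  have "(\<integral>\<^sup>+ z. ennreal (min 1 (norm z / \<delta>) * frac_kernel s z) \<partial>(lborel :: 'a measure))
    = (\<integral>\<^sup>+ (z::'a). (\<lambda>t::real. ennreal (min 1 (t / \<delta>) * (1 / t powr (real DIM('a) + s)))) (norm z) \<partial>lborel)"
    by (intro nn_integral_cong) (auto simp: riesz_def indicator_def)
  also have "\<dots> = (\<integral>\<^sup>+ t. ennreal (omega DIM('a) * t ^ (DIM('a) - 1)) * indicator {0..} t *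
      ennreal (min 1 (t / \<delta>) * (1 / t powr (real DIM('a) + s))) \<partial>lborel)"
    by (subst nn_integral_radial) auto
  also have "\<dots> \<le> (\<integral>\<^sup>+ t. ennreal (omega DIM('a) / \<delta> * t powr (- s)) * indicator {0..\<delta>} t
        + ennreal (omega DIM('a) * t powr (-1 - s)) * indicator {\<delta>..} t \<partial>lborel)"
  proof (intro nn_integral_mono)
    fix t :: real
    have w: "0 < omega DIM('a)" by (simp add: omega_pos)
    show "ennreal (omega DIM('a) * t ^ (DIM('a) - 1)) * indicator {0..} t *
      ennreal (min 1 (t / \<delta>) * (1 / t powr (real DIM('a) + s)))
      \<le> ennreal (omega DIM('a) / \<delta> * t powr (- s)) * indicator {0..\<delta>} t
        + ennreal (omega DIM('a) * t powr (-1 - s)) * indicator {\<delta>..} t"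
    proof (cases "t > 0")
      case True
      have eq: "omega DIM('a) * t ^ (DIM('a) - 1) * (min 1 (t / \<delta>) * (1 / t powr (real DIM('a) + s)))
          = omega DIM('a) * min 1 (t / \<delta>) * t powr (-1 - s)"
        by (subst polar_density_mult_riesz[OF True, of "DIM('a)" s, symmetric]) simp_all
      have lhs: "ennreal (omega DIM('a) * t ^ (DIM('a) - 1)) * indicator {0..} t *
          ennreal (min 1 (t / \<delta>) * (1 / t powr (real DIM('a) + s)))
        = ennreal (omega DIM('a) * min 1 (t / \<delta>) * t powr (-1 - s))"
        using True w d unfolding eq[symmetric] by (subst ennreal_mult) auto
      show ?thesis
      proof (cases "t < \<delta>")
        case True
        have "t * t powr (-1 - s) = t powr (- s)"
          using \<open>t > 0\<close> powr_add[of t 1 "-1-s"] by simp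
        then have *: "omega DIM('a) * min 1 (t / \<delta>) * t powr (-1 - s) = omega DIM('a) / \<delta> * t powr (- s)"
          using True d by (auto simp: min_def field_simps)
        show ?thesis unfolding lhs * using True \<open>t > 0\<close> by simp
      next
        case False
        then have "omega DIM('a) * min 1 (t / \<delta>) * t powr (-1 - s) = omega DIM('a) * t powr (-1 - s)"
          using d by (auto simp: min_def field_simps)
        then show ?thesis using False by (subst lhs) (auto simp: le_iff_add add.commute)
      qed
    qed (auto simp: indicator_def min_def divide_simps)
  qed
  also have "\<dots> = (\<integral>\<^sup>+ t. ennreal (omega DIM('a) / \<delta> * t powr (- s)) * indicator {0..\<delta>} t \<partial>lborel)
        + (\<integral>\<^sup>+ t. ennreal (omega DIM('a) * t powr (-1 - s)) * indicator {\<delta>..} t \<partial>lborel)"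
    by (rule nn_integral_add) auto
  also have "(\<integral>\<^sup>+ t. ennreal (omega DIM('a) / \<delta> * t powr (- s)) * indicator {0..\<delta>} t \<partial>lborel)
     = ennreal (omega DIM('a) / \<delta> * (\<delta> powr (-s + 1) / (-s + 1)))"
    using s d omega_pos[of "DIM('a)"]
    by (intro nn_integral_has_integral_lebesgue' has_integral_mult_right has_integral_powr_from_0) auto
  also have "(\<integral>\<^sup>+ t. ennreal (omega DIM('a) * t powr (-1 - s)) * indicator {\<delta>..} t \<partial>lborel)
     = ennreal (omega DIM('a) * (- (\<delta> powr (- 1 - s + 1)) / (-1 - s + 1)))"
    using s d omega_pos[of "DIM('a)"]
    by (intro nn_integral_has_integral_lebesgue' has_integral_mult_right has_integral_powr_to_inf) auto
  also have "ennreal (omega DIM('a) / \<delta> * (\<delta> powr (-s + 1) / (-s + 1))) + 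
      ennreal (omega DIM('a) * (- (\<delta> powr (- 1 - s + 1)) / (-1 - s + 1)))
    = ennreal (omega DIM('a) * (1 / (1 - s) + 1 / s) * \<delta> powr (- s))"
  proof -
    have 1: "omega DIM('a) / \<delta> * (\<delta> powr (-s + 1) / (-s + 1)) = omega DIM('a) * (1 / (1 - s)) * \<delta> powr (- s)"
      using d powr_add[of \<delta> "- s" 1] by simp
    have 2: "omega DIM('a) * (- (\<delta> powr (- 1 - s + 1)) / (-1 - s + 1)) = omega DIM('a) * (1 / s) * \<delta> powr (- s)"
      by simp
    show ?thesis
      unfolding 1 2 using s d omega_pos[of "DIM('a)"]
      by (subst ennreal_plus[symmetric]) (auto simp: distrib_left distrib_right)
  qed
  finally show ?thesis .
qed

lemma integrable_riesz_outside:
  assumes "0 < s" "0 < r"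
  shows "integrable lborel (\<lambda>z::'a::euclidean_space. frac_kernel s z * indicator {z. r \<le> norm z} z)"
    and "(LBINT (z::'a). frac_kernel s z * indicator {z. r \<le> norm z} z) = omega DIM('a) * r powr (- s) / s"
proof -
  have eq: "(\<integral>\<^sup>+ z. ennreal (frac_kernel s z * indicator {z. r \<le> norm z} z) \<partial>(lborel :: 'a measure))
     = ennreal (omega DIM('a) * r powr (- s) / s)"
    using nn_integral_riesz_outside[OF assms, where 'a='a]
    by (simp add: ennreal_mult' ennreal_indicator)
  show "integrable lborel (\<lambda>z::'a. frac_kernel s z * indicator {z. r \<le> norm z} z)"
    by (rule integrableI_nn_integral_finite[OF _ _ eq]) auto
  show "(LBINT (z::'a). frac_kernel s z * indicator {z. r \<le> norm z} z) = omega DIM('a) * r powr (- s) / s"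
    using eq assms omega_pos[of "DIM('a)"] by (subst integral_eq_nn_integral) auto
qed

section \<open>Thin strips\<close>
lemma emeasure_lborel_translate:
  fixes S :: "'a::euclidean_space set"
  assumes "S \<in> sets borel"
  shows "emeasure lborel {x. x - v \<in> S} = emeasure lborel S"
proof -
  have "emeasure lborel S = emeasure (distr lborel borel ((+) (- v))) S"
    by (simp only: lborel_distr_plus)
  also have "\<dots> = emeasure lborel ((+) (- v) -` S)"
    using assms by (subst emeasure_distr) auto
  also have "(+) (- v) -` S = {x. x - v \<in> S}" by auto
  finally show ?thesis by simp
qed

text \<open>
  For constant \<open>h\<close> this is a slab; for \<open>h\<close> describing a piece of a boundary it is a layer along it.
\<close>
definition strip :: "'a::euclidean_space \<Rightarrow> ('a \<Rightarrow> real) \<Rightarrow> real \<Rightarrow> 'a set" where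
  "strip e h t = {x. h (x - (x \<bullet> e) *\<^sub>R e) < x \<bullet> e \<and> x \<bullet> e \<le> h (x - (x \<bullet> e) *\<^sub>R e) + t}"

lemma strip_borel:
  assumes [measurable]: "h \<in> borel_measurable borel"
  shows "strip e h t \<in> sets borel"
  unfolding strip_def by measurable

text \<open>
  About \<open>R / t\<close> translates of the piece of the strip in direction \<open>e\<close>, by multiples of \<open>t\<close>, are
  pairwise disjoint and fit into a ball of twice the radius.
\<close>
lemma emeasure_strip_le:
  fixes p e :: "'a::euclidean_space"
  assumes e: "norm e = 1" and h: "h \<in> borel_measurable borel" and t: "0 < t" "t \<le> R"
  shows "emeasure lborel (cball p R \<inter> strip e h t)
    \<le> ennreal (2 * t / R * (unit_ball_vol DIM('a) * (2 * R) ^ DIM('a)))"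
proof -
  define S where "S = cball p R \<inter> strip e h t"
  have S[measurable]: "S \<in> sets borel"
    unfolding S_def using strip_borel[OF h] by auto
  have ee: "e \<bullet> e = 1" using e by (simp add: dot_square_norm)
  define m where "m = nat \<lfloor>R / t\<rfloor>"
  define T where "T j = {x. x - (real j * t) *\<^sub>R e \<in> S}" for j :: nat
  have T[measurable]: "T j \<in> sets borel" for j
    unfolding T_def by measurable
  have Rt: "1 \<le> R / t" using t by simp
  then have m1: "real m \<le> R / t" "R / t < real m + 1" "1 \<le> real m"
    using floor_correct[of "R / t"] one_le_floor[of "R / t"] unfolding m_def by auto
  have mt: "real m * t \<le> R" using m1(1) t by (simp add: field_simps)
  have strip_T: "h (x - (x \<bullet> e) *\<^sub>R e) + real j * t < x \<bullet> e"
       "x \<bullet> e \<le> h (x - (x \<bullet> e) *\<^sub>R e) + (real j + 1) * t" if "x \<in> T j" for x j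
  proof -
    define y where "y = x - (real j * t) *\<^sub>R e"
    have "y \<in> S" using that by (simp add: T_def y_def)
    then have yS: "h (y - (y \<bullet> e) *\<^sub>R e) < y \<bullet> e" "y \<bullet> e \<le> h (y - (y \<bullet> e) *\<^sub>R e) + t"
      by (auto simp: S_def strip_def)
    have ye: "y \<bullet> e = x \<bullet> e - real j * t"
      by (simp add: y_def inner_diff_left ee)
    have yx: "y - (y \<bullet> e) *\<^sub>R e = x - (x \<bullet> e) *\<^sub>R e"
      unfolding ye by (simp add: y_def algebra_simps)
    show "h (x - (x \<bullet> e) *\<^sub>R e) + real j * t < x \<bullet> e"
       "x \<bullet> e \<le> h (x - (x \<bullet> e) *\<^sub>R e) + (real j + 1) * t"
      using yS[unfolded yx] unfolding ye by (auto simp: distrib_right)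
  qed
  have disj: "disjoint_family_on T {..<m}"
    unfolding disjoint_family_on_def
  proof (intro ballI impI)
    fix i j :: nat assume "i \<noteq> j"
    have False if x: "x \<in> T i" "x \<in> T j" and ij: "i < j" for x and i j :: nat
    proof -
      have "(real i + 1) * t \<le> real j * t"
        using ij t by (intro mult_right_mono) auto
      then show False using strip_T[OF x(1)] strip_T[OF x(2)] by linarith
    qed
    then show "T i \<inter> T j = {}"
      using \<open>i \<noteq> j\<close> by (metis disjoint_iff nat_neq_iff)
  qed
  have sub: "(\<Union>j<m. T j) \<subseteq> cball p (2 * R)"
  proof clarify
    fix x j assume j: "j < m" and x: "x \<in> T j"
    have "dist p (x - (real j * t) *\<^sub>R e) \<le> R"
      using x by (auto simp: T_def S_def)
    moreover have "dist (x - (real j * t) *\<^sub>R e) x = real j * t"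
      using e t by (simp add: dist_norm)
    moreover have "real j * t \<le> real m * t"
      using j t by (intro mult_right_mono) auto
    ultimately show "x \<in> cball p (2 * R)"
      using mt dist_triangle[of p x "x - (real j * t) *\<^sub>R e"] by (auto simp: mem_cball)
  qed
  have "of_nat m * emeasure lborel S = (\<Sum>j<m. emeasure lborel (T j))"
    unfolding T_def by (simp add: emeasure_lborel_translate)
  also have "\<dots> = emeasure lborel (\<Union>j<m. T j)"
    using disj by (intro sum_emeasure) auto
  also have "\<dots> \<le> emeasure lborel (cball p (2 * R))"
    by (intro emeasure_mono sub) auto
  also have "\<dots> = ennreal (unit_ball_vol DIM('a) * (2 * R) ^ DIM('a))"
    using t by (simp add: emeasure_cball)
  finally have le: "of_nat m * emeasure lborel S \<le> ennreal (unit_ball_vol DIM('a) * (2 * R) ^ DIM('a))" .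
  have fin: "emeasure lborel S < \<infinity>"
    using emeasure_mono[of S "cball p R" lborel] emeasure_lborel_cball_finite[of p R]
    by (auto simp: S_def intro: le_less_trans)
  define \<mu> where "\<mu> = measure lborel S"
  have em: "emeasure lborel S = ennreal \<mu>"
    using fin by (simp add: \<mu>_def emeasure_eq_ennreal_measure)
  have "ennreal (real m * \<mu>) \<le> ennreal (unit_ball_vol DIM('a) * (2 * R) ^ DIM('a))"
    using le by (simp add: em ennreal_mult' ennreal_of_nat_eq_real_of_nat)
  then have m\<mu>: "real m * \<mu> \<le> unit_ball_vol DIM('a) * (2 * R) ^ DIM('a)"
    using t by (subst (asm) ennreal_le_iff) auto
  have "t * 1 \<le> t * real m"
    using m1 t by (intro mult_left_mono) auto
  moreover have "R < t * real m + t"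
    using m1(2) t by (simp add: field_simps)
  ultimately have "R \<le> 2 * t * real m"
    by linarith
  then have "1 \<le> 2 * t / R * real m"
    using t by (simp add: field_simps)
  then have "\<mu> \<le> (2 * t / R * real m) * \<mu>"
    using mult_right_mono[of 1 "2 * t / R * real m" \<mu>] by (simp add: \<mu>_def)
  also have "\<dots> = 2 * t / R * (real m * \<mu>)" by simp
  also have "\<dots> \<le> 2 * t / R * (unit_ball_vol DIM('a) * (2 * R) ^ DIM('a))"
    using t by (intro mult_left_mono m\<mu>) auto
  finally show ?thesis
    unfolding S_def[symmetric] em by (rule ennreal_leI)
qed

text \<open>
  The inequality \<open>\<kappa> \<bar>z\<bar>\<^sup>2 < z \<bullet> e\<close> describes the open ball of radius \<open>1 / (2 \<kappa>)\<close> that touches the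
  hyperplane orthogonal to \<open>e\<close> at the origin. The gap is what this ball and its mirror image leave
  over of the ball of radius \<open>r\<close>.
\<close>
definition tangent_gap :: "real \<Rightarrow> real \<Rightarrow> 'a::euclidean_space \<Rightarrow> 'a set" where
  "tangent_gap r \<kappa> e = {z. norm z < r \<and> \<bar>z \<bullet> e\<bar> \<le> \<kappa> * (norm z)\<^sup>2}"

lemma tangent_gap_borel [measurable]: "tangent_gap r \<kappa> e \<in> sets borel"
  unfolding tangent_gap_def by measurable

lemma tangent_gap_uminus [simp]: "- z \<in> tangent_gap r \<kappa> e \<longleftrightarrow> z \<in> tangent_gap r \<kappa> e"
  by (simp add: tangent_gap_def)

lemma dyadic_annulus:
  fixes x r :: real
  assumes "0 < x" "x < r"
  obtains k :: nat where "r / 2 ^ k / 2 \<le> x" "x < r / 2 ^ k"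
proof -
  have "(\<lambda>k. r / 2 ^ k) \<longlonglongrightarrow> 0"
    by real_asymp
  then have "eventually (\<lambda>k. r / 2 ^ k < x) sequentially"
    using assms by (intro order_tendstoD) auto
  then obtain k0 where "r / 2 ^ k0 \<le> x"
    by (auto simp: eventually_sequentially intro: less_imp_le)
  define k where "k = (LEAST k. r / 2 ^ k \<le> x)"
  have k: "r / 2 ^ k \<le> x" unfolding k_def by (rule LeastI) fact
  then have "k \<noteq> 0" using assms by (intro notI) auto
  then obtain j where j: "k = Suc j" by (cases k) auto
  have "\<not> r / 2 ^ j \<le> x"
    using not_less_Least[of j "\<lambda>k. r / 2 ^ k \<le> x"] j by (auto simp: k_def)
  then show thesis using that[of j] k j by (simp add: field_simps)
qed

text \<open>
  In a dyadic annulus of radius \<open>R\<close> the gap lies in a slab of thickness of order \<open>R\<^sup>2\<close>, one power of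
  \<open>R\<close> thinner than the annulus, so that the annulus contributes \<open>R\<^sup>1\<^sup>-\<^sup>s\<close>. The series of these
  contributions converges uniformly for \<open>s \<le> 1/2\<close> and, the bound on the slab being invariant under
  rotation, uniformly in \<open>e\<close>.
\<close>
lemma nn_integral_tangent_gap:
  fixes r \<kappa> :: real
  assumes r: "0 < r" "r \<le> 1" and \<kappa>: "0 < \<kappa>" "4 * \<kappa> * r \<le> 1"
  shows "\<exists>C\<ge>0. \<forall>e::'a::euclidean_space. \<forall>s. norm e = 1 \<longrightarrow> 0 < s \<longrightarrow> s \<le> 1/2 \<longrightarrow>
     (\<integral>\<^sup>+ z. ennreal (frac_kernel s z) * indicator (tangent_gap r \<kappa> e) z \<partial>lborel) \<le> ennreal C"
proof -
  define R where "R k = r / 2 ^ k" for k :: nat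
  define V where "V = unit_ball_vol DIM('a)"
  define d where "d = DIM('a)"
  \<comment> \<open>the first factor bounds the kernel on an annulus, the second the slab; \<open>q\<close> is the ratio for
    \<open>s = 1/2\<close>, the worst case\<close>
  define C0 where "C0 = 2 ^ (d + 1) * (8 * \<kappa> * V * 2 ^ d)"
  define q :: real where "q = 2 powr (- 1 / 2)"
  have q: "0 < q" "q < 1" unfolding q_def using powr_less_mono[of "-1/2" 0 "2::real"] by auto
  have C0: "0 \<le> C0" using \<kappa> by (simp add: C0_def V_def)
  have R: "0 < R k" "R k \<le> 1" "4 * \<kappa> * R k \<le> 1" for k
  proof -
    have "R k \<le> r" using r by (simp add: R_def field_simps)
    then show "R k \<le> 1" "4 * \<kappa> * R k \<le> 1"
      using r \<kappa> mult_left_mono[of "R k" r "4 * \<kappa>"] by linarith+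
  qed (use r in \<open>simp add: R_def\<close>)
  have "(\<integral>\<^sup>+ z. ennreal (riesz (real d + s) z) * indicator (tangent_gap r \<kappa> e) z \<partial>lborel) \<le> ennreal (C0 / (1 - q))"
    if e: "norm e = 1" and s: "0 < s" "s \<le> 1/2" for e :: 'a and s :: real
  proof -
    define A where "A k = {z. R k / 2 \<le> norm z \<and> norm z < R k} \<inter> tangent_gap r \<kappa> e" for k
    have A[measurable]: "A k \<in> sets borel" for k unfolding A_def by measurable
    \<comment> \<open>the origin lies in no annulus, but the kernel vanishes there\<close>
    have "(\<integral>\<^sup>+ z. ennreal (riesz (real d + s) z) * indicator (tangent_gap r \<kappa> e) z \<partial>lborel)
      \<le> (\<integral>\<^sup>+ z. (\<Sum>k. ennreal (riesz (real d + s) z) * indicator (A k) z) \<partial>lborel)"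
    proof (intro nn_integral_mono)
      fix z :: 'a
      show "ennreal (riesz (real d + s) z) * indicator (tangent_gap r \<kappa> e) z
         \<le> (\<Sum>k. ennreal (riesz (real d + s) z) * indicator (A k) z)"
      proof (cases "z \<in> tangent_gap r \<kappa> e \<and> z \<noteq> 0")
        case True
        then have "0 < norm z" "norm z < r" by (auto simp: tangent_gap_def)
        then obtain k where "r / 2 ^ k / 2 \<le> norm z" "norm z < r / 2 ^ k"
          by (rule dyadic_annulus)
        then have "z \<in> A k"
          using True by (auto simp: A_def R_def)
        then have "ennreal (riesz (real d + s) z) * indicator (tangent_gap r \<kappa> e) z
           = (\<Sum>k\<in>{k}. ennreal (riesz (real d + s) z) * indicator (A k) z)"
          using True by simp
        also have "\<dots> \<le> (\<Sum>k. ennreal (riesz (real d + s) z) * indicator (A k) z)"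
          by (intro sum_le_suminf) auto
        finally show ?thesis .
      qed (auto simp: riesz_def)
    qed
    also have "\<dots> = (\<Sum>k. \<integral>\<^sup>+ z. ennreal (riesz (real d + s) z) * indicator (A k) z \<partial>lborel)"
      by (intro nn_integral_suminf) measurable
    also have "\<dots> \<le> (\<Sum>k. ennreal (C0 * q ^ k))"
    proof (intro suminf_le allI)
      fix k
      have sub: "A k \<subseteq> cball 0 (R k) \<inter> strip e (\<lambda>_. - 2 * \<kappa> * (R k)\<^sup>2) (4 * \<kappa> * (R k)\<^sup>2)"
      proof
        fix z assume z: "z \<in> A k"
        then have n: "norm z < R k" "\<bar>z \<bullet> e\<bar> \<le> \<kappa> * (norm z)\<^sup>2"
          by (auto simp: A_def tangent_gap_def)
        have "\<kappa> * (norm z)\<^sup>2 \<le> \<kappa> * (R k)\<^sup>2"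
          using n \<kappa> by (intro mult_left_mono power_mono) auto
        moreover have "0 < \<kappa> * (R k)\<^sup>2" using \<kappa> R[of k] by simp
        ultimately show "z \<in> cball 0 (R k) \<inter> strip e (\<lambda>_. - 2 * \<kappa> * (R k)\<^sup>2) (4 * \<kappa> * (R k)\<^sup>2)"
          using n by (auto simp: strip_def abs_le_iff)
      qed
      have "(\<integral>\<^sup>+ z. ennreal (riesz (real d + s) z) * indicator (A k) z \<partial>lborel)
        \<le> (\<integral>\<^sup>+ z. ennreal (2 ^ (d + 1) * R k powr (- (d + s))) * indicator (A k) z \<partial>lborel)"
      proof (intro nn_integral_mono)
        fix z :: 'a
        have "riesz (real d + s) z \<le> 2 ^ (d + 1) * R k powr (- (d + s))" if "z \<in> A k"
        proof -
          have z: "R k / 2 \<le> norm z" "0 < norm z" using that R[of k] by (auto simp: A_def)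
          have "riesz (real d + s) z = norm z powr (- (d + s))"
            unfolding riesz_def powr_minus_divide ..
          also have "\<dots> \<le> (R k / 2) powr (- (d + s))"
            using z R[of k] s by (intro powr_mono2') auto
          also have "\<dots> = 2 powr (d + s) * R k powr (- (d + s))"
            unfolding powr_minus_divide using R[of k] by (simp add: powr_divide)
          also have "\<dots> \<le> 2 powr (real (d + 1)) * R k powr (- (d + s))"
            using s by (intro mult_right_mono powr_mono) auto
          also have "2 powr (real (d + 1)) = (2::real) ^ (d + 1)" by (rule powr_realpow) simp
          finally show ?thesis .
        qed
        then show "ennreal (riesz (real d + s) z) * indicator (A k) z
          \<le> ennreal (2 ^ (d + 1) * R k powr (- (d + s))) * indicator (A k) z"
          by (auto simp: indicator_def intro: ennreal_leI)
      qed
      also have "\<dots> = ennreal (2 ^ (d + 1) * R k powr (- (d + s))) * emeasure lborel (A k)"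
        by (simp add: nn_integral_cmult_indicator)
      also have "\<dots> \<le> ennreal (2 ^ (d + 1) * R k powr (- (d + s))) *
          emeasure lborel (cball 0 (R k) \<inter> strip e (\<lambda>_. - 2 * \<kappa> * (R k)\<^sup>2) (4 * \<kappa> * (R k)\<^sup>2))"
        by (intro mult_left_mono emeasure_mono sub) (auto intro!: sets.Int strip_borel)
      also have "\<dots> \<le> ennreal (2 ^ (d + 1) * R k powr (- (d + s))) *
          ennreal (2 * (4 * \<kappa> * (R k)\<^sup>2) / R k * (V * (2 * R k) ^ d))"
        unfolding V_def d_def using e \<kappa> R[of k]
        by (intro mult_left_mono emeasure_strip_le) (auto simp: power2_eq_square)
      also have "\<dots> = ennreal (2 ^ (d + 1) * R k powr (- (d + s)) *
          (2 * (4 * \<kappa> * (R k)\<^sup>2) / R k * (V * (2 * R k) ^ d)))"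
        using \<kappa> R[of k] by (subst ennreal_mult[symmetric]) (auto simp: V_def)
      also have "2 ^ (d + 1) * R k powr (- (d + s)) * (2 * (4 * \<kappa> * (R k)\<^sup>2) / R k * (V * (2 * R k) ^ d))
         = C0 * R k powr (1 - s)"
      proof -
        have "R k powr (1 - s) = R k powr (- (d + s)) * R k powr (real (d + 1))"
          by (simp flip: powr_add)
        also have "R k powr (real (d + 1)) = R k ^ (d + 1)" using R[of k] by (intro powr_realpow) simp
        finally show ?thesis
          by (simp add: C0_def power2_eq_square power_mult_distrib)
      qed
      also have "C0 * R k powr (1 - s) \<le> C0 * q ^ k"
      proof (intro mult_left_mono C0)
        have "R k powr (1 - s) \<le> R k powr (1 / 2)"
          using R[of k] s by (intro powr_mono') auto
        also have "\<dots> \<le> (1 / 2 ^ k) powr (1 / 2)"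
          using r by (intro powr_mono2) (auto simp: R_def divide_right_mono)
        also have "\<dots> = q ^ k"
          by (simp add: q_def powr_realpow[symmetric] powr_powr powr_minus_divide[symmetric] del: powr_realpow)
        finally show "R k powr (1 - s) \<le> q ^ k" .
      qed
      finally show "(\<integral>\<^sup>+ z. ennreal (riesz (real d + s) z) * indicator (A k) z \<partial>lborel) \<le> ennreal (C0 * q ^ k)"
        by (simp add: ennreal_leI)
    qed auto
    also have "\<dots> = ennreal (C0 / (1 - q))"
      using q C0 sums_mult[OF geometric_sums[of q], of C0]
      by (intro suminf_ennreal_eq) auto
    finally show ?thesis .
  qed
  moreover have "0 \<le> C0 / (1 - q)" using C0 q by simp
  ultimately show ?thesis unfolding d_def by blast
qed

section \<open>The integrand of the energy\<close>
lemma continuous_on_g_fun: "continuous_on A (g_fun n s)"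
  unfolding g_fun_def by (intro continuous_intros) (auto simp: add_nonneg_eq_0_iff)

lemma g_fun_measurable [measurable]: "g_fun n s \<in> borel_measurable borel"
  unfolding g_fun_def by measurable

lemma g_fun_pos: "0 < g_fun n s t"
  by (auto simp: g_fun_def add_nonneg_eq_0_iff)

lemma g_fun_uminus [simp]: "g_fun n s (- t) = g_fun n s t"
  by (simp add: g_fun_def)

lemma g_fun_integrable:
  assumes "1 \<le> n" "0 < s"
  shows "integrable lborel (g_fun n s)"
proof (rule Bochner_Integration.integrable_bound)
  show "integrable lborel (\<lambda>t::real. indicator {-1..1} t + riesz (real DIM(real) + 1) t * indicator {t. 1 \<le> norm t} t)"
    by (intro Bochner_Integration.integrable_add integrable_riesz_outside) auto
  show "AE t in lborel. norm (g_fun n s t) \<le>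
     norm (indicator {-1..1} t + riesz (real DIM(real) + 1) t * indicator {t. 1 \<le> norm t} t)"
  proof (intro AE_I2)
    fix t :: real
    have le: "g_fun n s t \<le> (1 + t\<^sup>2) powr (- 1)"
      unfolding g_fun_def using assms by (intro powr_mono) auto
    show "norm (g_fun n s t) \<le>
     norm (indicator {-1..1} t + riesz (real DIM(real) + 1) t * indicator {t. 1 \<le> norm t} t)"
    proof (cases "\<bar>t\<bar> \<le> 1")
      case True
      have "(1 + t\<^sup>2) powr (- 1) = 1 / (1 + t\<^sup>2)"
        unfolding powr_minus_divide by simp
      then have "(1 + t\<^sup>2) powr (- 1) \<le> 1"
        by (simp add: divide_le_eq_1 add_pos_nonneg)
      then have "norm (g_fun n s t) \<le> 1" using le g_fun_pos[of n s t] by simp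
      also have "1 \<le> norm (indicator {-1..1} t + riesz (real DIM(real) + 1) t * indicator {t. 1 \<le> norm t} t)"
        using True riesz_nonneg[of 2 t] by (auto simp: indicator_def)
      finally show ?thesis .
    next
      case False
      have "(1 + t\<^sup>2) powr (- 1) = 1 / (1 + t\<^sup>2)"
        unfolding powr_minus_divide by simp
      also have "\<dots> \<le> 1 / t\<^sup>2"
        using False by (intro divide_left_mono) (auto simp: add_pos_nonneg)
      also have "\<dots> = riesz 2 t"
        using False by (simp add: riesz_def)
      finally show ?thesis
        using le g_fun_pos[of n s t] riesz_nonneg[of 2 t] False by (auto simp: indicator_def)
    qed
  qed
qed simp

lemma G_fun_has_derivative: "(G_fun n s has_real_derivative g_fun n s x) (at x)"
proof -
  define b where "b = \<bar>x\<bar> + 1"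
  have "((\<lambda>u. LBINT y=ereal 0..ereal u. g_fun n s y) has_vector_derivative g_fun n s x) (at x within {-b..b})"
    by (rule interval_integral_FTC2) (auto simp: b_def continuous_on_g_fun)
  then have "((\<lambda>u. LBINT y=ereal 0..ereal u. g_fun n s y) has_vector_derivative g_fun n s x) (at x)"
    by (subst (asm) at_within_interior) (auto simp: b_def interior_atLeastAtMost_real)
  then show ?thesis
    by (simp add: G_fun_def[abs_def] has_real_derivative_iff_has_vector_derivative zero_ereal_def)
qed

lemma continuous_on_G_fun: "continuous_on A (G_fun n s)"
  by (intro continuous_at_imp_continuous_on ballI DERIV_isCont[OF G_fun_has_derivative])

lemma G_fun_measurable [measurable]: "G_fun n s \<in> borel_measurable borel"
  by (intro borel_measurable_continuous_onI continuous_on_G_fun)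

lemma calG_has_derivative: "(calG n s has_real_derivative G_fun n s x) (at x)"
proof -
  define b where "b = \<bar>x\<bar> + 1"
  have "((\<lambda>u. LBINT y=ereal 0..ereal u. G_fun n s y) has_vector_derivative G_fun n s x) (at x within {-b..b})"
    by (rule interval_integral_FTC2) (auto simp: b_def continuous_on_G_fun)
  then have "((\<lambda>u. LBINT y=ereal 0..ereal u. G_fun n s y) has_vector_derivative G_fun n s x) (at x)"
    by (subst (asm) at_within_interior) (auto simp: b_def interior_atLeastAtMost_real)
  then show ?thesis
    by (simp add: calG_def[abs_def] has_real_derivative_iff_has_vector_derivative zero_ereal_def)
qed

lemma calG_measurable [measurable]: "calG n s \<in> borel_measurable borel"
  by (intro borel_measurable_continuous_onI continuous_at_imp_continuous_on ballI
      DERIV_isCont[OF calG_has_derivative])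

lemma G_fun_0 [simp]: "G_fun n s 0 = 0"
  by (simp add: G_fun_def zero_ereal_def)

lemma G_fun_mono: "a \<le> b \<Longrightarrow> G_fun n s a \<le> G_fun n s b"
  by (rule DERIV_nonneg_imp_nondecreasing)
     (auto intro!: exI[of _ "g_fun n s _"] G_fun_has_derivative less_imp_le g_fun_pos)

lemma G_fun_uminus: "G_fun n s (- t) = - G_fun n s t"
proof -
  have "((\<lambda>t. G_fun n s t + G_fun n s (- t)) has_real_derivative 0) (at x)" for x
    by (auto intro!: derivative_eq_intros DERIV_chain2[OF G_fun_has_derivative] G_fun_has_derivative)
  then have "G_fun n s t + G_fun n s (- t) = G_fun n s 0 + G_fun n s (- 0)"
    by (intro DERIV_isconst_all allI)
  then show ?thesis by simp
qed

definition G_bound :: "nat \<Rightarrow> real \<Rightarrow> real" where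
  "G_bound n s = (LBINT t. g_fun n s t)"

lemma G_bound_nonneg: "0 \<le> G_bound n s"
  unfolding G_bound_def using g_fun_pos[of n s]
  by (intro Bochner_Integration.integral_nonneg) (auto intro: less_imp_le)

lemma G_fun_nonneg_eq: "0 \<le> t \<Longrightarrow> G_fun n s t = (LBINT \<tau>. g_fun n s \<tau> * indicator {0<..<t} \<tau>)"
  by (simp add: G_fun_def interval_lebesgue_integral_def zero_ereal_def einterval_eq
      set_lebesgue_integral_def mult.commute)

lemma abs_G_fun_le:
  assumes "1 \<le> n" "0 < s"
  shows "\<bar>G_fun n s t\<bar> \<le> G_bound n s"
proof -
  have "\<bar>G_fun n s t\<bar> \<le> G_bound n s" if "0 \<le> t" for t
  proof -
    have "G_fun n s t \<le> G_bound n s"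
      unfolding G_fun_nonneg_eq[OF that] G_bound_def
      using g_fun_pos[of n s]
      by (intro integral_mono integrable_real_mult_indicator g_fun_integrable assms)
         (auto simp: indicator_def less_imp_le)
    moreover have "0 \<le> G_fun n s t" using G_fun_mono[OF that, of n s] by simp
    ultimately show ?thesis by simp
  qed
  from this[of t] this[of "- t"] show ?thesis
    by (cases "0 \<le> t") (auto simp: G_fun_uminus)
qed

text \<open>The graph of the convex function \<open>calG\<close> lies above its tangents, whose slopes are \<open>G_fun\<close>.\<close>
lemma calG_convex: "G_fun n s b * (a - b) \<le> calG n s a - calG n s b"
proof -
  consider "a < b" | "a = b" | "b < a" by linarith
  then show ?thesis
  proof cases
    case 1
    then obtain z where "a < z" "z < b" "calG n s b - calG n s a = (b - a) * G_fun n s z"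
      using MVT2[of a b "calG n s" "G_fun n s"] calG_has_derivative by blast
    then show ?thesis
      using mult_right_mono[OF G_fun_mono[of z b n s], of "b - a"] 1 by (simp add: algebra_simps)
  next
    case 3
    then obtain z where "b < z" "z < a" "calG n s a - calG n s b = (a - b) * G_fun n s z"
      using MVT2[of b a "calG n s" "G_fun n s"] calG_has_derivative by blast
    then show ?thesis
      using mult_right_mono[OF G_fun_mono[of b z n s], of "a - b"] 3 by (simp add: algebra_simps)
  qed auto
qed

lemma calG_lipschitz:
  assumes "1 \<le> n" "0 < s"
  shows "\<bar>calG n s a - calG n s b\<bar> \<le> G_bound n s * \<bar>a - b\<bar>"
proof -
  have "\<bar>G_fun n s x * (a - b)\<bar> \<le> G_bound n s * \<bar>a - b\<bar>" for x
    unfolding abs_mult by (intro mult_right_mono abs_G_fun_le assms) auto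
  note * = this[of a] this[of b]
  have "calG n s a - calG n s b \<le> G_fun n s a * (a - b)"
    using calG_convex[of n s a b] by (simp add: algebra_simps)
  then show ?thesis
    using * calG_convex[of n s b a] unfolding abs_le_iff by linarith
qed

text \<open>
  \<open>G_fun\<close> measures the imbalance of the even density \<open>g_fun\<close> between the two sides of \<open>a\<close>. This is
  what turns a curvature of graphs into a curvature of sets.
\<close>
lemma integral_sign_g_fun:
  assumes "1 \<le> n" "0 < s"
  shows "(LBINT t. (if t \<le> a then 1 else - 1) * g_fun n s t) = 2 * G_fun n s a"
proof -
  note g_int = g_fun_integrable[OF assms]
  have int: "integrable lborel (\<lambda>t. (if t \<le> a then 1 else - 1) * g_fun n s t)" for a
    by (rule Bochner_Integration.integrable_bound[OF g_int]) auto
  have refl: "(LBINT t. (if t \<le> - a then 1 else - 1) * g_fun n s t) =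
      - (LBINT t. (if t \<le> a then 1 else - 1) * g_fun n s t)" for a
  proof -
    have "(LBINT t. (if t \<le> - a then 1 else - 1) * g_fun n s t)
      = (LBINT t. (if - t \<le> - a then 1 else - 1) * g_fun n s (- t))"
      by (subst lborel_integral_real_affine[where c="-1" and t=0]) auto
    also have "\<dots> = (LBINT t. - ((if t \<le> a then 1 else - 1) * g_fun n s t))"
      by (intro integral_cong_AE eventually_mono[OF AE_lborel_singleton[of a]]) auto
    finally show ?thesis by simp
  qed
  have pos: "(LBINT t. (if t \<le> a then 1 else - 1) * g_fun n s t) = 2 * G_fun n s a" if "0 \<le> a" for a
  proof -
    have int2: "integrable lborel (\<lambda>t. 2 * (g_fun n s t * indicator {0<..<a} t))"
      by (rule Bochner_Integration.integrable_bound[where f="\<lambda>t. 2 * g_fun n s t"])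
         (use g_int in \<open>auto simp: indicator_def\<close>)
    \<comment> \<open>passing from threshold 0 to threshold \<open>a\<close> changes the sign from -1 to 1 on the interval between\<close>
    have "(LBINT t. (if t \<le> a then 1 else - 1) * g_fun n s t)
       = (LBINT t. 2 * (g_fun n s t * indicator {0<..<a} t) + (if t \<le> 0 then 1 else - 1) * g_fun n s t)"
      using that
      by (intro integral_cong_AE eventually_mono[OF AE_lborel_singleton[of a]])
         (auto simp: indicator_def)
    also have "\<dots> = 2 * G_fun n s a + (LBINT t. (if t \<le> 0 then 1 else - 1) * g_fun n s t)"
      using int2 int by (subst Bochner_Integration.integral_add) (auto simp: G_fun_nonneg_eq[OF that])
    also have "(LBINT t. (if t \<le> 0 then 1 else - 1) * g_fun n s t) = 0"
      using refl[of 0] by simp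
    finally show ?thesis by simp
  qed
  show ?thesis
  proof (cases "0 \<le> a")
    case False
    then show ?thesis using pos[of "- a"] refl[of a] by (simp add: G_fun_uminus)
  qed (rule pos)
qed

lemma riesz_Pair:
  fixes z :: "'a::euclidean_space" and t :: real
  assumes "z \<noteq> 0"
  shows "frac_kernel s (z, norm z * t) = riesz (real DIM('a \<times> real) + s) z * g_fun DIM('a) s t"
proof -
  have "norm (z, norm z * t) = sqrt ((norm z)\<^sup>2 * (1 + t\<^sup>2))"
    by (simp add: norm_Pair power_mult_distrib distrib_left)
  then have "norm (z, norm z * t) = norm z * sqrt (1 + t\<^sup>2)"
    by (simp add: real_sqrt_mult)
  moreover have "sqrt (1 + t\<^sup>2) powr p = (1 + t\<^sup>2) powr (p / 2)" for p
    by (simp add: powr_half_sqrt[symmetric] powr_powr)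
  moreover have "g_fun DIM('a) s t = 1 / (1 + t\<^sup>2) powr ((real DIM('a) + 1 + s) / 2)"
    unfolding g_fun_def minus_divide_left[symmetric] powr_minus_divide ..
  ultimately show ?thesis
    by (simp add: riesz_def powr_mult add_ac)
qed

text \<open>
  Integrating the signed kernel of \<open>\<real>\<^sup>n\<^sup>+\<^sup>1\<close> along the vertical line over \<open>z\<close> gives the integrand of
  the first variation of the energy. The substitution \<open>t = - \<bar>z\<bar> \<tau>\<close> reduces the claim to
  \<open>integral_sign_g_fun\<close>.
\<close>
lemma integral_sign_riesz_slice:
  fixes z :: "'a::euclidean_space"
  assumes z: "z \<noteq> 0" and s: "0 < s"
  shows "(LBINT t. (if b \<le> a + t then 1 else - 1) * frac_kernel s (z, t))
     = 2 * G_fun DIM('a) s ((a - b) / norm z) * frac_kernel s z"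
proof -
  have nz: "norm z > 0" using z by simp
  have "(LBINT t. (if b \<le> a + t then 1 else - 1) * frac_kernel s (z, t))
    = norm z * (LBINT t. (if b \<le> a - norm z * t then 1 else - 1) * frac_kernel s (z, norm z * (- t)))"
    using nz by (subst lborel_integral_real_affine[where c="- norm z" and t=0]) auto
  also have "\<dots> = norm z * (LBINT t. riesz (real DIM('a \<times> real) + s) z * ((if t \<le> (a - b) / norm z then 1 else - 1) * g_fun DIM('a) s t))"
    using nz by (subst riesz_Pair[OF z]) (simp add: field_simps cong: if_cong)
  also have "\<dots> = norm z * riesz (real DIM('a \<times> real) + s) z * (2 * G_fun DIM('a) s ((a - b) / norm z))"
    using s by (simp add: integral_sign_g_fun)
  also have "norm z * riesz (real DIM('a \<times> real) + s) z = frac_kernel s z"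
    using nz by (simp add: riesz_def powr_add)
  finally show ?thesis by simp
qed

section \<open>Fractional curvature of a subgraph\<close>
lemma lborel_distr_uminus_euclidean: "distr lborel borel uminus = (lborel :: 'a::euclidean_space measure)"
  by (subst lborel_affine[of "-1" 0]) (auto simp: density_1 one_ennreal_def[symmetric])

lemma
  fixes f :: "'a::euclidean_space \<Rightarrow> real"
  assumes [measurable]: "f \<in> borel_measurable borel"
  shows integral_lborel_uminus: "(LBINT x. f (- x)) = (LBINT x. f x)"
    and integrable_lborel_uminus: "integrable lborel (\<lambda>x. f (- x)) \<longleftrightarrow> integrable lborel f"
    and integral_lborel_translate: "(LBINT x. f (c + x)) = (LBINT x. f x)"
    and integrable_lborel_translate: "integrable lborel (\<lambda>x. f (c + x)) \<longleftrightarrow> integrable lborel f"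
proof -
  have "(LBINT x. f x) = integral\<^sup>L (distr lborel borel uminus) f"
    by (simp add: lborel_distr_uminus_euclidean)
  then show "(LBINT x. f (- x)) = (LBINT x. f x)" by (simp add: integral_distr)
  have "(LBINT x. f x) = integral\<^sup>L (distr lborel borel ((+) c)) f"
    by (simp add: lborel_distr_plus)
  then show "(LBINT x. f (c + x)) = (LBINT x. f x)" by (simp add: integral_distr)
  have "integrable lborel f \<longleftrightarrow> integrable (distr lborel borel uminus) f"
    by (simp add: lborel_distr_uminus_euclidean)
  then show "integrable lborel (\<lambda>x. f (- x)) \<longleftrightarrow> integrable lborel f"
    by (simp add: integrable_distr_eq)
  have "integrable lborel f \<longleftrightarrow> integrable (distr lborel borel ((+) c)) f"
    by (simp add: lborel_distr_plus)
  then show "integrable lborel (\<lambda>x. f (c + x)) \<longleftrightarrow> integrable lborel f"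
    by (simp add: integrable_distr_eq)
qed

lemma borel_measurable_fst_snd [measurable]:
  "fst \<in> borel_measurable (borel :: ('a::euclidean_space \<times> 'b::euclidean_space) measure)"
  "snd \<in> borel_measurable (borel :: ('a \<times> 'b) measure)"
  by (intro borel_measurable_continuous_onI continuous_intros)+

text \<open>
  Half the fractional mean curvature at \<open>(x, w x)\<close>, with the singularity removed in the form of the
  cylinder \<open>\<bar>z\<bar> < \<epsilon>\<close> and not of a ball. A cylinder is also invariant under \<open>Z \<mapsto> - Z\<close>, and it is
  compatible with the iterated integral over vertical lines.
\<close>
definition curv :: "real \<Rightarrow> ('a::euclidean_space \<Rightarrow> real) \<Rightarrow> real \<Rightarrow> 'a \<Rightarrow> real" where
  "curv s w \<epsilon> x = (LBINT z. indicator {z. \<epsilon> \<le> norm z} z *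
     (G_fun DIM('a) s ((w x - w (x + z)) / norm z) * frac_kernel s z))"

definition above :: "('a::euclidean_space \<Rightarrow> real) \<Rightarrow> 'a \<Rightarrow> 'a \<times> real \<Rightarrow> real" where
  "above w x Z = (if w (x + fst Z) \<le> w x + snd Z then 1 else - 1)"

lemma cylinder_borel:
  "{Z::'a::euclidean_space \<times> real. \<epsilon> \<le> norm (fst Z)} \<in> sets borel"
  "{Z::'a::euclidean_space \<times> real. norm (fst Z) < \<epsilon>} \<in> sets borel"
  by (auto intro!: borel_closed borel_open closed_Collect_le open_Collect_less continuous_intros)

lemma above_measurable [measurable]:
  assumes [measurable]: "w \<in> borel_measurable borel"
  shows "above w x \<in> borel_measurable borel"
  unfolding above_def borel_prod[symmetric] by measurable

lemma abs_above [simp]: "\<bar>above w x Z\<bar> = 1"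
  by (simp add: above_def)

text \<open>Every integral below that involves the kernel alone converges for this reason.\<close>
lemma integrable_bounded_riesz:
  fixes h :: "'a::euclidean_space \<Rightarrow> real"
  assumes h[measurable]: "h \<in> borel_measurable borel" and s: "0 < s" and r: "0 < r"
    and b: "\<And>z. \<bar>h z\<bar> \<le> c" and 0: "\<And>z. norm z < r \<Longrightarrow> h z = 0"
  shows "integrable lborel (\<lambda>z. h z * frac_kernel s z)"
proof (rule Bochner_Integration.integrable_bound)
  show "integrable lborel (\<lambda>z::'a. c * (frac_kernel s z * indicator {z. r \<le> norm z} z))"
    using s r by (intro integrable_mult_right integrable_riesz_outside)
  show "AE z in lborel. norm (h z * frac_kernel s z)
      \<le> norm (c * (frac_kernel s z * indicator {z. r \<le> norm z} z))"
  proof (intro AE_I2)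
    fix z :: 'a
    have "\<bar>h z\<bar> \<le> \<bar>c\<bar> * indicator {z. r \<le> norm z} z"
      using b[of z] 0[of z] by (auto simp: indicator_def)
    then show "norm (h z * frac_kernel s z)
      \<le> norm (c * (frac_kernel s z * indicator {z. r \<le> norm z} z))"
      using mult_right_mono[of "\<bar>h z\<bar>" "\<bar>c\<bar> * indicator {z. r \<le> norm z} z" "frac_kernel s z"]
      by (simp add: abs_mult mult_ac)
  qed
qed measurable

lemma norm_fst_le_norm: "norm (fst Z) \<le> norm (Z :: 'a::euclidean_space \<times> real)"
  by (metis norm_fst_le prod.collapse)

lemma curv_eq:
  fixes w :: "'a::euclidean_space \<Rightarrow> real"
  assumes [measurable]: "w \<in> borel_measurable borel" and s: "0 < s" and e: "0 < \<epsilon>"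
  shows "2 * curv s w \<epsilon> x =
    (LBINT Z. (indicator {Z. \<epsilon> \<le> norm (fst Z)} Z * above w x Z) * frac_kernel s Z)"
proof -
  let ?f = "\<lambda>Z. (indicator {Z. \<epsilon> \<le> norm (fst Z)} Z * above w x Z) * frac_kernel s Z"
  have [measurable]: "{Z::'a \<times> real. \<epsilon> \<le> norm (fst Z)} \<in> sets borel"
    by (rule cylinder_borel)
  have m: "(\<lambda>Z::'a \<times> real. indicator {Z. \<epsilon> \<le> norm (fst Z)} Z * above w x Z) \<in> borel_measurable borel"
    by measurable
  have "integrable lborel ?f"
  proof (rule integrable_bounded_riesz[OF m s e, of 1])
    fix z :: "'a \<times> real"
    assume "norm z < \<epsilon>"
    then show "indicator {Z. \<epsilon> \<le> norm (fst Z)} z * above w x z = 0"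
      using norm_fst_le_norm[of z] by (auto simp: indicator_def)
  qed (auto simp: indicator_def)
  then have int: "integrable (lborel \<Otimes>\<^sub>M lborel) ?f" by (simp add: lborel_prod)
  have "(LBINT Z. ?f Z) = (LBINT z. LBINT t. ?f (z, t))"
    using lborel_pair.integral_fst'[OF int] by (simp add: lborel_prod)
  also have "\<dots> = (LBINT z. 2 * (indicator {z. \<epsilon> \<le> norm z} z *
     (G_fun DIM('a) s ((w x - w (x + z)) / norm z) * frac_kernel s z)))"
  proof (intro Bochner_Integration.integral_cong refl)
    fix z :: 'a
    show "(LBINT t. ?f (z, t)) = 2 * (indicator {z. \<epsilon> \<le> norm z} z *
     (G_fun DIM('a) s ((w x - w (x + z)) / norm z) * frac_kernel s z))"
    proof (cases "\<epsilon> \<le> norm z")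
      case True
      then have "z \<noteq> 0" using e by auto
      from integral_sign_riesz_slice[OF this s, of "w (x + z)" "w x"] True show ?thesis
        by (simp add: above_def)
    qed simp
  qed
  finally show ?thesis by (simp add: curv_def)
qed

text \<open>
  The mass that the kernel centred at the graph point over \<open>x\<close> gives to the subgraph outside the
  ball of radius \<open>r\<close>.
\<close>
definition below_mass :: "real \<Rightarrow> ('a::euclidean_space \<Rightarrow> real) \<Rightarrow> real \<Rightarrow> 'a \<Rightarrow> real" where
  "below_mass s w r x = (LBINT Z. (indicator {Z. r \<le> norm Z} Z * indicator {Z. w x + snd Z < w (x + fst Z)} Z)
       * frac_kernel s Z)"

text \<open>
  What the cylindrical truncation takes away from the kernel outside the ball of radius \<open>r\<close>. It does
  not depend on the centre, so that its convergence to 0 is uniform.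
\<close>
definition cyl_tail :: "real \<Rightarrow> 'a::euclidean_space itself \<Rightarrow> real \<Rightarrow> real \<Rightarrow> real" where
  "cyl_tail s T r \<epsilon> = (LBINT Z::'a \<times> real. (indicator {Z. r \<le> norm Z} Z * indicator {Z. norm (fst Z) < \<epsilon>} Z)
      * frac_kernel s Z)"

text \<open>
  Outside the ball the sign is \<open>1 - 2 \<chi>\<close> with \<open>\<chi>\<close> the indicator of the subgraph. Inside, average
  over \<open>Z\<close> and \<open>- Z\<close>: unless both lie in the gap, one of them lies in the touching ball and has sign
  \<open>+1\<close>, and then the two signs add up to something nonnegative.
\<close>
lemma curv_lower_bound:
  fixes w :: "'a::euclidean_space \<Rightarrow> real"
  assumes w[measurable]: "w \<in> borel_measurable borel" and s: "0 < s" and \<epsilon>: "0 < \<epsilon>" and r: "0 < r"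
    and tangent: "\<And>Z. norm Z < r \<Longrightarrow> \<kappa> * (norm Z)\<^sup>2 < Z \<bullet> e \<Longrightarrow> w (x + fst Z) \<le> w x + snd Z"
    and near: "(\<integral>\<^sup>+ Z. ennreal (frac_kernel s Z) * indicator (tangent_gap r \<kappa> e) Z \<partial>lborel) \<le> ennreal C"
    and C: "0 \<le> C"
    and far: "below_mass s w r x \<le> B"
  shows "omega DIM('a \<times> real) * r powr (- s) / s - cyl_tail s TYPE('a) r \<epsilon> - 2 * B - C \<le> 2 * curv s w \<epsilon> x"
proof -
  let ?K = "frac_kernel s :: 'a \<times> real \<Rightarrow> real"
  define cut where "cut Z = (indicator {Z. \<epsilon> \<le> norm (fst Z)} Z * above w x Z :: real)" for Z :: "'a \<times> real"
  define out where "out Z = (indicator {Z. r \<le> norm Z} Z :: real)" for Z :: "'a \<times> real"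
  define cyl where "cyl Z = (indicator {Z. norm (fst Z) < \<epsilon>} Z :: real)" for Z :: "'a \<times> real"
  define low where "low Z = (indicator {Z. w x + snd Z < w (x + fst Z)} Z :: real)" for Z :: "'a \<times> real"
  have [measurable]: "cut \<in> borel_measurable borel" "out \<in> borel_measurable borel" "cyl \<in> borel_measurable borel"
    unfolding cut_def out_def cyl_def using cylinder_borel[where 'a='a] by measurable
  have [measurable]: "low \<in> borel_measurable borel"
    unfolding low_def borel_prod[symmetric] by measurable
  have cut_le: "\<bar>cut Z\<bar> \<le> 1" for Z by (auto simp: cut_def indicator_def)
  have cut_0: "cut Z = 0" if "norm Z < \<epsilon>" for Z
    using that norm_fst_le_norm[of Z] by (auto simp: cut_def indicator_def)
  have int_cut: "integrable lborel (\<lambda>Z. cut Z * ?K Z)"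
    by (rule integrable_bounded_riesz[OF _ s \<epsilon>, of _ 1]) (simp_all add: cut_le cut_0)
  have int_out: "integrable lborel (\<lambda>Z. (out Z * cut Z) * ?K Z)"
    using s r cut_le by (intro integrable_bounded_riesz[of _ s r 1]) (auto simp: out_def indicator_def)
  have int_in: "integrable lborel (\<lambda>Z. ((1 - out Z) * cut Z) * ?K Z)"
    using s \<epsilon> cut_le cut_0 by (intro integrable_bounded_riesz[of _ s \<epsilon> 1]) (auto simp: out_def indicator_def)
  have int_cyl: "integrable lborel (\<lambda>Z. (out Z * cyl Z) * ?K Z)"
    using s r by (intro integrable_bounded_riesz[of _ s r 1]) (auto simp: out_def cyl_def indicator_def)
  have int_low: "integrable lborel (\<lambda>Z. (out Z * low Z) * ?K Z)"
    using s r by (intro integrable_bounded_riesz[of _ s r 1]) (auto simp: out_def low_def indicator_def)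
  have int_K: "integrable lborel (\<lambda>Z. out Z * ?K Z)" "(LBINT Z. out Z * ?K Z) = omega DIM('a \<times> real) * r powr (- s) / s"
    using integrable_riesz_outside[OF s r, where 'a="'a \<times> real"] by (simp_all add: out_def mult.commute)
  have "2 * curv s w \<epsilon> x = (LBINT Z. cut Z * ?K Z)"
    unfolding cut_def by (rule curv_eq[OF w s \<epsilon>])
  also have "\<dots> = (LBINT Z. (out Z * cut Z) * ?K Z + ((1 - out Z) * cut Z) * ?K Z)"
    by (intro Bochner_Integration.integral_cong) (auto simp: algebra_simps)
  also have "\<dots> = (LBINT Z. (out Z * cut Z) * ?K Z) + (LBINT Z. ((1 - out Z) * cut Z) * ?K Z)"
    using int_out int_in by (rule Bochner_Integration.integral_add)
  finally have split: "2 * curv s w \<epsilon> x = \<dots>" .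
  have "omega DIM('a \<times> real) * r powr (- s) / s - cyl_tail s TYPE('a) r \<epsilon> - 2 * B
     \<le> (LBINT Z. out Z * ?K Z) - (LBINT Z. (out Z * cyl Z) * ?K Z) - 2 * (LBINT Z. (out Z * low Z) * ?K Z)"
    using far int_K(2) by (simp add: below_mass_def cyl_tail_def out_def cyl_def low_def)
  also have "\<dots> = (LBINT Z. out Z * ?K Z - (out Z * cyl Z) * ?K Z - 2 * ((out Z * low Z) * ?K Z))"
    using int_K int_cyl int_low by simp
  also have "\<dots> \<le> (LBINT Z. (out Z * cut Z) * ?K Z)"
  proof (intro integral_mono)
    fix Z
    have "out Z - out Z * cyl Z - 2 * (out Z * low Z) \<le> out Z * cut Z"
      by (auto simp: out_def cyl_def low_def cut_def above_def indicator_def)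
    from mult_right_mono[OF this, of "?K Z"]
    show "out Z * ?K Z - out Z * cyl Z * ?K Z - 2 * (out Z * low Z * ?K Z) \<le> out Z * cut Z * ?K Z"
      by (simp add: algebra_simps)
  qed (use int_K int_cyl int_low int_out in auto)
  finally have 1: "omega DIM('a \<times> real) * r powr (- s) / s - cyl_tail s TYPE('a) r \<epsilon> - 2 * B
      \<le> (LBINT Z. (out Z * cut Z) * ?K Z)" .
  define gap where "gap Z = (indicator (tangent_gap r \<kappa> e) Z :: real)" for Z
  have [measurable]: "gap \<in> borel_measurable borel" unfolding gap_def by measurable
  have near': "(\<integral>\<^sup>+ Z. ennreal (gap Z * ?K Z) \<partial>lborel) \<le> ennreal C"
    using near by (simp add: gap_def ennreal_mult' ennreal_indicator mult.commute)
  have int_gap: "integrable lborel (\<lambda>Z. gap Z * ?K Z)"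
  proof (rule integrableI_nonneg)
    show "(\<integral>\<^sup>+ Z. ennreal (gap Z * ?K Z) \<partial>lborel) < \<infinity>"
      using near' by (rule le_less_trans) simp
  qed (simp_all add: gap_def)
  have "(LBINT Z. gap Z * ?K Z) \<le> C"
    using near' C by (subst integral_eq_nn_integral) (auto simp: gap_def enn2real_leI)
  moreover have "- (2 * (LBINT Z. gap Z * ?K Z)) \<le> 2 * (LBINT Z. ((1 - out Z) * cut Z) * ?K Z)"
  proof -
    let ?h = "\<lambda>Z. ((1 - out Z) * cut Z) * ?K Z"
    have int': "integrable lborel (\<lambda>Z. ?h (- Z))"
      using int_in by (subst integrable_lborel_uminus) auto
    have "- (2 * (LBINT Z. gap Z * ?K Z)) = (LBINT Z. - (2 * (gap Z * ?K Z)))" by simp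
    also have "\<dots> \<le> (LBINT Z. ?h Z + ?h (- Z))"
    proof (intro integral_mono)
      fix Z
      have up: "above w x Z' = 1" if "norm Z' < r" "\<kappa> * (norm Z')\<^sup>2 < Z' \<bullet> e" for Z'
        using tangent[OF that] by (simp add: above_def)
      have "- 2 * gap Z \<le> (1 - out Z) * cut Z + (1 - out (- Z)) * cut (- Z)"
      proof (cases "norm Z < r")
        case True
        show ?thesis
        proof (cases "Z \<in> tangent_gap r \<kappa> e")
          case gap: True
          show ?thesis
            using True gap cut_le[of Z] cut_le[of "- Z"] by (simp add: out_def gap_def abs_le_iff)
        next
          case False
          then have "above w x Z = 1 \<or> above w x (- Z) = 1"
            using True up[of Z] up[of "- Z"] by (auto simp: tangent_gap_def abs_le_iff not_le)
          then have "0 \<le> above w x Z + above w x (- Z)"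
            using abs_above[of w x Z] abs_above[of w x "- Z"] by linarith
          then have "0 \<le> indicator {Z. \<epsilon> \<le> norm (fst Z)} Z * (above w x Z + above w x (- Z))"
            by (intro mult_nonneg_nonneg) auto
          moreover have "indicat_real {Z. \<epsilon> \<le> norm (fst Z)} (- Z) = indicator {Z. \<epsilon> \<le> norm (fst Z)} Z"
            by (simp add: indicator_def)
          ultimately show ?thesis
            using True False by (simp add: out_def gap_def cut_def distrib_left)
        qed
      next
        case False
        then show ?thesis by (simp add: out_def gap_def tangent_gap_def)
      qed
      from mult_right_mono[OF this, of "?K Z"]
      show "- (2 * (gap Z * ?K Z)) \<le> ?h Z + ?h (- Z)"
        by (simp add: algebra_simps)
    qed (use int_in int' int_gap in auto)
    also have "\<dots> = (LBINT Z. ?h Z) + (LBINT Z. ?h (- Z))"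
      using int_in int' by (rule Bochner_Integration.integral_add)
    also have "(LBINT Z. ?h (- Z)) = (LBINT Z. ?h Z)"
      by (rule integral_lborel_uminus) measurable
    finally show ?thesis by simp
  qed
  ultimately have "- C \<le> (LBINT Z. ((1 - out Z) * cut Z) * ?K Z)" by linarith
  with 1 split show ?thesis by linarith
qed

lemma cyl_tail_tendsto_0:
  assumes s: "0 < s" and r: "0 < r"
  shows "(\<lambda>k. cyl_tail s TYPE('a::euclidean_space) r (1 / real (Suc k))) \<longlonglongrightarrow> 0"
proof -
  let ?K = "frac_kernel s :: 'a \<times> real \<Rightarrow> real"
  define f where "f k Z = (indicator {Z. r \<le> norm Z} Z * indicator {Z. norm (fst Z) < 1 / real (Suc k)} Z) * ?K Z"
    for k and Z :: "'a \<times> real"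
  have [measurable]: "f k \<in> borel_measurable borel" for k
    unfolding f_def using cylinder_borel[where 'a='a] by measurable
  have "{0} \<in> null_sets (lborel :: 'a measure)"
    by (rule null_setsI) (rule emeasure_lborel_singleton, simp)
  then have "{0} \<times> UNIV \<in> null_sets ((lborel :: 'a measure) \<Otimes>\<^sub>M (lborel :: real measure))"
    by (intro lborel.times_in_null_sets1) auto
  then have N: "{0} \<times> UNIV \<in> null_sets (lborel :: ('a \<times> real) measure)"
    by (simp add: lborel_prod)
  have "(\<lambda>k. LBINT Z. f k Z) \<longlonglongrightarrow> (LBINT Z::'a \<times> real. 0)"
  proof (rule integral_dominated_convergence)
    show "integrable lborel (\<lambda>Z::'a \<times> real. ?K Z * indicator {Z. r \<le> norm Z} Z)"
      by (rule integrable_riesz_outside[OF s r])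
    show "AE Z in lborel. norm (f k Z) \<le> ?K Z * indicator {Z. r \<le> norm Z} Z" for k
      by (intro AE_I2) (auto simp: f_def indicator_def)
    show "AE Z in lborel. (\<lambda>k. f k Z) \<longlonglongrightarrow> 0"
    proof (rule AE_I'[OF N], clarify)
      fix z :: 'a and t :: real
      assume *: "\<not> (\<lambda>k. f k (z, t)) \<longlonglongrightarrow> 0"
      show "z \<in> {0} \<and> t \<in> UNIV"
      proof (rule ccontr)
        assume "\<not> (z \<in> {0} \<and> t \<in> UNIV)"
        then have "0 < norm z" by simp
        moreover have "(\<lambda>k. 1 / real (Suc k)) \<longlonglongrightarrow> 0" by real_asymp
        ultimately have "eventually (\<lambda>k. 1 / real (Suc k) < norm z) sequentially"
          by (intro order_tendstoD) auto
        then have "eventually (\<lambda>k. f k (z, t) = 0) sequentially"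
          by (rule eventually_mono) (auto simp: f_def indicator_def)
        then show False using tendsto_eventually * by (simp add: tendsto_eventually)
      qed
    qed
  qed auto
  then show ?thesis by (simp add: f_def cyl_tail_def)
qed

section \<open>The far field\<close>
definition far_mass :: "real \<Rightarrow> ('a::euclidean_space \<times> real) set \<Rightarrow> real" where
  "far_mass s E = (LBINT Y. (indicator {Y. 1 \<le> norm Y} Y * indicator E Y) * frac_kernel s Y)"

lemma subgraph_borel:
  fixes w :: "'a::euclidean_space \<Rightarrow> real"
  assumes [measurable]: "w \<in> borel_measurable borel"
  shows "subgraph w \<in> sets borel"
proof -
  have "{Z \<in> space borel. snd Z < w (fst Z)} \<in> sets borel" by measurable
  moreover have "subgraph w = {Z. snd Z < w (fst Z)}" by (auto simp: subgraph_def)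
  ultimately show ?thesis by simp
qed

text \<open>
  Exceptional null sets in one factor stay null in the product. This allows replacing functions on
  \<open>\<real>\<^sup>n\<close> by Borel representatives in integrals over \<open>\<real>\<^sup>n\<^sup>+\<^sup>1\<close> and \<open>\<real>\<^sup>2\<^sup>n\<close>.
\<close>
lemma AE_lborel_fst:
  assumes "AE x in (lborel :: 'a::euclidean_space measure). P x"
  shows "AE Z in (lborel :: ('a \<times> 'b::euclidean_space) measure). P (fst Z)"
proof -
  obtain N where N: "N \<in> null_sets lborel" "{x. \<not> P x} \<subseteq> N"
    using assms by (auto elim!: AE_E3 simp: eventually_ae_filter)
  have "N \<times> UNIV \<in> null_sets ((lborel :: 'a measure) \<Otimes>\<^sub>M (lborel :: 'b measure))"
    using N(1) by (intro lborel.times_in_null_sets1) auto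
  then show ?thesis
    using N(2) by (intro AE_I'[of "N \<times> UNIV"]) (auto simp: lborel_prod)
qed

lemma AE_lborel_snd:
  assumes "AE x in (lborel :: 'b::euclidean_space measure). P x"
  shows "AE Z in (lborel :: ('a::euclidean_space \<times> 'b) measure). P (snd Z)"
proof -
  obtain N where N: "N \<in> null_sets lborel" "{x. \<not> P x} \<subseteq> N"
    using assms by (auto elim!: AE_E3 simp: eventually_ae_filter)
  have "UNIV \<times> N \<in> null_sets ((lborel :: 'a measure) \<Otimes>\<^sub>M (lborel :: 'b measure))"
    using N(1) by (intro lborel.times_in_null_sets2) auto
  then show ?thesis
    using N(2) by (intro AE_I'[of "UNIV \<times> N"]) (auto simp: lborel_prod)
qed

text \<open>
  A Borel representative brings an integral over the completed measure within reach of Fubini's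
  theorem.
\<close>
lemma
  fixes f g :: "'a::euclidean_space \<Rightarrow> real"
  assumes g: "g \<in> borel_measurable borel" and ae: "AE x in lborel. f x = g x"
  shows integral_lebesgue_eq_lborel: "integral\<^sup>L lebesgue f = integral\<^sup>L lborel g"
    and integrable_lebesgue_iff_lborel: "integrable lebesgue f \<longleftrightarrow> integrable lborel g"
proof -
  have ae': "AE x in lebesgue. f x = g x" using ae by (simp add: AE_completion_iff)
  have g': "g \<in> borel_measurable lebesgue" using g by (simp add: measurable_completion)
  have f': "f \<in> borel_measurable lebesgue"
    by (rule borel_measurable_AE[OF g']) (use ae' in eventually_elim, simp)
  have "integral\<^sup>L lebesgue f = integral\<^sup>L lebesgue g"
    using f' g' ae' by (rule integral_cong_AE)
  then show "integral\<^sup>L lebesgue f = integral\<^sup>L lborel g"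
    using g by (simp add: integral_completion)
  have "integrable lebesgue f \<longleftrightarrow> integrable lebesgue g"
    using f' g' ae' by (rule integrable_cong_AE)
  then show "integrable lebesgue f \<longleftrightarrow> integrable lborel g"
    using g by (simp add: integrable_completion)
qed

lemma alpha_bar_eq_far_mass:
  fixes \<phi> \<phi>\<^sub>0 :: "'a::euclidean_space \<Rightarrow> real"
  assumes [measurable]: "\<phi>\<^sub>0 \<in> borel_measurable borel" and eq: "AE x in lebesgue. \<phi> x = \<phi>\<^sub>0 x"
  shows "alpha_bar (subgraph \<phi>) = Limsup (at_right 0) (\<lambda>s. ereal (s * far_mass s (subgraph \<phi>\<^sub>0)))"
proof -
  have "set_lebesgue_integral lebesgue (- ball 0 1)
            (\<lambda>Y. indicator (subgraph \<phi>) Y / norm Y powr (real DIM('a \<times> real) + s)) = far_mass s (subgraph \<phi>\<^sub>0)" for s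
  proof -
    let ?f = "\<lambda>Y::'a \<times> real. (indicator {Y. 1 \<le> norm Y} Y * indicator (subgraph \<phi>\<^sub>0) Y) * frac_kernel s Y"
    have [measurable]: "subgraph \<phi>\<^sub>0 \<in> sets borel" by (intro subgraph_borel) measurable
    have mf: "?f \<in> borel_measurable borel" by measurable
    have "AE x in lborel. \<phi> x = \<phi>\<^sub>0 x" using eq by (simp add: AE_completion_iff)
    then have ae: "AE Y in lborel. \<phi> (fst Y) = \<phi>\<^sub>0 (fst (Y :: 'a \<times> real))" by (rule AE_lborel_fst)
    have ae': "AE Y in lborel. indicat_real (- ball 0 1) Y *\<^sub>R (indicator (subgraph \<phi>) Y / norm Y powr (real DIM('a \<times> real) + s)) = ?f Y"
      using ae by eventually_elim (auto simp: indicator_def subgraph_def riesz_def)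
    have "set_lebesgue_integral lebesgue (- ball 0 1)
            (\<lambda>Y. indicator (subgraph \<phi>) Y / norm Y powr (real DIM('a \<times> real) + s)) = integral\<^sup>L lborel ?f"
      unfolding set_lebesgue_integral_def using mf ae' by (rule integral_lebesgue_eq_lborel)
    then show ?thesis by (simp add: far_mass_def)
  qed
  then show ?thesis by (simp add: alpha_bar_def)
qed

lemma far_mass_nonneg: "0 \<le> far_mass s E"
  unfolding far_mass_def by (intro Bochner_Integration.integral_nonneg) auto

text \<open>
  The mass of the subgraph of \<open>w\<close> seen from \<open>(x, w x)\<close> is compared with the mass of the subgraph of
  \<open>\<phi>\<^sub>0\<close> seen from the origin. On a large ball of radius \<open>R\<close> the kernels are bounded, and the factor
  \<open>s\<close> makes their contribution negligible. Beyond it the two sets agree and the ratio of the kernels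
  is as close to 1 as desired, uniformly for centres in a bounded set.
\<close>
lemma far_field_bound:
  fixes w \<phi>\<^sub>0 :: "'a::euclidean_space \<Rightarrow> real" and a a' r R\<^sub>0 R\<^sub>1 :: real
  assumes w[measurable]: "w \<in> borel_measurable borel" and p[measurable]: "\<phi>\<^sub>0 \<in> borel_measurable borel"
    and mass: "eventually (\<lambda>s. s * far_mass s (subgraph \<phi>\<^sub>0) < a) (at_right 0)" and a: "a < a'"
    and r: "0 < r" "r \<le> 1"
    and outer: "\<And>Y. Y \<in> subgraph w \<Longrightarrow> R\<^sub>1 \<le> norm Y \<Longrightarrow> Y \<in> subgraph \<phi>\<^sub>0"
  shows "eventually (\<lambda>s. \<forall>x. norm (x, w x) \<le> R\<^sub>0 \<longrightarrow>
    s * below_mass s w r x \<le> a') (at_right 0)"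
proof -
  define d where "d = real DIM('a \<times> real)"
  have "eventually (\<lambda>s::real. 0 < s) (at_right 0)" by (simp add: eventually_at_right_less)
  with mass have "eventually (\<lambda>s. 0 < a) (at_right (0::real))"
  proof eventually_elim
    case (elim s)
    have "0 \<le> s * far_mass s (subgraph \<phi>\<^sub>0)" using elim by (intro mult_nonneg_nonneg far_mass_nonneg) auto
    with elim show ?case by linarith
  qed
  then have a0: "0 < a" by (simp add: trivial_limit_at_right_real)
  \<comment> \<open>half of the room between \<open>a\<close> and \<open>a'\<close> pays for the factor \<open>\<theta>\<close>, the other half for the ball\<close>
  define a'' where "a'' = (a + a') / 2"
  define \<theta> where "\<theta> = a'' / a"
  have \<theta>: "1 < \<theta>" "\<theta> * a = a''" using a a0 by (auto simp: \<theta>_def a''_def field_simps)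
  have "((\<lambda>R. (1 - R\<^sub>0 / R) powr (- (d + 1))) \<longlongrightarrow> (1 - 0) powr (- (d + 1))) at_top"
    by (intro tendsto_intros) (real_asymp, simp)
  then have "eventually (\<lambda>R. (1 - R\<^sub>0 / R) powr (- (d + 1)) < \<theta>) at_top"
    using \<theta> by (intro order_tendstoD) auto
  moreover have "eventually (\<lambda>R. max 1 (max R\<^sub>1 (2 * \<bar>R\<^sub>0\<bar>)) < R) at_top"
    by (rule eventually_gt_at_top)
  ultimately have "eventually (\<lambda>R. (1 - R\<^sub>0 / R) powr (- (d + 1)) < \<theta> \<and> max 1 (max R\<^sub>1 (2 * \<bar>R\<^sub>0\<bar>)) < R) at_top"
    by (rule eventually_conj)
  then obtain R where R: "(1 - R\<^sub>0 / R) powr (- (d + 1)) < \<theta>" "1 < R" "R\<^sub>1 < R" "2 * \<bar>R\<^sub>0\<bar> < R"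
    by (auto dest: eventually_happens)
  define q where "q = 1 - R\<^sub>0 / R"
  have q: "0 < q" "q powr (- (d + 1)) < \<theta>"
    using R by (auto simp: q_def field_simps)
  define Cst where "Cst = r powr (- (d + 1)) * measure lborel (ball (0::'a \<times> real) R)"
  have "((\<lambda>s::real. s * Cst) \<longlongrightarrow> 0 * Cst) (at_right 0)" by (intro tendsto_intros)
  then have "eventually (\<lambda>s::real. s * Cst < a' - a'') (at_right 0)"
    using a by (intro order_tendstoD) (auto simp: a''_def field_simps)
  moreover have "eventually (\<lambda>s::real. s < 1) (at_right 0)" 
    by (intro order_tendstoD(2)[of _ 0]) auto
  ultimately show ?thesis using mass \<open>eventually (\<lambda>s::real. 0 < s) (at_right 0)\<close>
  proof eventually_elim
    case (elim s)
    note s = \<open>0 < s\<close> \<open>s < 1\<close>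
    let ?K = "riesz (d + s) :: 'a \<times> real \<Rightarrow> real"
    have dpos: "0 < d + s" using s by (simp add: d_def add_pos_pos)
    show ?case
    proof (intro allI impI)
      fix x assume x: "norm (x, w x) \<le> R\<^sub>0"
      define X where "X = (x, w x)"
      have R0: "0 \<le> R\<^sub>0" by (rule order_trans[OF norm_ge_zero x])
      have q1: "q \<le> 1" using R0 R by (simp add: q_def)
      define low where "low Z = (indicator {Z. r \<le> norm Z} Z * indicator {Z. w x + snd Z < w (x + fst Z)} Z :: real)" for Z :: "'a \<times> real"
      have "{Z \<in> space borel. w x + snd Z < w (x + fst Z)} \<in> sets borel" by measurable
      then have [measurable]: "low \<in> borel_measurable borel"
        unfolding low_def by simp
      define F where "F Y = r powr (- (d + 1)) * indicator (ball 0 R) Y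
           + \<theta> * ((indicator {Y. 1 \<le> norm Y} Y * indicator (subgraph \<phi>\<^sub>0) Y) * ?K Y)" for Y :: "'a \<times> real"
      have [measurable]: "subgraph \<phi>\<^sub>0 \<in> sets borel" by (rule subgraph_borel[OF p])
      have F_m[measurable]: "F \<in> borel_measurable borel"
        unfolding F_def
        by (intro borel_measurable_add borel_measurable_times borel_measurable_indicator
            borel_measurable_const riesz_measurable) (auto intro: subgraph_borel p)
      have int_mass: "integrable lborel (\<lambda>Y::'a \<times> real. (indicator {Y. 1 \<le> norm Y} Y * indicator (subgraph \<phi>\<^sub>0) Y) * ?K Y)"
        unfolding d_def using s by (intro integrable_bounded_riesz[of _ s 1 1]) (auto simp: indicator_def)
      have int_ball: "integrable lborel (\<lambda>Y::'a \<times> real. r powr (- (d + 1)) * indicator (ball 0 R) Y)"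
        using emeasure_lborel_ball_finite[of "0::'a \<times> real" R]
        by (intro integrable_mult_right) (auto simp: integrable_indicator_iff)
      have int_F: "integrable lborel F"
        unfolding F_def using int_mass int_ball by auto
      have int_low: "integrable lborel (\<lambda>Z. low Z * ?K Z)"
        unfolding d_def using s r by (intro integrable_bounded_riesz[of _ s r 1]) (auto simp: low_def indicator_def)
      have "(LBINT Z. low Z * ?K Z) \<le> (LBINT Z. F (X + Z))"
      proof (intro integral_mono int_low)
        show "integrable lborel (\<lambda>Z. F (X + Z))"
          using int_F by (subst integrable_lborel_translate) auto
        fix Z :: "'a \<times> real"
        have F0: "0 \<le> F Y" for Y unfolding F_def using \<theta> by simp
        show "low Z * ?K Z \<le> F (X + Z)"
        proof (cases "r \<le> norm Z \<and> w x + snd Z < w (x + fst Z)")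
          case True
          have Zpos: "0 < norm Z" using True r by linarith
          have Ys: "X + Z \<in> subgraph w"
            using True by (cases Z) (simp add: subgraph_def X_def)
          show ?thesis
          proof (cases "norm (X + Z) < R")
            case inR: True
            have "?K Z = norm Z powr (- (d + s))"
              unfolding riesz_def powr_minus_divide ..
            also have "\<dots> \<le> r powr (- (d + s))"
              using True r dpos by (intro powr_mono2') auto
            also have "\<dots> \<le> r powr (- (d + 1))"
              using r s by (intro powr_mono') auto
            also have "\<dots> \<le> F (X + Z)"
              using inR \<theta> by (simp add: F_def)
            finally show ?thesis using True by (simp add: low_def)
          next
            case False
            define Y where "Y = X + Z"
            have Y: "R \<le> norm Y" using False by (simp add: Y_def)
            have Y0: "Y \<in> subgraph \<phi>\<^sub>0" using outer[of Y] Ys Y R by (simp add: Y_def)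
            have "norm Y \<le> norm Z + R\<^sub>0"
              using norm_triangle_ineq[of X Z] x by (simp add: Y_def X_def)
            moreover have "R\<^sub>0 \<le> norm Y * (R\<^sub>0 / R)"
              using mult_right_mono[OF Y, of "R\<^sub>0 / R"] R0 R by simp
            ultimately have qY: "q * norm Y \<le> norm Z" by (simp add: q_def algebra_simps)
            have "?K Z = norm Z powr (- (d + s))"
              unfolding riesz_def powr_minus_divide ..
            also have "\<dots> \<le> (q * norm Y) powr (- (d + s))"
            proof (rule powr_mono2'[OF _ _ qY])
              have "0 < norm Y" using Y R by linarith
              then show "0 < q * norm Y" using q by simp
            qed (use dpos in simp)
            also have "\<dots> = q powr (- (d + s)) * norm Y powr (- (d + s))"
              using q by (simp add: powr_mult)
            also have "\<dots> \<le> q powr (- (d + 1)) * norm Y powr (- (d + s))"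
              using q q1 s by (intro mult_right_mono powr_mono') auto
            also have "\<dots> \<le> \<theta> * norm Y powr (- (d + s))"
              using q by (intro mult_right_mono) auto
            also have "norm Y powr (- (d + s)) = ?K Y"
              unfolding riesz_def powr_minus_divide ..
            also have "\<theta> * ?K Y \<le> F Y"
              using Y0 Y R by (simp add: F_def)
            finally show ?thesis using True by (simp add: low_def Y_def)
          qed
        next
          case False
          then have "low Z = 0" by (auto simp: low_def)
          then show ?thesis using F0[of "X + Z"] by simp
        qed
      qed
      also have "\<dots> = (LBINT Y. F Y)" by (rule integral_lborel_translate) measurable
      also have "\<dots> = Cst + \<theta> * far_mass s (subgraph \<phi>\<^sub>0)"
        unfolding F_def using int_mass int_ball
        by (subst Bochner_Integration.integral_add) (auto simp: far_mass_def Cst_def d_def)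
      finally have "s * (LBINT Z. low Z * ?K Z) \<le> s * (Cst + \<theta> * far_mass s (subgraph \<phi>\<^sub>0))"
        using s by (intro mult_left_mono) auto
      also have "\<dots> = s * Cst + \<theta> * (s * far_mass s (subgraph \<phi>\<^sub>0))" by (simp add: algebra_simps)
      also have "\<dots> \<le> s * Cst + \<theta> * a"
        using elim \<theta> by (intro add_left_mono mult_left_mono) auto
      also have "\<dots> \<le> a'" using elim \<theta> by linarith
      finally show "s * below_mass s w r x \<le> a'"
        by (simp add: below_mass_def low_def d_def)
    qed
  qed
qed

text \<open>
  At every point of the graph over \<open>\<Omega>\<close> the graph stays, within distance \<open>r\<close>, below a ball of radius
  \<open>1 / (2 \<kappa>)\<close> touching it from above. The direction \<open>e\<close> may come arbitrarily close to being
  horizontal, as happens where the obstacle is steep. The localization is needed since nothing is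
  known about the exterior data far from \<open>\<Omega>\<close>.
\<close>
definition uniformly_tangent :: "'a::euclidean_space set \<Rightarrow> ('a \<Rightarrow> real) \<Rightarrow> bool" where
  "uniformly_tangent \<Omega> w \<longleftrightarrow> (\<exists>r>0. \<exists>\<kappa>>0. \<forall>x\<in>\<Omega>. \<exists>e. norm e = 1 \<and>
     (\<forall>Z. norm Z < r \<longrightarrow> \<kappa> * (norm Z)\<^sup>2 < Z \<bullet> e \<longrightarrow> w (x + fst Z) \<le> w x + snd Z))"

text \<open>
  The far part of twice the curvature is at least a positive multiple of \<open>1 / s\<close>, while the near part
  is bounded below independently of \<open>s\<close>.
\<close>
lemma curv_eventually_ge_1:
  fixes w \<phi>\<^sub>0 :: "'a::euclidean_space \<Rightarrow> real"
  assumes w[measurable]: "w \<in> borel_measurable borel" and p[measurable]: "\<phi>\<^sub>0 \<in> borel_measurable borel"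
    and alpha: "Limsup (at_right 0) (\<lambda>s. ereal (s * far_mass s (subgraph \<phi>\<^sub>0))) < ereal (omega DIM('a \<times> real) / 2)"
    and bdd: "\<And>x. x \<in> \<Omega> \<Longrightarrow> norm (x, w x) \<le> R\<^sub>0"
    and outer: "\<And>Y. Y \<in> subgraph w \<Longrightarrow> R\<^sub>1 \<le> norm Y \<Longrightarrow> Y \<in> subgraph \<phi>\<^sub>0"
    and tan: "uniformly_tangent \<Omega> w"
  shows "\<exists>r>0. \<exists>s\<^sub>0. 0 < s\<^sub>0 \<and> s\<^sub>0 < 1 \<and> (\<forall>s x \<epsilon>. 0 < s \<longrightarrow> s < s\<^sub>0 \<longrightarrow> x \<in> \<Omega> \<longrightarrow> 0 < \<epsilon> \<longrightarrow>
    1 - cyl_tail s TYPE('a) r \<epsilon> \<le> 2 * curv s w \<epsilon> x)"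
proof -
  let ?\<omega> = "omega DIM('a \<times> real)"
  obtain r1 \<kappa> where r1: "0 < r1" "0 < \<kappa>" and tan: "\<And>x. x \<in> \<Omega> \<Longrightarrow> \<exists>e. norm e = 1 \<and>
     (\<forall>Z. norm Z < r1 \<longrightarrow> \<kappa> * (norm Z)\<^sup>2 < Z \<bullet> e \<longrightarrow> w (x + fst Z) \<le> w x + snd Z)"
    using tan unfolding uniformly_tangent_def by blast
  define r where "r = min r1 (min 1 (1 / (4 * \<kappa>)))"
  have r: "0 < r" "r \<le> 1" "r \<le> r1" using r1 by (auto simp: r_def)
  have "r \<le> 1 / (4 * \<kappa>)" by (simp add: r_def)
  then have "4 * \<kappa> * r \<le> 1" using r1 by (simp add: field_simps)
  then obtain C where C: "0 \<le> C" and near: "\<And>e::'a \<times> real. \<And>s. norm e = 1 \<Longrightarrow> 0 < s \<Longrightarrow> s \<le> 1/2 \<Longrightarrow>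
     (\<integral>\<^sup>+ z. ennreal (frac_kernel s z) * indicator (tangent_gap r \<kappa> e) z \<partial>lborel) \<le> ennreal C"
    using nn_integral_tangent_gap[OF r(1,2) r1(2), where 'a="'a \<times> real"] by blast
  obtain a where a: "Limsup (at_right 0) (\<lambda>s. ereal (s * far_mass s (subgraph \<phi>\<^sub>0))) < ereal a" "a < ?\<omega> / 2"
    using ereal_dense2[OF alpha] by auto
  define a' where "a' = (a + ?\<omega> / 2) / 2"
  have a': "a < a'" "2 * a' < ?\<omega>" using a(2) by (auto simp: a'_def)
  have "eventually (\<lambda>s. s * far_mass s (subgraph \<phi>\<^sub>0) < a) (at_right 0)"
    using Limsup_lessD[OF a(1)] by simp
  from far_field_bound[OF w p this a'(1) r(1,2) outer, of R\<^sub>1 R\<^sub>0]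
  have "eventually (\<lambda>s. \<forall>x. norm (x, w x) \<le> R\<^sub>0 \<longrightarrow>
    s * below_mass s w r x \<le> a') (at_right 0)" by simp
  then obtain s1 where s1: "0 < s1" and far: "\<And>s x. 0 < s \<Longrightarrow> s < s1 \<Longrightarrow> norm (x, w x) \<le> R\<^sub>0 \<Longrightarrow>
    s * below_mass s w r x \<le> a'"
    unfolding eventually_at_right_field by auto
  \<comment> \<open>the last entry makes \<open>(\<omega> - 2 a') / s\<close> exceed \<open>1 + C\<close>\<close>
  define s0 where "s0 = min s1 (min (1 / 2) ((?\<omega> - 2 * a') / (C + 1)))"
  have s0: "0 < s0" "s0 < 1" "s0 \<le> s1" "s0 \<le> 1/2" "s0 \<le> (?\<omega> - 2 * a') / (C + 1)"
  proof -
    show half: "s0 \<le> 1/2" unfolding s0_def by (intro min.coboundedI2 min.cobounded1)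
    then show "s0 < 1" by linarith
    show "0 < s0" "s0 \<le> s1" "s0 \<le> (?\<omega> - 2 * a') / (C + 1)"
      using s1 a' C by (auto simp: s0_def)
  qed
  have bound: "1 - cyl_tail s TYPE('a) r \<epsilon> \<le> 2 * curv s w \<epsilon> x"
    if s: "0 < s" "s < s0" and x: "x \<in> \<Omega>" and \<epsilon>: "0 < \<epsilon>" for s x \<epsilon>
  proof -
    obtain e where e: "norm e = 1"
      and t: "\<And>Z. norm Z < r1 \<Longrightarrow> \<kappa> * (norm Z)\<^sup>2 < Z \<bullet> e \<Longrightarrow> w (x + fst Z) \<le> w x + snd Z"
      using tan[OF x] by blast
    let ?B = "below_mass s w r x"
    have "s * ?B \<le> a'" using far[of s x] s s0 bdd[OF x] by simp
    then have B: "?B \<le> a' / s" using s by (simp add: field_simps)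
    have "?\<omega> * r powr (- s) / s - cyl_tail s TYPE('a) r \<epsilon> - 2 * (a' / s) - C \<le> 2 * curv s w \<epsilon> x"
  proof (rule curv_lower_bound[OF w s(1) \<epsilon> r(1) _ near[OF e s(1)] C B])
      fix Z assume "norm Z < r" "\<kappa> * (norm Z)\<^sup>2 < Z \<bullet> e"
      then show "w (x + fst Z) \<le> w x + snd Z"
        using r(3) by (intro t) simp_all
    qed (use s s0 in simp)
    moreover have "1 + C \<le> ?\<omega> * r powr (- s) / s - 2 * (a' / s)"
    proof -
      have "1 \<le> r powr (- s)"
        using powr_mono2'[of "- s" r 1] r s by simp
      then have "?\<omega> \<le> ?\<omega> * r powr (- s)"
        using omega_pos[of "DIM('a \<times> real)"] by simp
      moreover have "(1 + C) * s \<le> ?\<omega> - 2 * a'"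
      proof -
        have "s \<le> (?\<omega> - 2 * a') / (C + 1)" using s s0 by linarith
        then show ?thesis using C by (simp add: field_simps)
      qed
      ultimately have "(1 + C) * s \<le> ?\<omega> * r powr (- s) - 2 * a'" by linarith
      then have "1 + C \<le> (?\<omega> * r powr (- s) - 2 * a') / s" using s by (simp add: pos_le_divide_eq)
      then show ?thesis by (simp add: diff_divide_distrib)
    qed
    ultimately show ?thesis by linarith
  qed
  show ?thesis
    by (rule exI[of _ r], rule conjI[OF r(1)], rule exI[of _ s0]) (use s0 bound in blast)
qed

section \<open>The first variation of the energy\<close>
lemma
  fixes f :: "'a::euclidean_space \<times> 'a \<Rightarrow> real"
  assumes [measurable]: "f \<in> borel_measurable borel"
  shows integral_lborel_swap: "(LBINT p. f (snd p, fst p)) = (LBINT p. f p)"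
    and integrable_lborel_swap: "integrable lborel (\<lambda>p. f (snd p, fst p)) \<longleftrightarrow> integrable lborel f"
proof -
  have m: "f \<in> borel_measurable (lborel \<Otimes>\<^sub>M lborel)" by (simp add: lborel_prod)
  show "(LBINT p. f (snd p, fst p)) = (LBINT p. f p)"
    using lborel_pair.integral_product_swap[OF m] by (simp add: lborel_prod case_prod_beta')
  show "integrable lborel (\<lambda>p. f (snd p, fst p)) \<longleftrightarrow> integrable lborel f"
    using lborel_pair.integrable_product_swap_iff[of f] by (simp add: lborel_prod case_prod_beta')
qed

definition lip_kernel :: "real \<Rightarrow> real \<Rightarrow> 'a::euclidean_space \<Rightarrow> real" where
  "lip_kernel s \<delta> z = min 1 (norm z / \<delta>) * frac_kernel s z"

lemma lip_kernel_measurable [measurable]: "lip_kernel s \<delta> \<in> borel_measurable borel"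
  unfolding lip_kernel_def by measurable

lemma lip_kernel_nonneg [simp]: "0 < \<delta> \<Longrightarrow> 0 \<le> lip_kernel s \<delta> z"
  by (simp add: lip_kernel_def)

lemma lip_kernel_minus: "lip_kernel s \<delta> (x - y) = lip_kernel s \<delta> (y - x)"
  by (simp add: lip_kernel_def riesz_def norm_minus_commute)

definition lip_mass :: "nat \<Rightarrow> real \<Rightarrow> real \<Rightarrow> real" where
  "lip_mass n s \<delta> = omega n * (1 / (1 - s) + 1 / s) * \<delta> powr (- s)"

lemma
  fixes B :: "'a::euclidean_space set"
  assumes B[measurable]: "B \<in> sets borel" and fin: "emeasure lborel B < \<infinity>"
    and s: "0 < s" "s < 1" and \<delta>: "0 < \<delta>"
  shows lip_kernel_integrable_fst: "integrable lborel (\<lambda>p. indicator B (fst p) * lip_kernel s \<delta> (fst p - snd p))"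
    and lip_kernel_integrable_snd: "integrable lborel (\<lambda>p. indicator B (snd p) * lip_kernel s \<delta> (fst p - snd p))"
    and lip_kernel_integral_fst: "(LBINT p. indicator B (fst p) * lip_kernel s \<delta> (fst p - snd p)) \<le> measure lborel B * lip_mass DIM('a) s \<delta>"
    and lip_kernel_integral_snd: "(LBINT p. indicator B (snd p) * lip_kernel s \<delta> (fst p - snd p)) \<le> measure lborel B * lip_mass DIM('a) s \<delta>"
proof -
  let ?f = "\<lambda>p::'a \<times> 'a. indicator B (fst p) * lip_kernel s \<delta> (fst p - snd p) :: real"
  define J where "J = lip_mass DIM('a) s \<delta>"
  have J: "0 \<le> J" using s \<delta> omega_pos[of "DIM('a)"] by (simp add: J_def lip_mass_def)
  have f[measurable]: "?f \<in> borel_measurable borel" by measurable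
  have f': "(\<lambda>p. ennreal (?f p)) \<in> borel_measurable (lborel \<Otimes>\<^sub>M lborel)"
    using f by (simp add: lborel_prod)
  have "(\<integral>\<^sup>+ p. ennreal (?f p) \<partial>lborel) = (\<integral>\<^sup>+ x. \<integral>\<^sup>+ y. ennreal (?f (x, y)) \<partial>lborel \<partial>lborel)"
    using lborel.nn_integral_fst[OF f'] by (simp add: lborel_prod)
  also have "\<dots> \<le> (\<integral>\<^sup>+ x. indicator B x * ennreal J \<partial>lborel)"
  proof (intro nn_integral_mono)
    fix x :: 'a
    have "(\<integral>\<^sup>+ y. ennreal (?f (x, y)) \<partial>lborel) = (\<integral>\<^sup>+ y. indicator B x * ennreal (lip_kernel s \<delta> (- x + y)) \<partial>lborel)"
      using lip_kernel_minus[of s \<delta> x] by (intro nn_integral_cong) (simp add: ennreal_mult' ennreal_indicator)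
    also have "\<dots> = indicator B x * (\<integral>\<^sup>+ y. ennreal (lip_kernel s \<delta> (- x + y)) \<partial>lborel)"
      by (rule nn_integral_cmult) measurable
    also have "(\<integral>\<^sup>+ y. ennreal (lip_kernel s \<delta> (- x + y)) \<partial>lborel)
        = (\<integral>\<^sup>+ y. ennreal (lip_kernel s \<delta> y) \<partial>distr lborel borel ((+) (- x)))"
      by (subst nn_integral_distr) auto
    also have "\<dots> = (\<integral>\<^sup>+ y. ennreal (lip_kernel s \<delta> y) \<partial>(lborel :: 'a measure))" by (simp only: lborel_distr_plus)
    also have "indicator B x * (\<integral>\<^sup>+ y. ennreal (lip_kernel s \<delta> y) \<partial>(lborel :: 'a measure)) \<le> indicator B x * ennreal J"
      unfolding lip_kernel_def J_def lip_mass_def by (intro mult_left_mono nn_integral_lipschitz_kernel s \<delta>) simp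
    finally show "(\<integral>\<^sup>+ y. ennreal (?f (x, y)) \<partial>lborel) \<le> indicator B x * ennreal J" .
  qed
  also have "\<dots> = emeasure lborel B * ennreal J"
    by (subst nn_integral_multc) auto
  also have "\<dots> = ennreal (measure lborel B * J)"
    using fin J by (simp add: emeasure_eq_ennreal_measure ennreal_mult)
  finally have le: "(\<integral>\<^sup>+ p. ennreal (?f p) \<partial>lborel) \<le> ennreal (measure lborel B * J)" .
  show int: "integrable lborel ?f"
  proof (rule integrableI_nonneg[OF _ _ le_less_trans[OF le]])
    show "?f \<in> borel_measurable lborel" by measurable
  qed (use \<delta> in simp_all)
  show I: "(LBINT p. ?f p) \<le> measure lborel B * lip_mass DIM('a) s \<delta>"
    using le J \<delta> unfolding J_def[symmetric]
    by (subst integral_eq_nn_integral) (auto intro!: enn2real_leI)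
  have eq: "(\<lambda>p. indicator B (snd p) * lip_kernel s \<delta> (fst p - snd p)) = (\<lambda>p. ?f (snd p, fst p))"
    using lip_kernel_minus by (intro ext) auto
  show "integrable lborel (\<lambda>p. indicator B (snd p) * lip_kernel s \<delta> (fst p - snd p) :: real)"
    unfolding eq using int by (subst integrable_lborel_swap[OF f])
  show "(LBINT p. indicator B (snd p) * lip_kernel s \<delta> (fst p - snd p)) \<le> measure lborel B * lip_mass DIM('a) s \<delta>"
    unfolding eq using I by (subst integral_lborel_swap[OF f])
qed

definition dquot :: "('a::real_normed_vector \<Rightarrow> real) \<Rightarrow> 'a \<times> 'a \<Rightarrow> real" where
  "dquot u p = (u (fst p) - u (snd p)) / norm (fst p - snd p)"

lemma dquot_measurable [measurable]:
  fixes u :: "'a::euclidean_space \<Rightarrow> real"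
  assumes [measurable]: "u \<in> borel_measurable borel"
  shows "dquot u \<in> borel_measurable borel"
  unfolding dquot_def by measurable

lemma dquot_swap: "dquot u (y, x) = - dquot u (x, y)"
  unfolding dquot_def by (simp add: norm_minus_commute minus_divide_left)

text \<open>
  Put \<open>q = v - w\<close>, so that \<open>q\<close> is the part of the gap \<open>U - w\<close> exceeding \<open>\<eta>\<close> and \<open>\<zeta>\<close> is the rest.
  Where \<open>q\<close> and \<open>\<zeta>\<close> have increments of the same sign the claim is monotonicity of \<open>G_fun\<close>. If \<open>q\<close> is
  larger at \<open>x\<close> and \<open>\<zeta>\<close> is smaller, then the truncation is active at \<open>x\<close>, and the increment of \<open>\<zeta>\<close> is
  dominated by that of \<open>\<eta>\<close>.
\<close>
lemma truncation_monotone: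
  fixes w U \<eta> \<zeta> :: "'a::euclidean_space \<Rightarrow> real"
  assumes n: "1 \<le> n" and s: "0 < s"
    and U: "\<And>x. w x \<le> U x" "\<And>x. x \<notin> \<Omega> \<Longrightarrow> U x = w x"
    and \<zeta>: "\<And>x. \<zeta> x = min (U x - w x) (\<eta> x)"
    and \<eta>: "\<And>x. 0 \<le> \<eta> x"
  defines "v \<equiv> \<lambda>x. U x - \<zeta> x"
  shows "G_fun n s (dquot w (x, y)) * (\<zeta> x - \<zeta> y)
      - 2 * G_bound n s * (indicator \<Omega> x * max 0 (\<eta> y - \<eta> x) + indicator \<Omega> y * max 0 (\<eta> x - \<eta> y))
    \<le> G_fun n s (dquot v (x, y)) * (\<zeta> x - \<zeta> y)"
proof -
  define q where "q x = v x - w x" for x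
  define E where "E x y = indicator \<Omega> x * max 0 (\<eta> y - \<eta> x)" for x y
  have q: "0 \<le> q x" for x using U(1)[of x] by (simp add: q_def v_def \<zeta>)
  have E: "0 \<le> E x y" for x y by (simp add: E_def)
  have main: "G_fun n s (dquot w (x, y)) * (\<zeta> x - \<zeta> y) - 2 * G_bound n s * E x y
     \<le> G_fun n s (dquot v (x, y)) * (\<zeta> x - \<zeta> y)" if "q y \<le> q x" for x y
  proof -
    have "dquot w (x, y) \<le> dquot v (x, y)"
      using that unfolding dquot_def q_def by (intro divide_right_mono) auto
    then have mono: "G_fun n s (dquot w (x, y)) \<le> G_fun n s (dquot v (x, y))" by (rule G_fun_mono)
    show ?thesis
    proof (cases "\<zeta> y \<le> \<zeta> x \<or> q x = q y")
      case True
      then have "G_fun n s (dquot w (x, y)) * (\<zeta> x - \<zeta> y) \<le> G_fun n s (dquot v (x, y)) * (\<zeta> x - \<zeta> y)"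
      proof
        assume "q x = q y"
        then have "dquot w (x, y) = dquot v (x, y)" by (simp add: dquot_def q_def)
        then show ?thesis by simp
      qed (auto intro!: mult_right_mono mono)
      moreover have "0 \<le> 2 * G_bound n s * E x y"
        using E[of x y] G_bound_nonneg[of n s] by simp
      ultimately show ?thesis by linarith
    next
      case False
      \<comment> \<open>a positive \<open>q x\<close> means that the truncation is active at \<open>x\<close>\<close>
      then have qx: "0 < q x" using q[of y] that by linarith
      then have "x \<in> \<Omega>" "\<zeta> x = \<eta> x"
        using U(2)[of x] \<eta>[of x] by (auto simp: q_def v_def \<zeta> min_def split: if_splits)
      moreover have "\<zeta> y \<le> \<eta> y" by (simp add: \<zeta>)
      ultimately have Z: "\<bar>\<zeta> x - \<zeta> y\<bar> \<le> E x y" using False by (auto simp: E_def)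
      have "\<bar>(G_fun n s (dquot w (x, y)) - G_fun n s (dquot v (x, y))) * (\<zeta> x - \<zeta> y)\<bar>
         \<le> (2 * G_bound n s) * E x y"
        unfolding abs_mult
        using abs_G_fun_le[OF n s, of "dquot w (x, y)"] abs_G_fun_le[OF n s, of "dquot v (x, y)"]
          G_bound_nonneg[of n s] Z by (intro mult_mono) auto
      then show ?thesis by (simp add: left_diff_distrib abs_le_iff)
    qed
  qed
  have EE: "indicator \<Omega> x * max 0 (\<eta> y - \<eta> x) + indicator \<Omega> y * max 0 (\<eta> x - \<eta> y) = E x y + E y x"
    by (simp add: E_def)
  have nonneg: "0 \<le> 2 * G_bound n s * E x y" "0 \<le> 2 * G_bound n s * E y x"
    using E G_bound_nonneg[of n s] by simp_all
  show ?thesis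
  proof (cases "q y \<le> q x")
    case True
    show ?thesis using main[OF True] nonneg unfolding EE distrib_left by linarith
  next
    case False
    then have "q x \<le> q y" by simp
    from main[OF this] have "G_fun n s (dquot w (x, y)) * (\<zeta> x - \<zeta> y) - 2 * G_bound n s * E y x
       \<le> G_fun n s (dquot v (x, y)) * (\<zeta> x - \<zeta> y)"
      unfolding dquot_swap[of _ y x] G_fun_uminus by (simp add: algebra_simps)
    then show ?thesis using nonneg unfolding EE distrib_left by linarith
  qed
qed

text \<open>
  Off the diagonal the two terms of \<open>\<zeta> x - \<zeta> y\<close> can be integrated separately. Since \<open>G_fun\<close> is odd
  they contribute equally.
\<close>
lemma double_integral_eq_curv:
  fixes w \<zeta> :: "'a::euclidean_space \<Rightarrow> real"
  assumes w[measurable]: "w \<in> borel_measurable borel" and z[measurable]: "\<zeta> \<in> borel_measurable borel"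
    and int: "integrable lborel \<zeta>" and s: "0 < s" and \<epsilon>: "0 < \<epsilon>"
  defines "F \<equiv> \<lambda>p. indicator {p. \<epsilon> \<le> norm (fst p - snd p)} p *
      (G_fun DIM('a) s (dquot w p) * (\<zeta> (fst p) - \<zeta> (snd p)) * frac_kernel s (fst p - snd p))"
  shows "integrable lborel F" and "(LBINT p. F p) = (LBINT x. \<zeta> x * (2 * curv s w \<epsilon> x))"
    and "integrable lborel (\<lambda>x. \<zeta> x * (2 * curv s w \<epsilon> x))"
proof -
  let ?cut = "\<lambda>p::'a \<times> 'a. indicator {p. \<epsilon> \<le> norm (fst p - snd p)} p :: real"
  let ?K = "\<lambda>p::'a \<times> 'a. frac_kernel s (fst p - snd p)"
  have cut[measurable]: "{p::'a \<times> 'a. \<epsilon> \<le> norm (fst p - snd p)} \<in> sets borel"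
    by (intro borel_closed closed_Collect_le continuous_intros)
  define f where "f p = \<zeta> (fst p) * (?cut p * (G_fun DIM('a) s (dquot w p) * ?K p))" for p
  have f[measurable]: "f \<in> borel_measurable borel" unfolding f_def by measurable
  have f0: "integrable lborel (\<lambda>p. \<zeta> (fst p) * (?cut p * ?K p))" (is "integrable lborel ?g")
  proof -
    have g: "?g \<in> borel_measurable borel" by measurable
    have "integrable (lborel \<Otimes>\<^sub>M lborel) ?g"
    proof (rule lborel_pair.Fubini_integrable)
      show "?g \<in> borel_measurable (lborel \<Otimes>\<^sub>M lborel)" using g by (simp add: lborel_prod)
      have shift: "(\<lambda>y. ?cut (x, y) * ?K (x, y)) = (\<lambda>y. (\<lambda>z. frac_kernel s z * indicator {z. \<epsilon> \<le> norm z} z) (- x + y))" for x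
        by (auto simp: indicator_def riesz_def norm_minus_commute)
      have i: "integrable lborel (\<lambda>y. ?cut (x, y) * ?K (x, y))" for x
        unfolding shift using integrable_riesz_outside(1)[OF s \<epsilon>, where 'a='a]
        by (subst integrable_lborel_translate) auto
      show "AE x in lborel. integrable lborel (\<lambda>y. ?g (x, y))"
        using i by (intro AE_I2) (simp)
      have v: "(LBINT y. ?cut (x, y) * ?K (x, y)) = omega DIM('a) * \<epsilon> powr (- s) / s" for x
        unfolding shift by (subst integral_lborel_translate) (auto simp: integrable_riesz_outside(2)[OF s \<epsilon>])
      have "(LBINT y. norm (?g (x, y))) = \<bar>\<zeta> x\<bar> * (omega DIM('a) * \<epsilon> powr (- s) / s)" for x
      proof -
        have "(LBINT y. norm (?g (x, y))) = (LBINT y. \<bar>\<zeta> x\<bar> * (?cut (x, y) * ?K (x, y)))"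
          by (intro Bochner_Integration.integral_cong) (auto simp: abs_mult)
        also have "\<dots> = \<bar>\<zeta> x\<bar> * (LBINT y. ?cut (x, y) * ?K (x, y))"
          by (rule integral_mult_right_zero)
        finally show ?thesis unfolding v .
      qed
      then show "integrable lborel (\<lambda>x. LBINT y. norm (?g (x, y)))"
        using int by auto
    qed
    then show ?thesis by (simp add: lborel_prod)
  qed
  have int_f: "integrable lborel f"
  proof (rule Bochner_Integration.integrable_bound)
    show "integrable lborel (\<lambda>p. G_bound DIM('a) s * (\<zeta> (fst p) * (?cut p * ?K p)))"
      using f0 by (rule integrable_mult_right)
    show "AE p in lborel. norm (f p) \<le> norm (G_bound DIM('a) s * (\<zeta> (fst p) * (?cut p * ?K p)))"
    proof (intro AE_I2)
      fix p
      have "\<bar>G_fun DIM('a) s (dquot w p)\<bar> * \<bar>\<zeta> (fst p) * (?cut p * ?K p)\<bar>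
          \<le> G_bound DIM('a) s * \<bar>\<zeta> (fst p) * (?cut p * ?K p)\<bar>"
        using s by (intro mult_right_mono abs_G_fun_le) auto
      then show "norm (f p) \<le> norm (G_bound DIM('a) s * (\<zeta> (fst p) * (?cut p * ?K p)))"
        using G_bound_nonneg[of "DIM('a)" s] by (simp add: f_def abs_mult mult_ac)
    qed
  qed simp
  have F_eq: "F p = f p + f (snd p, fst p)" for p
    unfolding F_def f_def using dquot_swap[of w "snd p" "fst p"]
    by (simp add: G_fun_uminus indicator_def norm_minus_commute riesz_def algebra_simps)
  have int_f': "integrable lborel (\<lambda>p. f (snd p, fst p))"
    using int_f by (subst integrable_lborel_swap[OF f])
  show "integrable lborel F"
    unfolding F_eq[abs_def] using int_f int_f' by (rule Bochner_Integration.integrable_add)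
  have inner: "(LBINT y. f (x, y)) = \<zeta> x * curv s w \<epsilon> x" for x
  proof -
    let ?h = "\<lambda>y. ?cut (x, y) * (G_fun DIM('a) s (dquot w (x, y)) * ?K (x, y))"
    have h: "?h \<in> borel_measurable borel"
    proof -
      have "(\<lambda>y. (x, y)) \<in> borel \<rightarrow>\<^sub>M borel"
        by (intro borel_measurable_continuous_onI continuous_intros)
      moreover have "(\<lambda>p. ?cut p * (G_fun DIM('a) s (dquot w p) * ?K p)) \<in> borel_measurable borel" by measurable
      ultimately show ?thesis by (rule measurable_compose)
    qed
    have "(LBINT y. f (x, y)) = \<zeta> x * (LBINT y. ?h y)"
      unfolding f_def by (subst integral_mult_right_zero[symmetric]) simp
    also have "(LBINT y. ?h y) = (LBINT z. ?h (x + z))"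
      by (rule integral_lborel_translate[OF h, symmetric])
    also have "\<dots> = curv s w \<epsilon> x"
      unfolding curv_def by (intro Bochner_Integration.integral_cong) (auto simp: dquot_def indicator_def)
    finally show ?thesis .
  qed
  have f2: "integrable (lborel \<Otimes>\<^sub>M lborel) f" using int_f by (simp add: lborel_prod)
  have fub: "(LBINT p. f p) = (LBINT x. \<zeta> x * curv s w \<epsilon> x)"
    using lborel_pair.integral_fst'[OF f2] by (simp add: lborel_prod inner)
  have intc: "integrable lborel (\<lambda>x. \<zeta> x * curv s w \<epsilon> x)"
    using lborel_pair.integrable_fst'[OF f2] by (simp add: inner)
  then show "integrable lborel (\<lambda>x. \<zeta> x * (2 * curv s w \<epsilon> x))"
    using integrable_mult_right[of 2, OF intc] by (simp add: mult_ac)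
  have "(LBINT p. F p) = (LBINT p. f p) + (LBINT p. f (snd p, fst p))"
    unfolding F_eq[abs_def] using int_f int_f' by (rule Bochner_Integration.integral_add)
  also have "\<dots> = 2 * (LBINT x. \<zeta> x * curv s w \<epsilon> x)"
    using integral_lborel_swap[OF f] fub by simp
  also have "\<dots> = (LBINT x. \<zeta> x * (2 * curv s w \<epsilon> x))"
    by (subst integral_mult_right_zero[symmetric]) (simp add: mult_ac)
  finally show "(LBINT p. F p) = (LBINT x. \<zeta> x * (2 * curv s w \<epsilon> x))" .
qed

text \<open>
  The curvature need not converge pointwise as the truncation is removed. It suffices that the
  double integral converges absolutely, so that the bound on truncated curvatures survives the limit.
\<close>
lemma weak_form_lower_bound:
  fixes w \<zeta> :: "'a::euclidean_space \<Rightarrow> real"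
  assumes w[measurable]: "w \<in> borel_measurable borel" and z[measurable]: "\<zeta> \<in> borel_measurable borel"
    and int: "integrable lborel \<zeta>" and s: "0 < s" and r: "0 < r"
    and \<zeta>: "\<And>x. 0 \<le> \<zeta> x" "\<And>x. x \<notin> \<Omega> \<Longrightarrow> \<zeta> x = 0"
    and curv: "\<And>x \<epsilon>. x \<in> \<Omega> \<Longrightarrow> 0 < \<epsilon> \<Longrightarrow> 1 - cyl_tail s TYPE('a) r \<epsilon> \<le> 2 * curv s w \<epsilon> x"
    and intF: "integrable lborel (\<lambda>p. (\<zeta> (fst p) - \<zeta> (snd p)) * frac_kernel s (fst p - snd p))"
  defines "D \<equiv> \<lambda>p. G_fun DIM('a) s (dquot w p) * (\<zeta> (fst p) - \<zeta> (snd p)) * frac_kernel s (fst p - snd p)"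
  shows "integrable lborel D" and "(LBINT x. \<zeta> x) \<le> (LBINT p. D p)"
proof -
  have D[measurable]: "D \<in> borel_measurable borel" unfolding D_def by measurable
  show int_D: "integrable lborel D"
  proof (rule Bochner_Integration.integrable_bound)
    show "integrable lborel (\<lambda>p. G_bound DIM('a) s * ((\<zeta> (fst p) - \<zeta> (snd p)) * frac_kernel s (fst p - snd p)))"
      using intF by (rule integrable_mult_right)
    show "AE p in lborel. norm (D p) \<le> norm (G_bound DIM('a) s * ((\<zeta> (fst p) - \<zeta> (snd p)) * frac_kernel s (fst p - snd p)))"
    proof (intro AE_I2)
      fix p :: "'a \<times> 'a"
      let ?x = "(\<zeta> (fst p) - \<zeta> (snd p)) * frac_kernel s (fst p - snd p)"
      have "\<bar>G_fun DIM('a) s (dquot w p)\<bar> * \<bar>?x\<bar> \<le> G_bound DIM('a) s * \<bar>?x\<bar>"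
        using s by (intro mult_right_mono abs_G_fun_le) auto
      then show "norm (D p) \<le> norm (G_bound DIM('a) s * ?x)"
        using G_bound_nonneg[of "DIM('a)" s] by (simp add: D_def abs_mult mult_ac)
    qed
  qed simp
  define \<epsilon> where "\<epsilon> k = 1 / real (Suc k)" for k
  have \<epsilon>: "0 < \<epsilon> k" for k by (simp add: \<epsilon>_def)
  have \<epsilon>0: "\<epsilon> \<longlonglongrightarrow> 0" unfolding \<epsilon>_def by real_asymp
  define F where "F k p = indicator {p. \<epsilon> k \<le> norm (fst p - snd p)} p * D p" for k p
  note dbl = double_integral_eq_curv[OF w z int s \<epsilon>, folded D_def]
  have conv: "(\<lambda>k. LBINT p. F k p) \<longlonglongrightarrow> (LBINT p. D p)"
  proof (rule integral_dominated_convergence)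
    show "integrable lborel (\<lambda>p. norm (D p))" using int_D by (rule integrable_norm)
    show "F k \<in> borel_measurable lborel" for k
      using borel_measurable_integrable[OF dbl(1)[of k]] by (simp add: F_def[abs_def] D_def mult.assoc)
    show "AE p in lborel. norm (F k p) \<le> norm (D p)" for k
      by (intro AE_I2) (auto simp: F_def indicator_def)
    show "AE p in lborel. (\<lambda>k. F k p) \<longlonglongrightarrow> D p"
    proof (intro AE_I2)
      fix p :: "'a \<times> 'a"
      show "(\<lambda>k. F k p) \<longlonglongrightarrow> D p"
      proof (cases "fst p = snd p")
        case True
        then show ?thesis by (simp add: F_def D_def)
      next
        case False
        then have "eventually (\<lambda>k. \<epsilon> k < norm (fst p - snd p)) sequentially"
          using \<epsilon>0 by (intro order_tendstoD) auto
        then have "eventually (\<lambda>k. F k p = D p) sequentially"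
          by (rule eventually_mono) (auto simp: F_def)
        then show ?thesis by (rule tendsto_eventually)
      qed
    qed
  qed simp
  have lower: "(1 - cyl_tail s TYPE('a) r (\<epsilon> k)) * (LBINT x. \<zeta> x) \<le> (LBINT p. F k p)" for k
  proof -
    have "(1 - cyl_tail s TYPE('a) r (\<epsilon> k)) * (LBINT x. \<zeta> x) = (LBINT x. \<zeta> x * (1 - cyl_tail s TYPE('a) r (\<epsilon> k)))"
      by simp
    also have "\<dots> \<le> (LBINT x. \<zeta> x * (2 * curv s w (\<epsilon> k) x))"
    proof (intro integral_mono dbl(3))
      show "integrable lborel (\<lambda>x. \<zeta> x * (1 - cyl_tail s TYPE('a) r (\<epsilon> k)))" using int by simp
      show "\<zeta> x * (1 - cyl_tail s TYPE('a) r (\<epsilon> k)) \<le> \<zeta> x * (2 * curv s w (\<epsilon> k) x)" for x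
        using \<zeta>[of x] curv[of x "\<epsilon> k"] \<epsilon>[of k] by (cases "x \<in> \<Omega>") (auto intro!: mult_left_mono)
    qed
    also have "\<dots> = (LBINT p. F k p)"
      using dbl(2)[of k] by (simp add: F_def D_def)
    finally show ?thesis .
  qed
  have "(\<lambda>k. (1 - cyl_tail s TYPE('a) r (\<epsilon> k)) * (LBINT x. \<zeta> x)) \<longlonglongrightarrow> (1 - 0) * (LBINT x. \<zeta> x)"
    unfolding \<epsilon>_def by (intro tendsto_intros cyl_tail_tendsto_0 s r)
  from LIMSEQ_le[OF this conv] lower show "(LBINT x. \<zeta> x) \<le> (LBINT p. D p)"
    by auto
qed

section \<open>Testing the obstacle problem\<close>

text \<open>
  On a null set the solution may be redefined so that the constraint and the exterior condition hold
  everywhere.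
\<close>
lemma obstacle_borel_version:
  fixes \<Omega> :: "'a::euclidean_space set" and w :: "'a \<Rightarrow> real"
  assumes \<Omega>: "open \<Omega>" and w[measurable]: "w \<in> borel_measurable borel"
    and u: "u \<in> W_obst s \<Omega> \<Omega> \<phi> \<psi>"
    and w\<psi>: "\<And>x. x \<in> \<Omega> \<Longrightarrow> w x = \<psi> x" and w\<phi>: "AE x in lborel. x \<notin> \<Omega> \<longrightarrow> \<phi> x = w x"
  obtains U where "U \<in> borel_measurable borel" "AE x in lborel. u x = U x"
    "\<And>x. w x \<le> U x" "\<And>x. x \<notin> \<Omega> \<Longrightarrow> U x = w x"
proof -
  have \<Omega>m[measurable]: "\<Omega> \<in> sets borel" using \<Omega> by simp
  have "u \<in> borel_measurable lebesgue"
    using u by (simp add: W_obst_def W_space_def)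
  then obtain u\<^sub>0 where u0[measurable]: "u\<^sub>0 \<in> borel_measurable lborel" and eq: "AE x in lborel. u x = u\<^sub>0 x"
    using completion_ex_borel_measurable_real by blast
  define U where "U x = (if x \<in> \<Omega> then max (u\<^sub>0 x) (w x) else w x)" for x
  have "AE x in lborel. x \<notin> \<Omega> \<longrightarrow> u x = \<phi> x" "AE x in lborel. x \<in> \<Omega> \<longrightarrow> \<psi> x \<le> u x"
    using u by (simp_all add: W_obst_def AE_completion_iff)
  then have ae: "AE x in lborel. u x = U x"
    using eq w\<phi> by eventually_elim (auto simp: U_def w\<psi> max_def)
  have "U \<in> borel_measurable borel"
    unfolding U_def using u0 by measurable
  then show thesis using ae by (rule that) (auto simp: U_def)
qed

text \<open>
  The competitor is \<open>v = U - \<zeta>\<close> with \<open>\<zeta> = min (U - w) \<eta>\<close>. The increments of \<open>\<zeta>\<close> are controlled by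
  those of \<open>U\<close> inside \<open>\<Omega>\<close>, of \<open>w\<close> on the support of \<open>\<eta>\<close>, and of \<open>\<eta>\<close>; therefore \<open>v\<close> is admissible and
  the energy difference converges absolutely. Convexity bounds the energy difference below by the
  first variation at \<open>v\<close>, \<open>truncation_monotone\<close> replaces this by the first variation at \<open>w\<close>, and
  that is at least \<open>\<integral> \<zeta>\<close> because the curvature is large. Minimality makes the energy difference
  nonpositive, so only the error term remains. It is supported where \<open>\<eta> < 1\<close>.
\<close>
lemma obstacle_gap_estimate:
  fixes \<Omega> :: "'a::euclidean_space set" and w U \<eta> \<phi> \<psi> u :: "'a \<Rightarrow> real"
  assumes \<Omega>: "open \<Omega>" "bounded \<Omega>" and s: "0 < s" "s < 1"
    and sol: "solves_obstacle s \<Omega> \<Omega> \<phi> \<psi> u"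
    and w[measurable]: "w \<in> borel_measurable borel"
    and w\<psi>: "\<And>x. x \<in> \<Omega> \<Longrightarrow> w x = \<psi> x" and w\<phi>: "AE x in lborel. x \<notin> \<Omega> \<longrightarrow> \<phi> x = w x"
    and U[measurable]: "U \<in> borel_measurable borel" and uU: "AE x in lborel. u x = U x"
    and wU: "\<And>x. w x \<le> U x" and Uw: "\<And>x. x \<notin> \<Omega> \<Longrightarrow> U x = w x"
    and \<eta>[measurable]: "\<eta> \<in> borel_measurable borel" and \<delta>: "0 < \<delta>"
    and \<eta>01: "\<And>x. 0 \<le> \<eta> x" "\<And>x. \<eta> x \<le> 1" and \<eta>0: "\<And>x. x \<notin> \<Omega> \<Longrightarrow> \<eta> x = 0"
    and \<eta>_lip: "\<And>x y. \<bar>\<eta> x - \<eta> y\<bar> \<le> min 1 (norm (x - y) / \<delta>)"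
    and w_lip: "\<And>x y. \<eta> x \<noteq> 0 \<Longrightarrow> \<eta> y \<noteq> 0 \<Longrightarrow> \<bar>w x - w y\<bar> \<le> L * min 1 (norm (x - y) / \<delta>)"
    and r: "0 < r"
    and curv: "\<And>x \<epsilon>. x \<in> \<Omega> \<Longrightarrow> 0 < \<epsilon> \<Longrightarrow> 1 - cyl_tail s TYPE('a) r \<epsilon> \<le> 2 * curv s w \<epsilon> x"
  shows "integrable lborel (\<lambda>x. min (U x - w x) (\<eta> x))"
    and "(LBINT x. min (U x - w x) (\<eta> x))
      \<le> 4 * G_bound DIM('a) s * measure lborel {x \<in> \<Omega>. \<eta> x < 1} * lip_mass DIM('a) s \<delta>"
proof -
  define n where "n = DIM('a)"
  have n: "1 \<le> n" by (simp add: n_def)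
  let ?K = "\<lambda>p::'a \<times> 'a. riesz (real n + s) (fst p - snd p)"
  define \<zeta> where "\<zeta> x = min (U x - w x) (\<eta> x)" for x
  define v where "v x = U x - \<zeta> x" for x
  have [measurable]: "\<zeta> \<in> borel_measurable borel" unfolding \<zeta>_def by measurable
  have [measurable]: "v \<in> borel_measurable borel" unfolding v_def by measurable
  have \<Omega>m[measurable]: "\<Omega> \<in> sets borel" using \<Omega> by simp
  have \<Omega>fin: "emeasure lborel \<Omega> < \<infinity>" using \<Omega>(2) by (rule emeasure_bounded_finite)
  have \<zeta>01: "0 \<le> \<zeta> x" "\<zeta> x \<le> 1" "\<zeta> x \<le> \<eta> x" for x
    using wU[of x] \<eta>01[of x] by (auto simp: \<zeta>_def)
  have \<zeta>0: "\<zeta> x = 0" if "\<eta> x = 0" for x using that wU[of x] by (simp add: \<zeta>_def)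
  have \<zeta>_off: "\<zeta> x = 0" if "x \<notin> \<Omega>" for x using \<zeta>0 \<eta>0 that by blast
  have wv: "w x \<le> v x" for x by (simp add: v_def \<zeta>_def)
  have vw: "v x = w x" if "x \<notin> \<Omega>" for x using that by (simp add: v_def \<zeta>_off Uw)
  show int_\<zeta>: "integrable lborel (\<lambda>x. min (U x - w x) (\<eta> x))"
  proof (rule Bochner_Integration.integrable_bound)
    show "integrable lborel (indicator \<Omega> :: 'a \<Rightarrow> real)"
      using \<Omega>fin by (simp add: integrable_indicator_iff)
    show "AE x in lborel. norm (min (U x - w x) (\<eta> x)) \<le> norm (indicat_real \<Omega> x)"
      using \<zeta>01 \<zeta>_off by (intro AE_I2) (auto simp: indicator_def \<zeta>_def)
  qed measurable
  then have int_\<zeta>': "integrable lborel \<zeta>" by (simp add: \<zeta>_def[abs_def])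
  have ae_p: "AE p in lborel. u (fst p) = U (fst p) \<and> u (snd p) = U (snd (p :: 'a \<times> 'a))"
    using AE_lborel_fst[OF uU, where 'b='a] AE_lborel_snd[OF uU, where 'a='a] by eventually_elim simp
  have uW: "u \<in> W_obst s \<Omega> \<Omega> \<phi> \<psi>" using sol by (simp add: solves_obstacle_def)
  have \<Omega>2[measurable]: "\<Omega> \<times> \<Omega> \<in> sets borel"
    using \<Omega>(1) by (intro borel_open open_Times)
  let ?KU = "\<lambda>p. indicator (\<Omega> \<times> \<Omega>) p * (\<bar>U (fst p) - U (snd p)\<bar> * ?K p)"
  have KU[measurable]: "?KU \<in> borel_measurable borel" by measurable
  have int_KU: "integrable lborel ?KU"
  proof -
    have "set_integrable lebesgue (\<Omega> \<times> \<Omega>) (\<lambda>(x, y). \<bar>u x - u y\<bar> / norm (x - y) powr (real DIM('a) + s))"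
      using uW by (simp add: W_obst_def W_space_def)
    then have "integrable lebesgue (\<lambda>p. indicator (\<Omega> \<times> \<Omega>) p *\<^sub>R (\<lambda>(x, y). \<bar>u x - u y\<bar> / norm (x - y) powr (real DIM('a) + s)) p)"
      unfolding set_integrable_def .
    then show ?thesis
    proof (subst (asm) integrable_lebesgue_iff_lborel[OF KU])
      show "AE p in lborel. indicator (\<Omega> \<times> \<Omega>) p *\<^sub>R (\<lambda>(x, y). \<bar>u x - u y\<bar> / norm (x - y) powr (real DIM('a) + s)) p = ?KU p"
        using ae_p by eventually_elim (auto simp: riesz_def n_def indicator_def)
    qed
  qed
  define L' where "L' = \<bar>L\<bar> + 1"
  let ?lip = "\<lambda>p::'a \<times> 'a. indicator \<Omega> (fst p) * lip_kernel s \<delta> (fst p - snd p) + indicator \<Omega> (snd p) * lip_kernel s \<delta> (fst p - snd p)"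
  have int_lip: "integrable lborel ?lip"
    using lip_kernel_integrable_fst[OF \<Omega>m \<Omega>fin s \<delta>] lip_kernel_integrable_snd[OF \<Omega>m \<Omega>fin s \<delta>]
    by (rule Bochner_Integration.integrable_add)
  have \<zeta>_diff: "\<bar>\<zeta> (fst p) - \<zeta> (snd p)\<bar> * ?K p \<le> ?KU p + L' * ?lip p" for p
  proof -
    obtain x y where p: "p = (x, y)" by (cases p)
    define m where "m = min 1 (norm (x - y) / \<delta>)"
    have m: "0 \<le> m" using \<delta> by (simp add: m_def)
    have lip_eq: "lip_kernel s \<delta> (x - y) = m * ?K p" by (simp add: lip_kernel_def m_def p n_def)
    have "\<bar>\<zeta> x - \<zeta> y\<bar> \<le> indicator (\<Omega> \<times> \<Omega>) p * \<bar>U x - U y\<bar> + L' * ((indicator \<Omega> x + indicator \<Omega> y) * m)"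
    proof (cases "\<eta> x \<noteq> 0 \<and> \<eta> y \<noteq> 0")
      case True
      then have in\<Omega>: "x \<in> \<Omega>" "y \<in> \<Omega>" using \<eta>0 by blast+
      have "\<bar>\<zeta> x - \<zeta> y\<bar> \<le> \<bar>U x - U y\<bar> + \<bar>w x - w y\<bar> + \<bar>\<eta> x - \<eta> y\<bar>"
        unfolding \<zeta>_def by (simp add: min_def abs_if)
      also have "\<bar>w x - w y\<bar> \<le> \<bar>L\<bar> * m"
        using w_lip[of x y] True m mult_right_mono[OF abs_ge_self[of L] m] by (simp add: m_def)
      also have "\<bar>\<eta> x - \<eta> y\<bar> \<le> m" using \<eta>_lip[of x y] by (simp add: m_def)
      also have "\<bar>U x - U y\<bar> + \<bar>L\<bar> * m + m \<le> \<bar>U x - U y\<bar> + 2 * (\<bar>L\<bar> * m + m)"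
        using m by simp
      also have "2 * (\<bar>L\<bar> * m + m) = L' * ((indicator \<Omega> x + indicator \<Omega> y) * m)"
        using in\<Omega> by (simp add: L'_def algebra_simps)
      also have "\<bar>U x - U y\<bar> = indicator (\<Omega> \<times> \<Omega>) p * \<bar>U x - U y\<bar>" using in\<Omega> by (simp add: p)
      finally show ?thesis by simp
    next
      case False
      then have a: "\<bar>\<zeta> x - \<zeta> y\<bar> \<le> \<bar>\<eta> x - \<eta> y\<bar>"
        using \<zeta>01[of x] \<zeta>01[of y] \<zeta>0[of x] \<zeta>0[of y] by auto
      have "\<bar>\<eta> x - \<eta> y\<bar> \<le> 1 * ((indicator \<Omega> x + indicator \<Omega> y) * m)"
      proof (cases "x \<in> \<Omega> \<or> y \<in> \<Omega>")
        case True
        then have "1 * m \<le> (indicator \<Omega> x + indicator \<Omega> y) * m"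
          using m by (intro mult_right_mono) (auto simp: indicator_def)
        then show ?thesis using \<eta>_lip[of x y, folded m_def] by linarith
      qed (simp add: \<eta>0)
      also have "\<dots> \<le> L' * ((indicator \<Omega> x + indicator \<Omega> y) * m)"
        using m by (intro mult_right_mono) (auto simp: L'_def indicator_def)
      finally have "\<bar>\<eta> x - \<eta> y\<bar> \<le> L' * ((indicator \<Omega> x + indicator \<Omega> y) * m)" .
      moreover have "0 \<le> indicator (\<Omega> \<times> \<Omega>) p * \<bar>U x - U y\<bar>" by simp
      ultimately show ?thesis using a by linarith
    qed
    from mult_right_mono[OF this, of "?K p"] show ?thesis
      unfolding p fst_conv snd_conv lip_eq[unfolded p fst_conv snd_conv] by (simp add: algebra_simps)
  qed
  have int_dom: "integrable lborel (\<lambda>p. ?KU p + L' * ?lip p)"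
    by (rule Bochner_Integration.integrable_add[OF int_KU integrable_mult_right[OF int_lip]])
  have int_d\<zeta>: "integrable lborel (\<lambda>p. (\<zeta> (fst p) - \<zeta> (snd p)) * ?K p)"
  proof (rule Bochner_Integration.integrable_bound[OF int_dom])
    show "AE p in lborel. norm ((\<zeta> (fst p) - \<zeta> (snd p)) * ?K p) \<le> norm (?KU p + L' * ?lip p)"
    proof (intro AE_I2)
      fix p
      show "norm ((\<zeta> (fst p) - \<zeta> (snd p)) * ?K p) \<le> norm (?KU p + L' * ?lip p)"
        using \<zeta>_diff[of p] unfolding real_norm_def by (simp add: abs_mult)
    qed
  qed measurable
  have vW: "v \<in> W_obst s \<Omega> \<Omega> \<phi> \<psi>"
  proof -
    have "set_integrable lebesgue \<Omega> u" using uW by (simp add: W_obst_def W_space_def)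
    then have "integrable lborel (\<lambda>x. indicator \<Omega> x * U x)"
      unfolding set_integrable_def
      by (subst (asm) integrable_lebesgue_iff_lborel[where g="\<lambda>x. indicator \<Omega> x * U x"])
         (use uU in \<open>auto elim!: eventually_mono\<close>)
    then have "integrable lborel (\<lambda>x. indicator \<Omega> x * U x - \<zeta> x)" using int_\<zeta>' by simp
    also have "(\<lambda>x. indicator \<Omega> x * U x - \<zeta> x) = (\<lambda>x. indicator \<Omega> x *\<^sub>R v x)"
      using \<zeta>_off by (auto simp: v_def indicator_def)
    finally have 1: "set_integrable lebesgue \<Omega> v"
      unfolding set_integrable_def by (simp add: integrable_completion)
    let ?Kv = "\<lambda>p. indicator (\<Omega> \<times> \<Omega>) p * (\<bar>v (fst p) - v (snd p)\<bar> * ?K p)"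
    have Kv[measurable]: "?Kv \<in> borel_measurable borel" by measurable
    have "integrable lborel ?Kv"
    proof (rule Bochner_Integration.integrable_bound)
      show "integrable lborel (\<lambda>p. ?KU p + norm ((\<zeta> (fst p) - \<zeta> (snd p)) * ?K p))"
        using int_KU int_d\<zeta> by (intro Bochner_Integration.integrable_add integrable_norm)
      show "AE p in lborel. norm (?Kv p) \<le> norm (?KU p + norm ((\<zeta> (fst p) - \<zeta> (snd p)) * ?K p))"
      proof (intro AE_I2)
        fix p
        have "\<bar>v (fst p) - v (snd p)\<bar> \<le> \<bar>U (fst p) - U (snd p)\<bar> + \<bar>\<zeta> (fst p) - \<zeta> (snd p)\<bar>"
          by (simp add: v_def)
        from mult_right_mono[OF this, of "?K p"]
        show "norm (?Kv p) \<le> norm (?KU p + norm ((\<zeta> (fst p) - \<zeta> (snd p)) * ?K p))"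
          by (simp add: indicator_def abs_mult distrib_right)
      qed
    qed simp
    then have "integrable lebesgue ?Kv" using Kv by (simp add: integrable_completion)
    also have "?Kv = (\<lambda>p. indicator (\<Omega> \<times> \<Omega>) p *\<^sub>R (\<lambda>(x, y). \<bar>v x - v y\<bar> / norm (x - y) powr (real DIM('a) + s)) p)"
      by (auto simp: riesz_def n_def)
    finally have 2: "set_integrable lebesgue (\<Omega> \<times> \<Omega>) (\<lambda>(x, y). \<bar>v x - v y\<bar> / norm (x - y) powr (real DIM('a) + s))"
      unfolding set_integrable_def .
    have 3: "AE x in lborel. x \<notin> \<Omega> \<longrightarrow> v x = \<phi> x"
      using w\<phi> by eventually_elim (simp add: vw)
    have 4: "AE x in lborel. x \<in> \<Omega> \<longrightarrow> \<psi> x \<le> v x"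
    proof (intro AE_I2 impI)
      fix x assume "x \<in> \<Omega>"
      then show "\<psi> x \<le> v x" using wv[of x] w\<psi>[of x] by simp
    qed
    show ?thesis
      using 1 2 3 4 by (simp add: W_obst_def W_space_def AE_completion_iff measurable_completion)
  qed
  define E where "E p = (calG n s (dquot U p) - calG n s (dquot v p)) / norm (fst p - snd p) powr (real n - 1 + s)"
    for p :: "'a \<times> 'a"
  have [measurable]: "E \<in> borel_measurable borel" unfolding E_def by measurable
  have E_le0: "(LBINT p. E p) \<le> 0"
  proof -
    have "set_lebesgue_integral lebesgue (Q_set \<Omega>)
          (\<lambda>(x, y). (calG DIM('a) s ((u x - u y) / norm (x - y))
                   - calG DIM('a) s ((v x - v y) / norm (x - y)))
                  / norm (x - y) powr (real DIM('a) - 1 + s)) = (LBINT p. E p)"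
      unfolding set_lebesgue_integral_def
    proof (rule integral_lebesgue_eq_lborel)
      show "AE p in lborel. indicator (Q_set \<Omega>) p *\<^sub>R (\<lambda>(x, y). (calG DIM('a) s ((u x - u y) / norm (x - y))
                   - calG DIM('a) s ((v x - v y) / norm (x - y)))
                  / norm (x - y) powr (real DIM('a) - 1 + s)) p = E p"
        using ae_p
      proof eventually_elim
        case (elim p)
        obtain x y where p: "p = (x, y)" by (cases p)
        show ?case
        proof (cases "x \<in> \<Omega> \<or> y \<in> \<Omega>")
          case True
          then show ?thesis using elim by (auto simp: p E_def dquot_def Q_set_def n_def)
        next
          case False
          then show ?thesis by (simp add: p E_def dquot_def Q_set_def n_def vw Uw)
        qed
      qed
    qed measurable
    then show ?thesis
      using bspec[OF conjunct2[OF sol[unfolded solves_obstacle_def]] vW] by simp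
  qed
  have K_eq: "?K p = 1 / (norm (fst p - snd p) * norm (fst p - snd p) powr (real n - 1 + s))" for p :: "'a \<times> 'a"
  proof (cases "fst p = snd p")
    case False
    then have "norm (fst p - snd p) powr (1 + (real n - 1 + s)) = norm (fst p - snd p) * norm (fst p - snd p) powr (real n - 1 + s)"
      by (subst powr_add) simp
    then show ?thesis by (simp add: riesz_def)
  qed (simp add: riesz_def)
  have dq: "dquot U p - dquot v p = (\<zeta> (fst p) - \<zeta> (snd p)) / norm (fst p - snd p)" for p
    by (simp add: dquot_def v_def diff_divide_distrib[symmetric])
  have int_E: "integrable lborel E"
  proof (rule Bochner_Integration.integrable_bound)
    show "integrable lborel (\<lambda>p. G_bound n s * ((\<zeta> (fst p) - \<zeta> (snd p)) * ?K p))"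
      using int_d\<zeta> by (rule integrable_mult_right)
    show "AE p in lborel. norm (E p) \<le> norm (G_bound n s * ((\<zeta> (fst p) - \<zeta> (snd p)) * ?K p))"
    proof (intro AE_I2)
      fix p
      have "\<bar>calG n s (dquot U p) - calG n s (dquot v p)\<bar> / norm (fst p - snd p) powr (real n - 1 + s)
         \<le> G_bound n s * \<bar>dquot U p - dquot v p\<bar> / norm (fst p - snd p) powr (real n - 1 + s)"
        using n s by (intro divide_right_mono calG_lipschitz) auto
      then show "norm (E p) \<le> norm (G_bound n s * ((\<zeta> (fst p) - \<zeta> (snd p)) * ?K p))"
        using G_bound_nonneg[of n s] unfolding E_def dq K_eq by (simp add: abs_mult)
    qed
  qed simp
  define B where "B = {x \<in> \<Omega>. \<eta> x < 1}"
  have Bm[measurable]: "B \<in> sets borel"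
  proof -
    have "{x \<in> space borel. x \<in> \<Omega> \<and> \<eta> x < 1} \<in> sets borel" by measurable
    then show ?thesis by (simp add: B_def)
  qed
  have Bfin: "emeasure lborel B < \<infinity>"
    by (rule emeasure_bounded_finite[OF bounded_subset[OF \<Omega>(2)]]) (auto simp: B_def)
  let ?lipB = "\<lambda>p::'a \<times> 'a. indicator B (fst p) * lip_kernel s \<delta> (fst p - snd p) + indicator B (snd p) * lip_kernel s \<delta> (fst p - snd p)"
  note lB = lip_kernel_integrable_fst[OF Bm Bfin s \<delta>] lip_kernel_integrable_snd[OF Bm Bfin s \<delta>]
  have int_lipB: "integrable lborel ?lipB"
    using lB by (rule Bochner_Integration.integrable_add)
  have lipB_le: "(LBINT p. ?lipB p) \<le> 2 * (measure lborel B * lip_mass DIM('a) s \<delta>)"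
    using lip_kernel_integral_fst[OF Bm Bfin s \<delta>] lip_kernel_integral_snd[OF Bm Bfin s \<delta>] lB by simp
  define D where "D p = G_fun n s (dquot w p) * (\<zeta> (fst p) - \<zeta> (snd p)) * ?K p" for p
  have D_eq: "D = (\<lambda>p. G_fun DIM('a) s (dquot w p) * (\<zeta> (fst p) - \<zeta> (snd p)) * frac_kernel s (fst p - snd p))"
    by (simp add: D_def[abs_def] n_def)
  have \<zeta>m: "\<zeta> \<in> borel_measurable borel" by measurable
  note weak_form = weak_form_lower_bound[OF w \<zeta>m int_\<zeta>' s(1) r \<zeta>01(1) \<zeta>_off curv int_d\<zeta>[unfolded n_def]]
  have weak: "integrable lborel D" "(LBINT x. \<zeta> x) \<le> (LBINT p. D p)"
    unfolding D_eq by (rule weak_form; assumption)+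
  have E_ge: "D p - 2 * G_bound n s * ?lipB p \<le> E p" for p
  proof -
    obtain x y where p: "p = (x, y)" by (cases p)
    define err where "err = indicator \<Omega> x * max 0 (\<eta> y - \<eta> x) + indicator \<Omega> y * max 0 (\<eta> x - \<eta> y)"
    have one: "indicator \<Omega> x * max 0 (\<eta> y - \<eta> x) \<le> indicator B x * min 1 (norm (x - y) / \<delta>)" for x y
      using \<eta>_lip[of x y] \<eta>01(2)[of y] \<delta> by (auto simp: B_def indicator_def not_less)
    have "err \<le> (indicator B x + indicator B y) * min 1 (norm (x - y) / \<delta>)"
      using one[of x y] one[of y x] by (simp add: err_def distrib_right norm_minus_commute)
    then have "err * ?K p \<le> (indicator B x + indicator B y) * min 1 (norm (x - y) / \<delta>) * ?K p"
      by (rule mult_right_mono) simp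
    also have "\<dots> = ?lipB p"
      by (simp add: p lip_kernel_def n_def algebra_simps)
    finally have err: "2 * G_bound n s * (err * ?K p) \<le> 2 * G_bound n s * ?lipB p"
      using G_bound_nonneg[of n s] by (intro mult_left_mono) auto
    have "G_fun n s (dquot w (x, y)) * (\<zeta> x - \<zeta> y) - 2 * G_bound n s * err
       \<le> G_fun n s (dquot v (x, y)) * (\<zeta> x - \<zeta> y)"
      unfolding err_def v_def using n s wU Uw \<eta>01(1)
      by (intro truncation_monotone) (auto simp: \<zeta>_def)
    from mult_right_mono[OF this, of "?K p"]
    have "D p - 2 * G_bound n s * (err * ?K p) \<le> G_fun n s (dquot v p) * (\<zeta> x - \<zeta> y) * ?K p"
      by (simp add: D_def p algebra_simps)
    also have "\<dots> = G_fun n s (dquot v p) * (dquot U p - dquot v p) / norm (fst p - snd p) powr (real n - 1 + s)"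
      unfolding dq K_eq by (simp add: p)
    also have "\<dots> \<le> E p"
      unfolding E_def by (intro divide_right_mono calG_convex) simp
    finally show ?thesis using err by linarith
  qed
  have int_err: "integrable lborel (\<lambda>p. 2 * G_bound n s * ?lipB p)"
    using int_lipB by (rule integrable_mult_right)
  have "(LBINT p. D p) - 2 * G_bound n s * (LBINT p. ?lipB p) = (LBINT p. D p - 2 * G_bound n s * ?lipB p)"
    by (simp only: Bochner_Integration.integral_diff[OF weak(1) int_err] integral_mult_right_zero)
  also have "\<dots> \<le> (LBINT p. E p)"
    by (rule integral_mono[OF Bochner_Integration.integrable_diff[OF weak(1) int_err] int_E E_ge])
  finally have "(LBINT p. D p) \<le> 2 * G_bound n s * (LBINT p. ?lipB p)" using E_le0 by linarith
  also have "\<dots> \<le> 2 * G_bound n s * (2 * (measure lborel B * lip_mass DIM('a) s \<delta>))"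
    using G_bound_nonneg[of n s] by (intro mult_left_mono lipB_le) auto
  finally have "(LBINT x. \<zeta> x) \<le> 4 * G_bound n s * measure lborel B * lip_mass DIM('a) s \<delta>"
    using weak(2) by simp
  then show "(LBINT x. min (U x - w x) (\<eta> x))
      \<le> 4 * G_bound DIM('a) s * measure lborel {x \<in> \<Omega>. \<eta> x < 1} * lip_mass DIM('a) s \<delta>"
    by (simp add: \<zeta>_def B_def n_def)
qed

section \<open>Domains with twice differentiable boundary\<close>

text \<open>
  A property with a constant that may be increased holds with a single constant on a compact set if
  it does so locally. The set \<open>T\<close> keeps the points at which it is asserted apart from the compact set
  that is covered, typically an open set and its closure.
\<close>
lemma compact_uniform_constant:
  fixes S :: "'a::metric_space set" and P :: "real \<Rightarrow> 'a \<Rightarrow> bool"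
  assumes S: "compact S"
    and mono: "\<And>x c c'. P c x \<Longrightarrow> c \<le> c' \<Longrightarrow> P c' x"
    and loc: "\<And>p. p \<in> S \<Longrightarrow> \<exists>\<rho>>0. \<exists>c. \<forall>x\<in>ball p \<rho> \<inter> T. P c x"
  shows "\<exists>c>0. \<forall>x\<in>S \<inter> T. P c x"
proof -
  obtain \<rho> c where \<rho>: "\<And>p. p \<in> S \<Longrightarrow> 0 < \<rho> p" "\<And>p x. p \<in> S \<Longrightarrow> x \<in> ball p (\<rho> p) \<inter> T \<Longrightarrow> P (c p) x"
    using loc by metis
  obtain F where F: "F \<subseteq> S" "finite F" "S \<subseteq> (\<Union>p\<in>F. ball p (\<rho> p))"
    using S \<rho>(1) by (elim compactE_image[of S S "\<lambda>p. ball p (\<rho> p)"]) auto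
  define C where "C = Max (insert 1 (c ` F))"
  have "P C x" if x: "x \<in> S \<inter> T" for x
  proof -
    obtain p where p: "p \<in> F" "x \<in> ball p (\<rho> p)" using F x by auto
    then have "P (c p) x" using \<rho>(2)[of p x] F x by auto
    moreover have "c p \<le> C" using F(2) p(1) by (auto simp: C_def)
    ultimately show ?thesis by (rule mono)
  qed
  moreover have "1 \<le> C" using F(2) by (auto simp: C_def)
  then have "0 < C" by simp
  ultimately show ?thesis by blast
qed

text \<open>
  Only the segment has to lie in the region where \<open>f\<close> is twice differentiable. The second estimate
  is the mean value inequality for \<open>f\<close> minus its tangent at \<open>a\<close>, whose gradient is small by the first.
\<close>
lemma taylor_segment:
  fixes f :: "'a::euclidean_space \<Rightarrow> real"
  assumes f: "\<And>z. z \<in> closed_segment a b \<Longrightarrow> GDERIV f z :> g z"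
    and g: "\<And>z. z \<in> closed_segment a b \<Longrightarrow> (g has_derivative blinfun_apply (H z)) (at z)"
    and H: "\<And>z. z \<in> closed_segment a b \<Longrightarrow> norm (H z) \<le> M"
  shows "norm (g b - g a) \<le> M * norm (b - a)"
    and "\<bar>f b - f a - g a \<bullet> (b - a)\<bar> \<le> M * (norm (b - a))\<^sup>2"
proof -
  have M: "0 \<le> M" by (rule order_trans[OF norm_ge_zero H[of a]]) simp
  have gb: "norm (g z - g a) \<le> M * norm (z - a)" if "z \<in> closed_segment a b" for z
  proof (rule differentiable_bound[where S="closed_segment a b" and f'="\<lambda>z. blinfun_apply (H z)"])
    fix y assume y: "y \<in> closed_segment a b"
    show "(g has_derivative blinfun_apply (H y)) (at y within closed_segment a b)"
      by (rule has_derivative_at_withinI[OF g[OF y]])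
    show "onorm (blinfun_apply (H y)) \<le> M"
      using H[OF y] by (simp add: norm_blinfun.rep_eq)
  qed (use that in simp_all)
  then show "norm (g b - g a) \<le> M * norm (b - a)" by simp
  have "norm ((f b - g a \<bullet> b) - (f a - g a \<bullet> a)) \<le> (M * norm (b - a)) * norm (b - a)"
  proof (rule differentiable_bound[where S="closed_segment a b" and f'="\<lambda>z v. v \<bullet> (g z - g a)"])
    fix z assume z: "z \<in> closed_segment a b"
    have "(f has_derivative (\<lambda>v. v \<bullet> g z)) (at z)" using f[OF z] by (simp add: gderiv_def)
    then have "((\<lambda>z. f z - g a \<bullet> z) has_derivative (\<lambda>v. v \<bullet> g z - g a \<bullet> v)) (at z within closed_segment a b)"
      by (intro has_derivative_diff has_derivative_inner_right has_derivative_ident)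
         (rule has_derivative_at_withinI)
    then show "((\<lambda>z. f z - g a \<bullet> z) has_derivative (\<lambda>v. v \<bullet> (g z - g a))) (at z within closed_segment a b)"
      by (simp add: inner_diff_right inner_commute)
    have "norm (z - a) \<le> norm (b - a)"
      using z by (simp add: segment_bound)
    then have "M * norm (z - a) \<le> M * norm (b - a)" using M by (rule mult_left_mono)
    then have gz: "norm (g z - g a) \<le> M * norm (b - a)" using gb[OF z] by linarith
    show "onorm (\<lambda>v. v \<bullet> (g z - g a)) \<le> M * norm (b - a)"
    proof (rule onorm_bound)
      show "norm (v \<bullet> (g z - g a)) \<le> M * norm (b - a) * norm v" for v
        using Cauchy_Schwarz_ineq2[of v "g z - g a"] mult_right_mono[OF gz norm_ge_zero[of v]]
        by (simp add: mult.commute)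
    qed (use M in simp)
  qed auto
  moreover have "(f b - g a \<bullet> b) - (f a - g a \<bullet> a) = f b - f a - g a \<bullet> (b - a)"
    by (simp add: inner_diff_right)
  ultimately show "\<bar>f b - f a - g a \<bullet> (b - a)\<bar> \<le> M * (norm (b - a))\<^sup>2"
    by (simp only: real_norm_def power2_eq_square mult.assoc)
qed

lemma C2_UNIV_bounds:
  fixes \<gamma> :: "'a::euclidean_space \<Rightarrow> real"
  assumes "C2_on UNIV \<gamma>"
  shows "\<exists>L M g. 0 \<le> L \<and> 0 \<le> M \<and> continuous_on UNIV \<gamma> \<and>
    (\<forall>a\<in>cball q R. \<forall>b\<in>cball q R. \<bar>\<gamma> b - \<gamma> a\<bar> \<le> L * norm (b - a)) \<and>
    (\<forall>a\<in>cball q R. \<forall>b\<in>cball q R. \<bar>\<gamma> b - \<gamma> a - g a \<bullet> (b - a)\<bar> \<le> M * (norm (b - a))\<^sup>2)"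
proof -
  obtain g H where gH: "\<And>x. GDERIV \<gamma> x :> g x" "\<And>x. (g has_derivative blinfun_apply (H x)) (at x)" "continuous_on UNIV H"
    using assms by (auto simp: C2_on_def C2_with_derivs_def)
  have cg: "continuous_on UNIV g"
    using gH(2) by (intro continuous_at_imp_continuous_on ballI) (auto intro: has_derivative_continuous)
  have c\<gamma>: "continuous_on UNIV \<gamma>"
    using gH(1) by (intro continuous_at_imp_continuous_on ballI) (auto simp: gderiv_def intro: has_derivative_continuous)
  have "bounded (g ` cball q R)" "bounded (H ` cball q R)"
    by (intro compact_imp_bounded compact_continuous_image continuous_on_subset[OF cg] continuous_on_subset[OF gH(3)]; simp)+
  then obtain L M where L: "0 < L" "\<And>x. x \<in> cball q R \<Longrightarrow> norm (g x) \<le> L"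
    and M: "0 < M" "\<And>x. x \<in> cball q R \<Longrightarrow> norm (H x) \<le> M"
    unfolding bounded_pos by blast
  have "\<bar>\<gamma> b - \<gamma> a\<bar> \<le> L * norm (b - a)" if ab: "a \<in> cball q R" "b \<in> cball q R" for a b
  proof -
    have "norm (\<gamma> b - \<gamma> a) \<le> L * norm (b - a)"
    proof (rule differentiable_bound[where S="cball q R" and f'="\<lambda>x v. v \<bullet> g x"])
      fix x assume x: "x \<in> cball q R"
      show "(\<gamma> has_derivative (\<lambda>v. v \<bullet> g x)) (at x within cball q R)"
        using gH(1)[of x] by (auto simp: gderiv_def intro: has_derivative_at_withinI)
      show "onorm (\<lambda>v. v \<bullet> g x) \<le> L"
      proof (rule onorm_bound)
        show "norm (v \<bullet> g x) \<le> L * norm v" for v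
          using Cauchy_Schwarz_ineq2[of v "g x"] mult_right_mono[OF L(2)[OF x] norm_ge_zero[of v]]
          by (simp add: mult.commute)
      qed (use L in simp)
    qed (use ab in auto)
    then show ?thesis by simp
  qed
  moreover have "\<bar>\<gamma> b - \<gamma> a - g a \<bullet> (b - a)\<bar> \<le> M * (norm (b - a))\<^sup>2" if ab: "a \<in> cball q R" "b \<in> cball q R" for a b
  proof (rule taylor_segment[where H=H])
    fix z assume "z \<in> closed_segment a b"
    then have "z \<in> cball q R" using ab closed_segment_subset[of a "cball q R" b] by auto
    then show "norm (H z) \<le> M" by (rule M(2))
  qed (use gH in auto)
  ultimately show ?thesis using L(1) M(1) c\<gamma> by (intro exI[of _ L] exI[of _ M] exI[of _ g]) simp
qed

text \<open>For a unit vector \<open>e\<close> this is the projection along which boundaries are graphs.\<close>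
definition proj_perp :: "'a::real_inner \<Rightarrow> 'a \<Rightarrow> 'a" where
  "proj_perp e x = x - (x \<bullet> e) *\<^sub>R e"

lemma proj_perp_add: "proj_perp e (x + y) = proj_perp e x + proj_perp e y"
  by (simp add: proj_perp_def inner_add_left algebra_simps)

lemma proj_perp_diff: "proj_perp e (x - y) = proj_perp e x - proj_perp e y"
  by (simp add: proj_perp_def inner_diff_left algebra_simps)

lemma proj_perp_scaleR: "proj_perp e (c *\<^sub>R x) = c *\<^sub>R proj_perp e x"
  by (simp add: proj_perp_def algebra_simps)

lemma proj_perp_self: "norm e = 1 \<Longrightarrow> proj_perp e e = 0"
  by (simp add: proj_perp_def dot_square_norm)

lemma norm_proj_perp_le:
  assumes "norm e = 1"
  shows "norm (proj_perp e x) \<le> norm x"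
proof -
  have ee: "e \<bullet> e = 1" using assms by (simp add: dot_square_norm)
  have "(norm (proj_perp e x))\<^sup>2 = (norm x)\<^sup>2 - (x \<bullet> e)\<^sup>2"
    unfolding power2_norm_eq_inner proj_perp_def
    by (simp add: inner_diff_left inner_diff_right ee inner_commute power2_eq_square)
  then have "(norm (proj_perp e x))\<^sup>2 \<le> (norm x)\<^sup>2" by simp
  then show ?thesis by (rule power2_le_imp_le) simp
qed

lemma proj_perp_cball:
  assumes "norm e = 1" "x \<in> cball p r"
  shows "proj_perp e x \<in> cball (proj_perp e p) r"
  using norm_proj_perp_le[OF assms(1), of "p - x"] assms(2)
  by (simp add: dist_norm proj_perp_diff)

lemma abs_inner_unit_le: "norm e = 1 \<Longrightarrow> \<bar>x \<bullet> e\<bar> \<le> norm x"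
  using Cauchy_Schwarz_ineq2[of x e] by simp

text \<open>
  On the ball of a chart the function \<open>\<gamma>\<close> is Lipschitz and has a second order Taylor expansion with
  uniform constants.
\<close>
lemma C2_boundary_chart:
  assumes "C2_boundary U" "p \<in> frontier U"
  obtains r e \<gamma> g L M where "0 < r" "norm e = 1" "0 \<le> L" "0 \<le> M" "continuous_on UNIV \<gamma>"
    "\<And>x. x \<in> ball p r \<Longrightarrow> x \<in> U \<longleftrightarrow> \<gamma> (proj_perp e x) < x \<bullet> e"
    "\<And>x y. x \<in> cball p r \<Longrightarrow> y \<in> cball p r \<Longrightarrow> \<bar>\<gamma> (proj_perp e y) - \<gamma> (proj_perp e x)\<bar> \<le> L * norm (y - x)"
    "\<And>x y. x \<in> cball p r \<Longrightarrow> y \<in> cball p r \<Longrightarrow>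
       \<bar>\<gamma> (proj_perp e y) - \<gamma> (proj_perp e x) - g x \<bullet> proj_perp e (y - x)\<bar> \<le> M * (norm (y - x))\<^sup>2"
proof -
  obtain r e \<gamma> where r: "0 < r" and e: "norm e = 1" and C2: "C2_on UNIV \<gamma>"
    and U: "U \<inter> ball p r = {x \<in> ball p r. \<gamma> (x - (x \<bullet> e) *\<^sub>R e) < x \<bullet> e}"
    using assms unfolding C2_boundary_def by blast
  obtain L M g where g: "0 \<le> L" "0 \<le> M" "continuous_on UNIV \<gamma>"
    and lip: "\<forall>a\<in>cball (proj_perp e p) r. \<forall>b\<in>cball (proj_perp e p) r. \<bar>\<gamma> b - \<gamma> a\<bar> \<le> L * norm (b - a)"
    and tay: "\<forall>a\<in>cball (proj_perp e p) r. \<forall>b\<in>cball (proj_perp e p) r.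
       \<bar>\<gamma> b - \<gamma> a - g a \<bullet> (b - a)\<bar> \<le> M * (norm (b - a))\<^sup>2"
    using C2_UNIV_bounds[OF C2, of "proj_perp e p" r] by blast
  show thesis
  proof (rule that[OF r e g(1-3), of "\<lambda>x. g (proj_perp e x)"])
    fix x y assume xy: "x \<in> cball p r" "y \<in> cball p r"
    note pp = proj_perp_cball[OF e xy(1)] proj_perp_cball[OF e xy(2)]
    have le: "norm (proj_perp e (y - x)) \<le> norm (y - x)" by (rule norm_proj_perp_le[OF e])
    show "\<bar>\<gamma> (proj_perp e y) - \<gamma> (proj_perp e x)\<bar> \<le> L * norm (y - x)"
      using bspec[OF bspec[OF lip pp(1)] pp(2)] mult_left_mono[OF le g(1)] by (simp add: proj_perp_diff)
    have "M * (norm (proj_perp e (y - x)))\<^sup>2 \<le> M * (norm (y - x))\<^sup>2"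
      using g(2) le by (intro mult_left_mono power_mono) auto
    then show "\<bar>\<gamma> (proj_perp e y) - \<gamma> (proj_perp e x) - g (proj_perp e x) \<bullet> proj_perp e (y - x)\<bar> \<le> M * (norm (y - x))\<^sup>2"
      using bspec[OF bspec[OF tay pp(1)] pp(2)] by (simp add: proj_perp_diff)
  next
    fix x assume x: "x \<in> ball p r"
    have "x \<in> U \<inter> ball p r \<longleftrightarrow> x \<in> {x \<in> ball p r. \<gamma> (x - (x \<bullet> e) *\<^sub>R e) < x \<bullet> e}"
      by (simp only: U)
    then show "x \<in> U \<longleftrightarrow> \<gamma> (proj_perp e x) < x \<bullet> e"
      using x by (simp add: proj_perp_def)
  qed
qed

lemma frontier_between:
  fixes \<Omega> :: "'a::euclidean_space set"
  assumes "x \<in> \<Omega>" "z \<notin> \<Omega>"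
  obtains q where "q \<in> frontier \<Omega>" "dist x q \<le> dist x z" "dist z q \<le> dist x z" "q \<in> closed_segment x z"
proof -
  have "closed_segment x z \<inter> frontier \<Omega> \<noteq> {}"
    using assms by (intro connected_Int_frontier connected_segment) auto
  then obtain q where "q \<in> closed_segment x z" "q \<in> frontier \<Omega>" by blast
  then show thesis
    using segment_bound[of q x z] by (intro that[of q]) (auto simp: dist_norm norm_minus_commute)
qed

text \<open>
  In a chart with Lipschitz constant \<open>L\<close>, points at distance less than \<open>\<delta>\<close> from the boundary lie in
  a strip of thickness \<open>(L + 1) \<delta>\<close> above the graph, and finitely many charts suffice.
\<close>
lemma boundary_layer_measure:
  fixes \<Omega> :: "'a::euclidean_space set"
  assumes \<Omega>: "open \<Omega>" "bounded \<Omega>" and C2: "C2_boundary \<Omega>"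
  obtains C \<delta>\<^sub>0 where "0 \<le> C" "0 < \<delta>\<^sub>0"
    "\<And>\<delta>. 0 < \<delta> \<Longrightarrow> \<delta> < \<delta>\<^sub>0 \<Longrightarrow> measure lborel {x \<in> \<Omega>. infdist x (- \<Omega>) < \<delta>} \<le> C * \<delta>"
proof -
  have ne: "- \<Omega> \<noteq> {}"
  proof
    assume "- \<Omega> = {}"
    then have "\<Omega> = UNIV" by auto
    then show False using \<Omega>(2) not_bounded_UNIV[where 'a='a] by simp
  qed
  have near: "\<exists>q\<in>frontier \<Omega>. dist x q < \<delta>" if x: "x \<in> \<Omega>" "infdist x (- \<Omega>) < \<delta>" for x \<delta>
  proof -
    obtain z where z: "z \<in> - \<Omega>" "dist x z < \<delta>"
      using x(2) ne by (auto simp: infdist_def cInf_less_iff split: if_splits)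
    then show ?thesis using frontier_between[of x \<Omega> z] x by (metis ComplD le_less_trans)
  qed
  define layer where "layer \<delta> = {x \<in> \<Omega>. infdist x (- \<Omega>) < \<delta>}" for \<delta>
  have layer_m: "layer \<delta> \<in> sets borel" for \<delta>
  proof -
    have "layer \<delta> = \<Omega> \<inter> {x. infdist x (- \<Omega>) < \<delta>}" by (auto simp: layer_def)
    moreover have "open {x. infdist x (- \<Omega>) < \<delta>}"
      by (intro open_Collect_less continuous_intros)
    ultimately show ?thesis using \<Omega>(1) by auto
  qed
  have loc: "\<exists>\<rho>>0. \<exists>C\<ge>0. \<forall>\<delta>. 0 < \<delta> \<longrightarrow> \<delta> < \<rho> \<longrightarrow> measure lborel (layer \<delta> \<inter> ball p \<rho>) \<le> C * \<delta>"
    if p: "p \<in> frontier \<Omega>" for p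
  proof -
    obtain r e \<gamma> g L M where ch: "0 < r" "norm e = 1" "0 \<le> L" "continuous_on UNIV \<gamma>"
      "\<And>x. x \<in> ball p r \<Longrightarrow> x \<in> \<Omega> \<longleftrightarrow> \<gamma> (proj_perp e x) < x \<bullet> e"
      "\<And>x y. x \<in> cball p r \<Longrightarrow> y \<in> cball p r \<Longrightarrow> \<bar>\<gamma> (proj_perp e y) - \<gamma> (proj_perp e x)\<bar> \<le> L * norm (y - x)"
      using C2_boundary_chart[OF C2 p] by metis
    \<comment> \<open>small enough for boundary points close to \<open>x\<close> to stay in the chart, and for the strip to be
      thinner than the chart\<close>
    define \<rho> where "\<rho> = r / (2 * (L + 1))"
    define C where "C = 2 * (L + 1) / r * (unit_ball_vol DIM('a) * (2 * r) ^ DIM('a))"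
    have \<rho>: "0 < \<rho>" "(L + 1) * \<rho> \<le> r" "2 * \<rho> \<le> r"
      using ch(1,3) by (auto simp: \<rho>_def field_simps)
    have C: "0 \<le> C" using ch(1,3) by (simp add: C_def)
    have "measure lborel (layer \<delta> \<inter> ball p \<rho>) \<le> C * \<delta>" if \<delta>: "0 < \<delta>" "\<delta> < \<rho>" for \<delta>
    proof -
      have sub: "layer \<delta> \<inter> ball p \<rho> \<subseteq> cball p r \<inter> strip e \<gamma> ((L + 1) * \<delta>)"
      proof
        fix x assume x: "x \<in> layer \<delta> \<inter> ball p \<rho>"
        then have x\<Omega>: "x \<in> \<Omega>" by (simp add: layer_def)
        obtain q where q: "q \<in> frontier \<Omega>" "dist x q < \<delta>"
          using near x by (auto simp: layer_def)
        have xb: "x \<in> ball p r" using x \<rho> by auto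
        have qb: "q \<in> ball p r"
          using x q \<rho> \<delta> dist_triangle[of p q x] by (auto simp: mem_ball)
        have "q \<notin> \<Omega>" using q(1) \<Omega>(1) by (simp add: frontier_def interior_open)
        then have "q \<bullet> e \<le> \<gamma> (proj_perp e q)" using ch(5)[OF qb] by simp
        moreover have "\<gamma> (proj_perp e x) < x \<bullet> e" using ch(5)[OF xb] x\<Omega> by simp
        moreover have "\<bar>\<gamma> (proj_perp e q) - \<gamma> (proj_perp e x)\<bar> \<le> L * norm (q - x)"
          using xb qb by (intro ch(6)) auto
        moreover have "L * norm (q - x) \<le> L * \<delta>"
          using q(2) ch(3) by (intro mult_left_mono) (auto simp: dist_norm norm_minus_commute)
        moreover have "\<bar>(x - q) \<bullet> e\<bar> \<le> norm (x - q)" by (rule abs_inner_unit_le[OF ch(2)])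
        ultimately show "x \<in> cball p r \<inter> strip e \<gamma> ((L + 1) * \<delta>)"
          using xb q(2) by (auto simp: strip_def proj_perp_def[symmetric] dist_norm inner_diff_left algebra_simps)
      qed
      have mg: "\<gamma> \<in> borel_measurable borel" using ch(4) by (rule borel_measurable_continuous_onI)
      have "(L + 1) * \<delta> \<le> (L + 1) * \<rho>" using \<delta> ch(3) by (intro mult_left_mono) auto
      then have "(L + 1) * \<delta> \<le> r" using \<rho>(2) by linarith
      moreover have "0 < (L + 1) * \<delta>" using \<delta> ch(3) by simp
      ultimately have t: "0 < (L + 1) * \<delta>" "(L + 1) * \<delta> \<le> r" by simp_all
      have "emeasure lborel (layer \<delta> \<inter> ball p \<rho>) \<le> emeasure lborel (cball p r \<inter> strip e \<gamma> ((L + 1) * \<delta>))"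
        using strip_borel[OF mg] by (intro emeasure_mono sub) (auto intro: sets.Int)
      also have "\<dots> \<le> ennreal (2 * ((L + 1) * \<delta>) / r * (unit_ball_vol DIM('a) * (2 * r) ^ DIM('a)))"
        by (rule emeasure_strip_le[OF ch(2) mg t])
      also have "2 * ((L + 1) * \<delta>) / r * (unit_ball_vol DIM('a) * (2 * r) ^ DIM('a)) = C * \<delta>"
        by (simp add: C_def)
      finally show ?thesis
        using C \<delta> unfolding measure_def by (intro enn2real_leI) auto
    qed
    then show ?thesis using \<rho>(1) C by blast
  qed
  then obtain \<rho> C where \<rho>: "\<And>p. p \<in> frontier \<Omega> \<Longrightarrow> 0 < \<rho> p" "\<And>p. p \<in> frontier \<Omega> \<Longrightarrow> 0 \<le> C p"
    "\<And>p \<delta>. p \<in> frontier \<Omega> \<Longrightarrow> 0 < \<delta> \<Longrightarrow> \<delta> < \<rho> p \<Longrightarrow> measure lborel (layer \<delta> \<inter> ball p (\<rho> p)) \<le> C p * \<delta>"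
    by metis
  have cf: "compact (frontier \<Omega>)" using \<Omega>(2) by (rule compact_frontier_bounded)
  obtain F where F: "F \<subseteq> frontier \<Omega>" "finite F" "frontier \<Omega> \<subseteq> (\<Union>p\<in>F. ball p (\<rho> p / 2))"
    using cf \<rho>(1) by (elim compactE_image[of _ "frontier \<Omega>" "\<lambda>p. ball p (\<rho> p / 2)"]) (auto intro!: bexI)
  define \<delta>\<^sub>0 where "\<delta>\<^sub>0 = Min (insert 1 ((\<lambda>p. \<rho> p / 2) ` F))"
  have d0: "0 < \<delta>\<^sub>0" using F(1,2) \<rho>(1) by (auto simp: \<delta>\<^sub>0_def)
  have d0p: "\<delta>\<^sub>0 \<le> \<rho> p / 2" if "p \<in> F" for p
    unfolding \<delta>\<^sub>0_def using F(2) that by (intro Min_le) auto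
  have "measure lborel (layer \<delta>) \<le> (\<Sum>p\<in>F. C p) * \<delta>" if \<delta>: "0 < \<delta>" "\<delta> < \<delta>\<^sub>0" for \<delta>
  proof -
    have sub: "layer \<delta> \<subseteq> (\<Union>p\<in>F. layer \<delta> \<inter> ball p (\<rho> p))"
    proof
      fix x assume x: "x \<in> layer \<delta>"
      then obtain q where q: "q \<in> frontier \<Omega>" "dist x q < \<delta>" using near by (auto simp: layer_def)
      then obtain p where p: "p \<in> F" "dist p q < \<rho> p / 2" using F(3) by auto
      have "dist p x < \<rho> p"
        using p q \<delta> d0p[OF p(1)] dist_triangle[of p x q] by (simp add: dist_commute)
      then show "x \<in> (\<Union>p\<in>F. layer \<delta> \<inter> ball p (\<rho> p))" using p(1) x by auto
    qed
    have fm: "layer \<delta> \<inter> ball p (\<rho> p) \<in> fmeasurable lborel" for p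
    proof (rule fmeasurableI)
      show "layer \<delta> \<inter> ball p (\<rho> p) \<in> sets lborel" using layer_m by simp
      have "emeasure lborel (layer \<delta> \<inter> ball p (\<rho> p)) < \<infinity>"
        by (rule emeasure_bounded_finite) (simp add: bounded_Int)
      then show "emeasure lborel (layer \<delta> \<inter> ball p (\<rho> p)) < \<infinity>" .
    qed
    have "measure lborel (layer \<delta>) \<le> measure lborel (\<Union>p\<in>F. layer \<delta> \<inter> ball p (\<rho> p))"
      using F(2) fm layer_m by (intro measure_mono_fmeasurable sub fmeasurable.finite_UN) auto
    also have "\<dots> \<le> (\<Sum>p\<in>F. measure lborel (layer \<delta> \<inter> ball p (\<rho> p)))"
      using F(2) fm by (intro measure_UNION_le) (auto simp: layer_m)
    also have "\<dots> \<le> (\<Sum>p\<in>F. C p * \<delta>)"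
    proof (intro sum_mono)
      fix p assume p: "p \<in> F"
      then have "p \<in> frontier \<Omega>" "\<delta> < \<rho> p" using F(1) d0p[OF p] \<delta> by auto
      then show "measure lborel (layer \<delta> \<inter> ball p (\<rho> p)) \<le> C p * \<delta>" using \<rho>(3) \<delta> by blast
    qed
    finally show ?thesis by (simp add: sum_distrib_right)
  qed
  moreover have "0 \<le> (\<Sum>p\<in>F. C p)" using F(1) \<rho>(2) by (intro sum_nonneg) auto
  ultimately show thesis using d0 unfolding layer_def by (intro that) auto
qed

section \<open>Uniform tangent balls\<close>
lemma tangent_mono:
  fixes c c' :: real and Z e :: "'a::real_inner"
  assumes "c \<le> c'" "c' * norm Z < 1" "c' * (norm Z)\<^sup>2 < Z \<bullet> e"
  shows "c * norm Z < 1" "c * (norm Z)\<^sup>2 < Z \<bullet> e"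
proof -
  have "c * norm Z \<le> c' * norm Z" "c * (norm Z)\<^sup>2 \<le> c' * (norm Z)\<^sup>2"
    using assms(1) by (intro mult_right_mono; simp)+
  then show "c * norm Z < 1" "c * (norm Z)\<^sup>2 < Z \<bullet> e" using assms by linarith+
qed

text \<open>
  In a chart, \<open>X + Z\<close> lies in \<open>U\<close> as soon as the increment of \<open>x \<bullet> e - \<gamma>\<close> from \<open>X\<close> is positive. Up to
  an error \<open>M \<bar>Z\<bar>\<^sup>2\<close> this increment is \<open>Z \<bullet> N\<close>, where \<open>N = e - proj_perp e (\<nabla>\<gamma>)\<close> is normal to the boundary
  and has length at least 1.
\<close>
lemma uniform_interior_ball:
  fixes U :: "'b::euclidean_space set"
  assumes U: "open U" "C2_boundary U" and S: "compact S" "S \<subseteq> frontier U"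
  shows "\<exists>c>0. \<forall>X\<in>S. \<exists>e. norm e = 1 \<and>
     (\<forall>Z. c * norm Z < 1 \<longrightarrow> c * (norm Z)\<^sup>2 < Z \<bullet> e \<longrightarrow> X + Z \<in> U)"
proof -
  let ?P = "\<lambda>c X. \<exists>e. norm e = 1 \<and> (\<forall>Z. c * norm Z < 1 \<longrightarrow> c * (norm Z)\<^sup>2 < Z \<bullet> e \<longrightarrow> X + Z \<in> U)"
  have mono: "?P c' X" if P: "?P c X" and cc: "c \<le> c'" for c c' X
  proof -
    obtain e where e: "norm e = 1" "\<And>Z. c * norm Z < 1 \<Longrightarrow> c * (norm Z)\<^sup>2 < Z \<bullet> e \<Longrightarrow> X + Z \<in> U"
      using P by blast
    have "X + Z \<in> U" if "c' * norm Z < 1" "c' * (norm Z)\<^sup>2 < Z \<bullet> e" for Z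
      using tangent_mono[OF cc that] by (rule e(2))
    then show ?thesis using e(1) by blast
  qed
  have loc: "\<exists>\<rho>>0. \<exists>c. \<forall>X\<in>ball p \<rho> \<inter> S. ?P c X" if p: "p \<in> S" for p
  proof -
    have "p \<in> frontier U" using p S(2) by blast
    then obtain r e \<gamma> g L M where ch: "0 < r" "norm e = 1" "0 \<le> M" "continuous_on UNIV \<gamma>"
      "\<And>x. x \<in> ball p r \<Longrightarrow> x \<in> U \<longleftrightarrow> \<gamma> (proj_perp e x) < x \<bullet> e"
      "\<And>x y. x \<in> cball p r \<Longrightarrow> y \<in> cball p r \<Longrightarrow>
       \<bar>\<gamma> (proj_perp e y) - \<gamma> (proj_perp e x) - g x \<bullet> proj_perp e (y - x)\<bar> \<le> M * (norm (y - x))\<^sup>2"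
      using C2_boundary_chart[OF U(2)] by metis
    \<comment> \<open>the second entry keeps \<open>X + Z\<close> inside the chart\<close>
    define c where "c = max (M + 1) (2 / r)"
    have c: "M + 1 \<le> c" "2 / r \<le> c" by (auto simp: c_def)
    define F where "F x = x \<bullet> e - \<gamma> (proj_perp e x)" for x
    have Fc: "continuous_on UNIV F"
      unfolding F_def proj_perp_def
      by (intro continuous_intros continuous_on_compose2[OF ch(4)]) auto
    have "?P c X" if X: "X \<in> ball p (r / 2) \<inter> S" for X
    proof -
      have Xb: "X \<in> ball p r" using X ch(1) by auto
      have Xf: "X \<in> frontier U" using X S(2) by blast
      have "X \<notin> U" using Xf U(1) by (simp add: frontier_def interior_open)
      then have "F X \<le> 0" using ch(5)[OF Xb] by (simp add: F_def)
      moreover have "0 \<le> F X"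
      proof (rule ccontr)
        assume "\<not> 0 \<le> F X"
        then have "X \<in> (ball p r \<inter> {x. F x < 0}) \<inter> closure U"
          using Xf Xb by (simp add: frontier_def)
        moreover have "open (ball p r \<inter> {x. F x < 0})"
          by (intro open_Int open_Collect_less Fc continuous_intros) simp
        ultimately have "(ball p r \<inter> {x. F x < 0}) \<inter> U \<noteq> {}"
          using open_Int_closure_eq_empty by blast
        then obtain y where "y \<in> U" "y \<in> ball p r" "F y < 0" by blast
        then show False using ch(5)[of y] by (simp add: F_def)
      qed
      ultimately have FX: "X \<bullet> e = \<gamma> (proj_perp e X)" by (simp add: F_def)
      define G where "G = g X"
      define N where "N = e - proj_perp e G"
      have ee: "e \<bullet> e = 1" using ch(2) by (simp add: dot_square_norm)
      have "N \<bullet> e = 1" by (simp add: N_def proj_perp_def inner_diff_left ee)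
      then have N1: "1 \<le> norm N" using abs_inner_unit_le[OF ch(2), of N] by simp
      have "X + Z \<in> U" if Z: "c * norm Z < 1" "c * (norm Z)\<^sup>2 < Z \<bullet> (N /\<^sub>R norm N)" for Z
      proof -
        have "2 / r * norm Z \<le> c * norm Z" using c by (intro mult_right_mono) auto
        then have "2 / r * norm Z < 1" using Z(1) by linarith
        then have "norm Z < r / 2" using ch(1) by (simp add: field_simps)
        then have Zb: "X + Z \<in> ball p r"
          using X norm_triangle_ineq[of "X - p" Z]
          by (simp add: dist_norm norm_minus_commute algebra_simps)
        have "0 \<le> c * (norm Z)\<^sup>2" using c ch(3) by simp
        then have pos: "0 < (Z \<bullet> N) / norm N" using Z(2) by (simp add: divide_inverse mult.commute)
        then have "0 < Z \<bullet> N" using N1 by (simp add: zero_less_divide_iff)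
        then have "(Z \<bullet> N) / norm N \<le> Z \<bullet> N" using N1 by (simp add: divide_le_eq)
        moreover have "M * (norm Z)\<^sup>2 \<le> c * (norm Z)\<^sup>2" using c by (intro mult_right_mono) auto
        ultimately have ZN: "M * (norm Z)\<^sup>2 < Z \<bullet> N" using Z(2) by (simp add: divide_inverse mult.commute)
        have "Z \<bullet> N = Z \<bullet> e - G \<bullet> proj_perp e Z"
          by (simp add: N_def proj_perp_def inner_diff_right inner_commute)
        moreover have "\<bar>\<gamma> (proj_perp e (X + Z)) - \<gamma> (proj_perp e X) - G \<bullet> proj_perp e Z\<bar> \<le> M * (norm Z)\<^sup>2"
          using ch(6)[of X "X + Z"] Xb Zb by (simp add: G_def)
        ultimately have "\<gamma> (proj_perp e (X + Z)) < (X + Z) \<bullet> e"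
          using ZN FX unfolding abs_le_iff inner_add_left by linarith
        then show ?thesis using ch(5)[OF Zb] by simp
      qed
      moreover have "norm (N /\<^sub>R norm N) = 1"
      proof -
        have "norm N \<noteq> 0" using N1 by linarith
        then show ?thesis by simp
      qed
      ultimately show ?thesis by blast
    qed
    then have P: "\<forall>X\<in>ball p (r / 2) \<inter> S. ?P c X" by (intro ballI)
    have r2: "0 < r / 2" using ch(1) by simp
    show ?thesis by (rule exI[of _ "r / 2"], rule conjI, rule r2, rule exI[of _ c], rule P)
  qed
  have "\<exists>c>0. \<forall>X\<in>S \<inter> S. ?P c X"
    using mono loc by (rule compact_uniform_constant[OF S(1)])
  then show ?thesis by (simp only: Int_absorb)
qed

text \<open>
  The graph of \<open>\<psi>\<close> over the closure of \<open>\<Omega>\<close> is a compact part of the boundary of the epigraph. The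
  balls lie in the epigraph, hence over \<open>\<Omega>\<close>, where \<open>w\<close> is \<open>\<psi>\<close>.
\<close>
lemma uniformly_tangent_C2_epigraph:
  fixes \<Omega> :: "'a::euclidean_space set"
  assumes \<Omega>: "bounded \<Omega>" and \<psi>: "continuous_on (closure \<Omega>) \<psi>"
    and O: "open {(x, t). x \<in> \<Omega> \<and> t > \<psi> x}" "C2_boundary {(x, t). x \<in> \<Omega> \<and> t > \<psi> x}"
    and w: "\<And>x. x \<in> \<Omega> \<Longrightarrow> w x = \<psi> x"
  shows "uniformly_tangent \<Omega> w"
proof -
  let ?O = "{(x, t). x \<in> \<Omega> \<and> t > \<psi> x}"
  define \<Gamma> where "\<Gamma> x = (x, \<psi> x)" for x
  have \<Gamma>c: "continuous_on (closure \<Omega>) \<Gamma>" unfolding \<Gamma>_def using \<psi> by (intro continuous_intros)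
  have "\<Gamma> x \<in> frontier ?O" if x: "x \<in> \<Omega>" for x
  proof -
    have "(\<lambda>k. (x, \<psi> x + 1 / real (Suc k))) \<longlonglongrightarrow> (x, \<psi> x + 0)"
      by (intro tendsto_intros) real_asymp
    then have "\<Gamma> x \<in> closure ?O"
      unfolding closure_sequential using x by (intro exI[of _ "\<lambda>k. (x, \<psi> x + 1 / real (Suc k))"]) (auto simp: \<Gamma>_def)
    moreover have "\<Gamma> x \<notin> ?O" by (simp add: \<Gamma>_def)
    ultimately show ?thesis using O(1) by (simp add: frontier_def interior_open)
  qed
  then have "\<Gamma> ` closure \<Omega> \<subseteq> frontier ?O"
    by (intro image_closure_subset[OF \<Gamma>c]) auto
  moreover have "compact (\<Gamma> ` closure \<Omega>)"
    using \<Gamma>c \<Omega> by (intro compact_continuous_image) (simp_all add: compact_closure)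
  ultimately have "\<exists>c>0. \<forall>X\<in>\<Gamma> ` closure \<Omega>. \<exists>e. norm e = 1 \<and>
     (\<forall>Z. c * norm Z < 1 \<longrightarrow> c * (norm Z)\<^sup>2 < Z \<bullet> e \<longrightarrow> X + Z \<in> ?O)"
    by (intro uniform_interior_ball[OF O])
  then obtain c where c: "0 < c" "\<forall>X\<in>\<Gamma> ` closure \<Omega>. \<exists>e. norm e = 1 \<and>
     (\<forall>Z. c * norm Z < 1 \<longrightarrow> c * (norm Z)\<^sup>2 < Z \<bullet> e \<longrightarrow> X + Z \<in> ?O)" by blast
  have "\<exists>e. norm e = 1 \<and> (\<forall>Z. norm Z < 1 / c \<longrightarrow> c * (norm Z)\<^sup>2 < Z \<bullet> e \<longrightarrow> w (x + fst Z) \<le> w x + snd Z)"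
    if x: "x \<in> \<Omega>" for x
  proof -
    have "x \<in> closure \<Omega>" using x closure_subset by blast
    then have "\<Gamma> x \<in> \<Gamma> ` closure \<Omega>" by (rule imageI)
    from bspec[OF c(2) this]
    obtain e where e: "norm e = 1" "\<And>Z. c * norm Z < 1 \<Longrightarrow> c * (norm Z)\<^sup>2 < Z \<bullet> e \<Longrightarrow> \<Gamma> x + Z \<in> ?O"
      by blast
    have "w (x + fst Z) \<le> w x + snd Z" if "norm Z < 1 / c" "c * (norm Z)\<^sup>2 < Z \<bullet> e" for Z
    proof -
      have "c * norm Z < 1" using that(1) c(1) by (simp add: field_simps)
      then have "\<Gamma> x + Z \<in> ?O" using that(2) by (rule e(2))
      then have "x + fst Z \<in> \<Omega>" "\<psi> (x + fst Z) < \<psi> x + snd Z"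
        unfolding \<Gamma>_def by (cases Z, simp)+
      then show ?thesis using w x by simp
    qed
    then show ?thesis
      using e(1) by blast
  qed
  moreover have "0 < 1 / c" using c(1) by simp
  ultimately show ?thesis using c(1) unfolding uniformly_tangent_def by blast
qed

text \<open>Taylor estimates along a polygonal path combine to one between its end points.\<close>
lemma taylor_three_segments:
  fixes f :: "'a::euclidean_space \<Rightarrow> real" and g :: "'a \<Rightarrow> 'a"
  assumes D: "norm (b - a) \<le> D" "norm (c - b) \<le> D" "norm (d - c) \<le> D" and M: "0 \<le> M"
    and ab: "norm (g b - g a) \<le> M * norm (b - a)" "\<bar>f b - f a - g a \<bullet> (b - a)\<bar> \<le> M * (norm (b - a))\<^sup>2"
    and bc: "norm (g c - g b) \<le> M * norm (c - b)" "\<bar>f c - f b - g b \<bullet> (c - b)\<bar> \<le> M * (norm (c - b))\<^sup>2"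
    and cd: "norm (g d - g c) \<le> M * norm (d - c)" "\<bar>f d - f c - g c \<bullet> (d - c)\<bar> \<le> M * (norm (d - c))\<^sup>2"
  shows "norm (g d - g a) \<le> 3 * M * D" and "\<bar>f d - f a - g a \<bullet> (d - a)\<bar> \<le> 6 * M * D\<^sup>2"
proof -
  have D0: "0 \<le> D" using D(1) norm_ge_zero[of "b - a"] by linarith
  have lin: "M * norm x \<le> M * D" if "norm x \<le> D" for x :: 'a using that M by (rule mult_left_mono)
  have quad: "M * (norm x)\<^sup>2 \<le> M * D\<^sup>2" if "norm x \<le> D" for x :: 'a
    using that M by (intro mult_left_mono power_mono) auto
  have gab: "norm (g b - g a) \<le> M * D" using ab(1) lin[OF D(1)] by linarith
  have gbc: "norm (g c - g b) \<le> M * D" using bc(1) lin[OF D(2)] by linarith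
  have gcd: "norm (g d - g c) \<le> M * D" using cd(1) lin[OF D(3)] by linarith
  have gac: "norm (g c - g a) \<le> 2 * (M * D)"
    using norm_triangle_ineq[of "g c - g b" "g b - g a"] gab gbc by simp
  show "norm (g d - g a) \<le> 3 * M * D"
    using norm_triangle_ineq[of "g d - g c" "g c - g a"] gac gcd by simp
  have "\<bar>(g b - g a) \<bullet> (c - b)\<bar> \<le> (M * D) * D"
    using gab D(2) D0 M by (intro order_trans[OF Cauchy_Schwarz_ineq2] mult_mono) auto
  moreover have "\<bar>(g c - g a) \<bullet> (d - c)\<bar> \<le> (2 * (M * D)) * D"
    using gac D(3) D0 M by (intro order_trans[OF Cauchy_Schwarz_ineq2] mult_mono) auto
  moreover have "f d - f a - g a \<bullet> (d - a) = (f b - f a - g a \<bullet> (b - a)) + (f c - f b - g b \<bullet> (c - b))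
     + (f d - f c - g c \<bullet> (d - c)) + (g b - g a) \<bullet> (c - b) + (g c - g a) \<bullet> (d - c)"
    by (simp add: inner_diff_left inner_diff_right)
  moreover have "(M * D) * D = M * D\<^sup>2" "(2 * (M * D)) * D = 2 * (M * D\<^sup>2)"
    by (simp_all add: power2_eq_square)
  ultimately show "\<bar>f d - f a - g a \<bullet> (d - a)\<bar> \<le> 6 * M * D\<^sup>2"
    using ab(2) bc(2) cd(2) quad[OF D(1)] quad[OF D(2)] quad[OF D(3)]
    unfolding abs_le_iff by linarith
qed

text \<open>
  Near the boundary the segment between two points of \<open>\<Omega>\<close> may leave \<open>\<Omega>\<close>. The way out is to go up
  from \<open>x\<close> in the direction \<open>e\<close> of the chart, across, and down to \<open>y\<close>. If \<open>L\<close> is the Lipschitz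
  constant of the boundary, climbing by \<open>(L + 1) \<bar>y - x\<bar>\<close> is enough to cross safely.
\<close>
lemma boundary_path:
  fixes \<Omega> :: "'a::euclidean_space set"
  assumes C2: "C2_boundary \<Omega>" and p: "p \<in> frontier \<Omega>"
  shows "\<exists>\<rho>>0. \<exists>K\<ge>1. \<forall>x\<in>ball p \<rho> \<inter> \<Omega>. \<forall>y\<in>\<Omega>. norm (y - x) < \<rho> \<longrightarrow>
    (\<exists>a b. norm (a - x) \<le> K * norm (y - x) \<and> norm (b - a) \<le> K * norm (y - x) \<and> norm (y - b) \<le> K * norm (y - x) \<and>
       closed_segment x a \<subseteq> \<Omega> \<and> closed_segment a b \<subseteq> \<Omega> \<and> closed_segment b y \<subseteq> \<Omega>)"
proof -
  obtain r e \<gamma> g L M where ch: "0 < r" "norm e = 1" "0 \<le> L"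
      "\<And>x. x \<in> ball p r \<Longrightarrow> x \<in> \<Omega> \<longleftrightarrow> \<gamma> (proj_perp e x) < x \<bullet> e"
      "\<And>x y. x \<in> cball p r \<Longrightarrow> y \<in> cball p r \<Longrightarrow> \<bar>\<gamma> (proj_perp e y) - \<gamma> (proj_perp e x)\<bar> \<le> L * norm (y - x)"
    using C2_boundary_chart[OF C2 p] by metis
  define \<rho> where "\<rho> = r / (L + 3)"
  have \<rho>: "0 < \<rho>" "(L + 3) * \<rho> = r" using ch(1,3) by (auto simp: \<rho>_def)
  have "\<exists>a b. norm (a - x) \<le> (L + 1) * norm (y - x) \<and> norm (b - a) \<le> (L + 1) * norm (y - x)
       \<and> norm (y - b) \<le> (L + 1) * norm (y - x) \<and>
       closed_segment x a \<subseteq> \<Omega> \<and> closed_segment a b \<subseteq> \<Omega> \<and> closed_segment b y \<subseteq> \<Omega>"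
    if x: "x \<in> ball p \<rho> \<inter> \<Omega>" and y: "y \<in> \<Omega>" and xy: "norm (y - x) < \<rho>" for x y
  proof -
    define D where "D = (L + 1) * norm (y - x)"
    define a where "a = x + D *\<^sub>R e"
    define b where "b = y + D *\<^sub>R e"
    have D0: "0 \<le> D" using ch(3) by (simp add: D_def)
    have "D \<le> (L + 1) * \<rho>" using xy ch(3) unfolding D_def by (intro mult_left_mono) auto
    then have D: "D + 2 * \<rho> \<le> r" using \<rho>(2) by (simp add: algebra_simps)
    have ab: "norm (a - x) = D" "norm (b - y) = D" "norm (b - a) = norm (y - x)"
      using ch(2) D0 by (auto simp: a_def b_def)
    have xp: "dist p x < \<rho>" using x by simp
    have yp: "dist p y < 2 * \<rho>"
      using xp xy dist_triangle[of p y x] by (simp add: dist_norm norm_minus_commute)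
    have inb: "x \<in> ball p r" "y \<in> ball p r" "a \<in> ball p r" "b \<in> ball p r"
      using xp yp D D0 \<rho>(1) dist_triangle[of p a x] dist_triangle[of p b y] ab
      by (auto simp: dist_norm norm_minus_commute)
    have seg: "closed_segment u v \<subseteq> ball p r" if "u \<in> ball p r" "v \<in> ball p r" for u v
      using that by (intro closed_segment_subset) auto
    have ee: "e \<bullet> e = 1" using ch(2) by (simp add: dot_square_norm)
    have pe: "proj_perp e (z + t *\<^sub>R e) = proj_perp e z" for z t
      by (simp add: proj_perp_add proj_perp_scaleR proj_perp_self[OF ch(2)])
    have lift: "closed_segment z (z + D *\<^sub>R e) \<subseteq> \<Omega>" if z: "z \<in> \<Omega>" "z \<in> ball p r" "z + D *\<^sub>R e \<in> ball p r" for z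
    proof
      fix u assume u: "u \<in> closed_segment z (z + D *\<^sub>R e)"
      then obtain t where t: "0 \<le> t" "t \<le> 1" "u = z + (t * D) *\<^sub>R e"
        by (auto simp: in_segment algebra_simps)
      have ub: "u \<in> ball p r" using seg[OF z(2,3)] u by blast
      have "0 \<le> t * D" using t(1) D0 by simp
      then have "\<gamma> (proj_perp e u) < u \<bullet> e"
        using ch(4)[OF z(2)] z(1) unfolding t(3) pe by (simp add: inner_add_left ee)
      then show "u \<in> \<Omega>" using ch(4)[OF ub] by simp
    qed
    have "closed_segment a b \<subseteq> \<Omega>"
    proof
      fix u assume u: "u \<in> closed_segment a b"
      then obtain t where t: "0 \<le> t" "t \<le> 1" "u = (1 - t) *\<^sub>R a + t *\<^sub>R b" by (auto simp: in_segment)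
      define v where "v = (1 - t) *\<^sub>R x + t *\<^sub>R y"
      have uv: "u = v + D *\<^sub>R e" by (simp add: t(3) v_def a_def b_def algebra_simps)
      have "v \<in> closed_segment x y" using t by (auto simp: in_segment v_def)
      then have vb: "v \<in> ball p r" using seg[OF inb(1,2)] by blast
      have ub: "u \<in> ball p r" using seg[OF inb(3,4)] u by blast
      have vx: "v - x = t *\<^sub>R (y - x)" by (simp add: v_def algebra_simps)
      then have nv: "norm (v - x) \<le> norm (y - x)" using t by (simp add: mult_left_le_one_le)
      have "\<bar>\<gamma> (proj_perp e v) - \<gamma> (proj_perp e x)\<bar> \<le> L * norm (v - x)"
        using inb(1) vb by (intro ch(5)) auto
      also have "\<dots> \<le> L * norm (y - x)" using nv ch(3) by (rule mult_left_mono)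
      finally have 1: "\<gamma> (proj_perp e v) \<le> \<gamma> (proj_perp e x) + L * norm (y - x)" by (simp add: abs_le_iff)
      have 2: "\<gamma> (proj_perp e x) < x \<bullet> e" using ch(4)[OF inb(1)] x by simp
      have "\<bar>(v - x) \<bullet> e\<bar> \<le> norm (y - x)" using abs_inner_unit_le[OF ch(2), of "v - x"] nv by linarith
      then have 3: "x \<bullet> e - norm (y - x) \<le> v \<bullet> e" by (simp add: inner_diff_left abs_le_iff)
      have "u \<bullet> e = v \<bullet> e + D" by (simp add: uv inner_add_left ee)
      moreover have "D = L * norm (y - x) + norm (y - x)" by (simp add: D_def algebra_simps)
      ultimately have "\<gamma> (proj_perp e v) < u \<bullet> e" using 1 2 3 by linarith
      then have "\<gamma> (proj_perp e u) < u \<bullet> e" unfolding uv pe .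
      then show "u \<in> \<Omega>" using ch(4)[OF ub] by simp
    qed
    moreover have "closed_segment x a \<subseteq> \<Omega>"
      unfolding a_def by (rule lift) (use x inb in \<open>auto simp: a_def\<close>)
    moreover have "closed_segment y b \<subseteq> \<Omega>"
      unfolding b_def by (rule lift) (use y inb in \<open>auto simp: b_def\<close>)
    moreover have "norm (y - x) \<le> D" using ch(3) by (simp add: D_def algebra_simps)
    ultimately show ?thesis
      using ab unfolding D_def[symmetric]
      by (intro exI[of _ a] exI[of _ b]) (auto simp: norm_minus_commute closed_segment_commute)
  qed
  then show ?thesis
    using \<rho>(1) ch(3) by (intro exI[of _ \<rho>] conjI exI[of _ "L + 1"]) auto
qed

text \<open>
  Locally two points of \<open>\<Omega>\<close> are joined by one segment (inside) or by three (near the boundary), on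
  which the second derivatives are bounded because they extend continuously to the compact closure.
  A limit then moves \<open>y\<close> to the boundary.
\<close>
lemma C2_closure_taylor:
  fixes \<Omega> :: "'a::euclidean_space set" and \<psi> :: "'a \<Rightarrow> real"
  assumes \<Omega>: "open \<Omega>" "bounded \<Omega>" "C2_boundary \<Omega>" and \<psi>: "C2_closure_with_grad \<Omega> \<psi> g"
  obtains c where "0 < c"
    "\<And>x y. x \<in> \<Omega> \<Longrightarrow> y \<in> closure \<Omega> \<Longrightarrow> c * norm (y - x) < 1 \<Longrightarrow>
       norm (g y - g x) \<le> c * norm (y - x) \<and> \<bar>\<psi> y - \<psi> x - g x \<bullet> (y - x)\<bar> \<le> c * (norm (y - x))\<^sup>2"
proof -
  obtain H where cont: "continuous_on (closure \<Omega>) \<psi>" "continuous_on (closure \<Omega>) g"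
    and H: "C2_with_derivs \<Omega> \<psi> g H" "continuous_on (closure \<Omega>) H"
    using \<psi> by (auto simp: C2_closure_with_grad_def)
  have cl: "compact (closure \<Omega>)" using \<Omega>(2) by (simp add: compact_closure)
  have "bounded (H ` closure \<Omega>)" by (intro compact_imp_bounded compact_continuous_image H(2) cl)
  then obtain M where M: "0 < M" "\<And>x. x \<in> closure \<Omega> \<Longrightarrow> norm (H x) \<le> M"
    unfolding bounded_pos by blast
  have seg: "norm (g b - g a) \<le> M * norm (b - a)" "\<bar>\<psi> b - \<psi> a - g a \<bullet> (b - a)\<bar> \<le> M * (norm (b - a))\<^sup>2"
    if ab: "closed_segment a b \<subseteq> \<Omega>" for a b
  proof -
    have s: "GDERIV \<psi> z :> g z" "(g has_derivative blinfun_apply (H z)) (at z)" "norm (H z) \<le> M"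
      if "z \<in> closed_segment a b" for z
    proof -
      have z: "z \<in> \<Omega>" using ab that by blast
      then show "GDERIV \<psi> z :> g z" "(g has_derivative blinfun_apply (H z)) (at z)"
        using H(1) by (auto simp: C2_with_derivs_def)
      show "norm (H z) \<le> M" using M(2) z closure_subset by blast
    qed
    note T = taylor_segment[of a b \<psi> g H M, OF s(1) s(2) s(3)]
    show "norm (g b - g a) \<le> M * norm (b - a)" by (rule T(1))
    show "\<bar>\<psi> b - \<psi> a - g a \<bullet> (b - a)\<bar> \<le> M * (norm (b - a))\<^sup>2" by (rule T(2))
  qed
  let ?T = "\<lambda>c x y. norm (g y - g x) \<le> c * norm (y - x) \<and> \<bar>\<psi> y - \<psi> x - g x \<bullet> (y - x)\<bar> \<le> c * (norm (y - x))\<^sup>2"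
  have T_mono: "?T c' x y" if "?T c x y" "c \<le> c'" for c c' x y
  proof -
    have "c * norm (y - x) \<le> c' * norm (y - x)" "c * (norm (y - x))\<^sup>2 \<le> c' * (norm (y - x))\<^sup>2"
      using that(2) by (intro mult_right_mono; simp)+
    with that(1) show ?thesis by linarith
  qed
  let ?P = "\<lambda>c x. \<forall>y\<in>\<Omega>. c * norm (y - x) < 1 \<longrightarrow> ?T c x y"
  have mono: "?P c' x" if P: "?P c x" and cc: "c \<le> c'" for c c' x
  proof (intro ballI impI)
    fix y assume y: "y \<in> \<Omega>" "c' * norm (y - x) < 1"
    have "c * norm (y - x) \<le> c' * norm (y - x)" using cc by (intro mult_right_mono) auto
    then have "?T c x y" using P y by simp
    then show "?T c' x y" using cc by (rule T_mono)
  qed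
  have small: "norm z < \<rho>" if "0 < \<rho>" "1 / \<rho> \<le> c" "c * norm z < 1" for \<rho> c :: real and z :: 'a
  proof -
    have "1 / \<rho> * norm z \<le> c * norm z" using that(2) by (intro mult_right_mono) auto
    then have "1 / \<rho> * norm z < 1" using that(3) by linarith
    then show ?thesis using that(1) by (simp add: field_simps)
  qed
  have loc: "\<exists>\<rho>>0. \<exists>c. \<forall>x\<in>ball p \<rho> \<inter> \<Omega>. ?P c x" if p: "p \<in> closure \<Omega>" for p
  proof (cases "p \<in> \<Omega>")
    case True
    then obtain r where r: "0 < r" "ball p r \<subseteq> \<Omega>" using \<Omega>(1) by (meson openE)
    have "?P (max M (1 / (r / 2))) x" if x: "x \<in> ball p (r / 2) \<inter> \<Omega>" for x
    proof (intro ballI impI)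
      fix y assume y: "y \<in> \<Omega>" "max M (1 / (r / 2)) * norm (y - x) < 1"
      have "norm (y - x) < r / 2" by (rule small[OF _ _ y(2)]) (use r in simp_all)
      then have "y \<in> ball p r"
        using x dist_triangle[of p y x] by (simp add: dist_norm norm_minus_commute)
      moreover have "x \<in> ball p r" using x r by auto
      ultimately have "closed_segment x y \<subseteq> ball p r" by (intro closed_segment_subset) auto
      then have "closed_segment x y \<subseteq> \<Omega>" using r(2) by blast
      then have "?T M x y" using seg by blast
      then show "?T (max M (1 / (r / 2))) x y" by (rule T_mono) simp
    qed
    then show ?thesis using r(1) by (intro exI[of _ "r / 2"] conjI exI[of _ "max M (1 / (r / 2))"] ballI) auto
  next
    case False
    then have "p \<in> frontier \<Omega>" using p \<Omega>(1) by (simp add: frontier_def interior_open)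
    from boundary_path[OF \<Omega>(3) this] obtain \<rho> K where \<rho>: "0 < \<rho>" and K: "1 \<le> K"
      and path: "\<forall>x\<in>ball p \<rho> \<inter> \<Omega>. \<forall>y\<in>\<Omega>. norm (y - x) < \<rho> \<longrightarrow>
    (\<exists>a b. norm (a - x) \<le> K * norm (y - x) \<and> norm (b - a) \<le> K * norm (y - x) \<and> norm (y - b) \<le> K * norm (y - x) \<and>
       closed_segment x a \<subseteq> \<Omega> \<and> closed_segment a b \<subseteq> \<Omega> \<and> closed_segment b y \<subseteq> \<Omega>)"
      by blast
    define c where "c = max (6 * M * K\<^sup>2) (1 / \<rho>)"
    have "?P c x" if x: "x \<in> ball p \<rho> \<inter> \<Omega>" for x
    proof (intro ballI impI)
      fix y assume y: "y \<in> \<Omega>" "c * norm (y - x) < 1"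
      have "norm (y - x) < \<rho>" by (rule small[OF \<rho> _ y(2)]) (simp add: c_def)
      from mp[OF bspec[OF bspec[OF path x] y(1)] this] obtain a b
        where D: "norm (a - x) \<le> K * norm (y - x)" "norm (b - a) \<le> K * norm (y - x)" "norm (y - b) \<le> K * norm (y - x)"
         and s: "closed_segment x a \<subseteq> \<Omega>" "closed_segment a b \<subseteq> \<Omega>" "closed_segment b y \<subseteq> \<Omega>"
        by blast
      note three = taylor_three_segments[OF D less_imp_le[OF M(1)] seg[OF s(1)] seg[OF s(2)] seg[OF s(3)]]
      have c: "6 * M * K\<^sup>2 \<le> c" by (simp add: c_def)
      have "K \<le> K\<^sup>2" using K by (simp add: self_le_power)
      then have "M * K \<le> M * K\<^sup>2" "0 \<le> M * K" using M(1) K by (simp_all add: mult_left_mono)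
      then have c': "3 * M * K \<le> c" using c by linarith
      have "norm (g y - g x) \<le> (3 * M * K) * norm (y - x)" using three(1) by (simp add: mult.assoc)
      also have "\<dots> \<le> c * norm (y - x)" using c' by (intro mult_right_mono) auto
      finally have 1: "norm (g y - g x) \<le> c * norm (y - x)" .
      have "\<bar>\<psi> y - \<psi> x - g x \<bullet> (y - x)\<bar> \<le> (6 * M * K\<^sup>2) * (norm (y - x))\<^sup>2"
        using three(2) by (simp add: power_mult_distrib mult.assoc)
      also have "\<dots> \<le> c * (norm (y - x))\<^sup>2" using c by (intro mult_right_mono) auto
      finally show "?T c x y" using 1 by blast
    qed
    then show ?thesis using \<rho> by (intro exI[of _ \<rho>] conjI exI[of _ c] ballI) auto
  qed
  have "\<exists>c>0. \<forall>x\<in>closure \<Omega> \<inter> \<Omega>. ?P c x"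
    using mono loc by (rule compact_uniform_constant[OF cl])
  then obtain c where c: "0 < c" "\<forall>x\<in>closure \<Omega> \<inter> \<Omega>. ?P c x" by (elim exE conjE)
  show thesis
  proof (rule that[OF c(1)])
    fix x y assume x: "x \<in> \<Omega>" and y: "y \<in> closure \<Omega>" "c * norm (y - x) < 1"
    have "x \<in> closure \<Omega> \<inter> \<Omega>" using x closure_subset by blast
    then have Px: "?P c x" by (rule bspec[OF c(2)])
    obtain Y where Y: "\<And>k::nat. Y k \<in> \<Omega>" "Y \<longlonglongrightarrow> y" using y(1) by (auto simp: closure_sequential)
    have Yc: "Y k \<in> closure \<Omega>" for k using Y(1) closure_subset by blast
    have l\<psi>: "(\<lambda>k. \<psi> (Y k)) \<longlonglongrightarrow> \<psi> y"
      by (rule continuous_on_tendsto_compose[OF cont(1) Y(2) y(1)]) (simp add: Yc)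
    have lg: "(\<lambda>k. g (Y k)) \<longlonglongrightarrow> g y"
      by (rule continuous_on_tendsto_compose[OF cont(2) Y(2) y(1)]) (simp add: Yc)
    have "(\<lambda>k. c * norm (Y k - x)) \<longlonglongrightarrow> c * norm (y - x)" by (intro tendsto_intros Y(2))
    then have "eventually (\<lambda>k. c * norm (Y k - x) < 1) sequentially"
      using y(2) by (intro order_tendstoD)
    then have ev: "eventually (\<lambda>k. ?T c x (Y k)) sequentially"
      by (rule eventually_mono) (use Px Y(1) in blast)
    have "norm (g y - g x) \<le> c * norm (y - x)"
    proof (rule tendsto_le[OF sequentially_bot])
      show "(\<lambda>k. c * norm (Y k - x)) \<longlonglongrightarrow> c * norm (y - x)" by (intro tendsto_intros Y(2))
      show "(\<lambda>k. norm (g (Y k) - g x)) \<longlonglongrightarrow> norm (g y - g x)" by (intro tendsto_intros lg)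
    qed (use ev in eventually_elim, blast)
    moreover have "\<bar>\<psi> y - \<psi> x - g x \<bullet> (y - x)\<bar> \<le> c * (norm (y - x))\<^sup>2"
    proof (rule tendsto_le[OF sequentially_bot])
      show "(\<lambda>k. c * (norm (Y k - x))\<^sup>2) \<longlonglongrightarrow> c * (norm (y - x))\<^sup>2" by (intro tendsto_intros Y(2))
      show "(\<lambda>k. \<bar>\<psi> (Y k) - \<psi> x - g x \<bullet> (Y k - x)\<bar>) \<longlonglongrightarrow> \<bar>\<psi> y - \<psi> x - g x \<bullet> (y - x)\<bar>"
        by (intro tendsto_intros l\<psi> Y(2))
    qed (use ev in eventually_elim, blast)
    ultimately show "?T c x y" by blast
  qed
qed

text \<open>
  It suffices that \<open>w\<close> lies below a paraboloid of fixed opening touching the graph at \<open>x\<close>. Inside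
  \<open>\<Omega>\<close> this is Taylor's formula. For \<open>y\<close> outside, the segment from \<open>x\<close> to \<open>y\<close> meets the boundary at
  some \<open>q\<close>; Taylor's formula between \<open>x\<close> and \<open>q\<close>, for the function and for its gradient, turns the
  quadratic bound at \<open>q\<close> into one at \<open>x\<close>. The exceptional value \<open>m\<close> allows for a Borel representative of
  \<open>\<phi>\<close>: it is so low that it lies below all the tangent planes.
\<close>
lemma uniformly_tangent_C2_closure:
  fixes \<Omega> :: "'a::euclidean_space set" and \<psi> \<phi> w :: "'a \<Rightarrow> real"
  assumes \<Omega>: "open \<Omega>" "bounded \<Omega>" "C2_boundary \<Omega>" and \<psi>: "C2_closure_with_grad \<Omega> \<psi> g"
    and \<rho>: "0 < \<rho>" and a: "0 < a"
    and ext: "\<And>x0 x. x0 \<in> frontier \<Omega> \<Longrightarrow> x \<in> ball x0 \<rho> - \<Omega> \<Longrightarrow>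
                 \<phi> x \<le> \<psi> x0 + g x0 \<bullet> (x - x0) + a / 2 * (norm (x - x0))\<^sup>2"
    and w\<psi>: "\<And>x. x \<in> \<Omega> \<Longrightarrow> w x = \<psi> x"
    and w\<phi>: "\<And>x. x \<notin> \<Omega> \<Longrightarrow> w x = \<phi> x \<or> w x = m"
    and m: "\<And>x. x \<in> \<Omega> \<Longrightarrow> m \<le> \<psi> x - norm (g x)"
  shows "uniformly_tangent \<Omega> w"
proof -
  obtain c where c: "0 < c" and tay: "\<And>x y. x \<in> \<Omega> \<Longrightarrow> y \<in> closure \<Omega> \<Longrightarrow> c * norm (y - x) < 1 \<Longrightarrow>
       norm (g y - g x) \<le> c * norm (y - x) \<and> \<bar>\<psi> y - \<psi> x - g x \<bullet> (y - x)\<bar> \<le> c * (norm (y - x))\<^sup>2"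
    using C2_closure_taylor[OF \<Omega> \<psi>] by metis
  \<comment> \<open>one \<open>c\<close> each from the function and its gradient between \<open>x\<close> and \<open>q\<close>, and \<open>a / 2\<close> from the exterior bound\<close>
  define \<kappa> where "\<kappa> = 2 * c + a / 2"
  define r where "r = min 1 (min \<rho> (1 / c))"
  have r: "0 < r" "r \<le> 1" "r \<le> \<rho>" "r \<le> 1 / c" using \<rho> c by (auto simp: r_def)
  have \<kappa>: "0 < \<kappa>" using c a by (simp add: \<kappa>_def)
  have quad: "w y \<le> \<psi> x + g x \<bullet> (y - x) + \<kappa> * (norm (y - x))\<^sup>2" if x: "x \<in> \<Omega>" and y: "norm (y - x) < r" for x y
  proof -
    define D where "D = norm (y - x)"
    have D: "0 \<le> D" "D < r" using y by (simp_all add: D_def)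
    have cD: "c * t < 1" if "t \<le> D" for t
    proof -
      have "t < 1 / c" using that D r(4) by linarith
      then show ?thesis using c by (simp add: field_simps)
    qed
    have c\<kappa>: "c * D\<^sup>2 \<le> \<kappa> * D\<^sup>2" using c a by (intro mult_right_mono) (auto simp: \<kappa>_def)
    show ?thesis
    proof (cases "y \<in> \<Omega>")
      case True
      then have "y \<in> closure \<Omega>" using closure_subset by blast
      then have "\<bar>\<psi> y - \<psi> x - g x \<bullet> (y - x)\<bar> \<le> c * D\<^sup>2" using tay[OF x] cD[of "norm (y - x)"] by (simp add: D_def)
      then show ?thesis using c\<kappa> w\<psi>[OF True] by (simp add: D_def abs_le_iff)
    next
      case out: False
      from w\<phi>[OF out] show ?thesis
      proof
        assume wm: "w y = m"
        have "\<bar>g x \<bullet> (y - x)\<bar> \<le> norm (g x) * norm (y - x)" by (rule Cauchy_Schwarz_ineq2)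
        also have "\<dots> \<le> norm (g x) * 1" using D r by (intro mult_left_mono) (auto simp: D_def)
        finally have "m \<le> \<psi> x + g x \<bullet> (y - x)" using m[OF x] by (simp add: abs_le_iff)
        moreover have "0 \<le> \<kappa> * (norm (y - x))\<^sup>2" using \<kappa> by simp
        ultimately show ?thesis using wm by linarith
      next
        assume wp: "w y = \<phi> y"
        obtain q where q: "q \<in> frontier \<Omega>" "dist x q \<le> dist x y" "dist y q \<le> dist x y"
          using frontier_between[OF x out] by metis
        have xq: "norm (q - x) \<le> D" and yq: "norm (y - q) \<le> D"
          using q by (simp_all add: D_def dist_norm norm_minus_commute)
        have qc: "q \<in> closure \<Omega>" using q(1) by (simp add: frontier_def)
        note t = tay[OF x qc cD[OF xq]]
        have "dist q y < \<rho>" using yq D r by (simp add: dist_norm norm_minus_commute)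
        then have "\<phi> y \<le> \<psi> q + g q \<bullet> (y - q) + a / 2 * (norm (y - q))\<^sup>2"
          using ext[OF q(1)] out by simp
        moreover have "a / 2 * (norm (y - q))\<^sup>2 \<le> a / 2 * D\<^sup>2"
          using yq a by (intro mult_left_mono power_mono) auto
        moreover have "\<psi> q \<le> \<psi> x + g x \<bullet> (q - x) + c * D\<^sup>2"
        proof -
          have "c * (norm (q - x))\<^sup>2 \<le> c * D\<^sup>2" using xq c by (intro mult_left_mono power_mono) auto
          then show ?thesis using t by (simp add: abs_le_iff)
        qed
        moreover have "g q \<bullet> (y - q) \<le> g x \<bullet> (y - q) + c * D\<^sup>2"
        proof -
          have "\<bar>(g q - g x) \<bullet> (y - q)\<bar> \<le> norm (g q - g x) * norm (y - q)" by (rule Cauchy_Schwarz_ineq2)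
          also have "\<dots> \<le> (c * D) * D"
          proof (rule mult_mono)
            have "c * norm (q - x) \<le> c * D" using xq c by (intro mult_left_mono) auto
            then show "norm (g q - g x) \<le> c * D" using t by linarith
          qed (use yq c D in auto)
          finally show ?thesis by (simp add: inner_diff_left power2_eq_square abs_le_iff mult.assoc)
        qed
        moreover have "g x \<bullet> (q - x) + g x \<bullet> (y - q) = g x \<bullet> (y - x)" by (simp add: inner_diff_right)
        moreover have "\<kappa> * D\<^sup>2 = c * D\<^sup>2 + c * D\<^sup>2 + a / 2 * D\<^sup>2" by (simp add: \<kappa>_def algebra_simps)
        ultimately show ?thesis unfolding D_def[symmetric] wp by linarith
      qed
    qed
  qed
  have "\<exists>e. norm e = 1 \<and> (\<forall>Z. norm Z < r \<longrightarrow> \<kappa> * (norm Z)\<^sup>2 < Z \<bullet> e \<longrightarrow> w (x + fst Z) \<le> w x + snd Z)"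
    if x: "x \<in> \<Omega>" for x
  proof -
    define N where "N = (- g x, 1 :: real)"
    have "1 \<le> norm N" using norm_snd_le[of "1::real" "- g x"] by (simp add: N_def)
    then have Npos: "0 < norm N" "1 \<le> norm N" by linarith+
    have "w (x + fst Z) \<le> w x + snd Z" if Z: "norm Z < r" "\<kappa> * (norm Z)\<^sup>2 < Z \<bullet> (N /\<^sub>R norm N)" for Z
    proof -
      have zZ: "norm (fst Z) \<le> norm Z" by (rule norm_fst_le_norm)
      have ZN: "Z \<bullet> N = snd Z - g x \<bullet> fst Z" by (cases Z) (simp add: N_def inner_commute)
      have "0 \<le> \<kappa> * (norm Z)\<^sup>2" using \<kappa> by simp
      then have "0 < (Z \<bullet> N) / norm N" using Z(2) by (simp add: divide_inverse mult.commute)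
      then have "0 < Z \<bullet> N" using Npos by (simp add: zero_less_divide_iff)
      then have "(Z \<bullet> N) / norm N \<le> Z \<bullet> N" using Npos by (simp add: divide_le_eq)
      then have "\<kappa> * (norm Z)\<^sup>2 < snd Z - g x \<bullet> fst Z"
        using Z(2) unfolding ZN[symmetric] by (simp add: divide_inverse mult.commute)
      moreover have "\<kappa> * (norm (fst Z))\<^sup>2 \<le> \<kappa> * (norm Z)\<^sup>2"
        using zZ \<kappa> by (intro mult_left_mono power_mono) auto
      moreover have "w (x + fst Z) \<le> \<psi> x + g x \<bullet> fst Z + \<kappa> * (norm (fst Z))\<^sup>2"
        using quad[OF x, of "x + fst Z"] zZ Z(1) by simp
      ultimately show ?thesis using w\<psi>[OF x] by linarith
    qed
    moreover have "norm (N /\<^sub>R norm N) = 1" using Npos by simp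
    ultimately show ?thesis by blast
  qed
  then show ?thesis using r(1) \<kappa> unfolding uniformly_tangent_def by blast
qed

section \<open>Coincidence with the obstacle\<close>

text \<open>
  A pointwise bound on \<open>\<phi>\<close> from above passes to the representative, apart from points at which it
  takes the value \<open>m\<close>. That value can be chosen to suit the application.
\<close>
lemma Linf_loc_borel_version:
  fixes \<phi> :: "'a::euclidean_space \<Rightarrow> real"
  assumes \<phi>: "Linf_loc \<phi>" and K: "compact K"
  shows "\<exists>\<phi>\<^sub>0 M. \<phi>\<^sub>0 \<in> borel_measurable borel \<and> (AE x in lebesgue. \<phi> x = \<phi>\<^sub>0 x) \<and>
    (\<forall>x. \<phi>\<^sub>0 x = \<phi> x \<or> \<phi>\<^sub>0 x = m) \<and> 0 \<le> M \<and> (\<forall>x\<in>K. \<bar>\<phi>\<^sub>0 x\<bar> \<le> M)"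
proof -
  obtain \<phi>' where \<phi>'[measurable]: "\<phi>' \<in> borel_measurable lborel" and eq: "AE x in lborel. \<phi> x = \<phi>' x"
    using \<phi> completion_ex_borel_measurable_real[of \<phi> lborel] by (auto simp: Linf_loc_def)
  obtain M where M: "AE x in lborel. x \<in> K \<longrightarrow> \<bar>\<phi> x\<bar> \<le> M"
    using \<phi> K by (auto simp: Linf_loc_def AE_completion_iff)
  from eq M have "AE x in lborel. \<phi> x = \<phi>' x \<and> (x \<in> K \<longrightarrow> \<bar>\<phi> x\<bar> \<le> M)" by eventually_elim simp
  then obtain N where N: "N \<in> null_sets lborel" "\<And>x. x \<notin> N \<Longrightarrow> \<phi> x = \<phi>' x \<and> (x \<in> K \<longrightarrow> \<bar>\<phi> x\<bar> \<le> M)"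
    by (auto simp: eventually_ae_filter)
  have [measurable]: "N \<in> sets borel" using N(1) by auto
  define \<phi>\<^sub>0 where "\<phi>\<^sub>0 x = (if x \<in> N then m else \<phi>' x)" for x
  have "\<phi>\<^sub>0 \<in> borel_measurable borel" unfolding \<phi>\<^sub>0_def using \<phi>' by measurable
  moreover have "AE x in lebesgue. \<phi> x = \<phi>\<^sub>0 x"
  proof -
    have "AE x in lborel. x \<notin> N" using N(1) by (rule AE_not_in)
    then have "AE x in lborel. \<phi> x = \<phi>\<^sub>0 x"
      by (rule eventually_mono) (use N(2) in \<open>simp add: \<phi>\<^sub>0_def\<close>)
    then show ?thesis by (simp add: AE_completion_iff)
  qed
  moreover have "\<phi>\<^sub>0 x = \<phi> x \<or> \<phi>\<^sub>0 x = m" for x using N(2)[of x] by (auto simp: \<phi>\<^sub>0_def)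
  moreover have "\<bar>\<phi>\<^sub>0 x\<bar> \<le> max \<bar>M\<bar> \<bar>m\<bar>" if "x \<in> K" for x
    using N(2)[of x] that by (auto simp: \<phi>\<^sub>0_def)
  ultimately show ?thesis by (intro exI[of _ \<phi>\<^sub>0] exI[of _ "max \<bar>M\<bar> \<bar>m\<bar>"]) simp
qed

lemma compact_inner_parallel_set:
  fixes \<Omega> :: "'a::euclidean_space set"
  assumes "bounded \<Omega>" "0 < \<delta>"
  shows "compact {x. \<delta> \<le> infdist x (- \<Omega>)}" "{x. \<delta> \<le> infdist x (- \<Omega>)} \<subseteq> \<Omega>"
proof -
  show sub: "{x. \<delta> \<le> infdist x (- \<Omega>)} \<subseteq> \<Omega>"
    using assms(2) by (auto intro: ccontr simp: infdist_zero)
  have "closed {x. \<delta> \<le> infdist x (- \<Omega>)}" by (intro closed_Collect_le continuous_intros)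
  then show "compact {x. \<delta> \<le> infdist x (- \<Omega>)}"
    using bounded_subset[OF assms(1) sub] by (simp add: compact_eq_bounded_closed)
qed

text \<open>
  Nearby points are joined by a segment in a compact subset of \<open>\<Omega>\<close>, where the gradient is bounded; for
  distant points it is enough that \<open>\<psi>\<close> is bounded. The constant
  depends on \<open>\<delta>\<close> since \<open>\<psi>\<close> need not be Lipschitz up to the boundary.
\<close>
lemma C2_lipschitz_inside:
  fixes \<Omega> :: "'a::euclidean_space set" and \<psi> :: "'a \<Rightarrow> real"
  assumes \<Omega>: "open \<Omega>" "bounded \<Omega>" and \<psi>: "C2_on \<Omega> \<psi>" and P: "\<And>x. x \<in> \<Omega> \<Longrightarrow> \<bar>\<psi> x\<bar> \<le> P" and \<delta>: "0 < \<delta>"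
  obtains L where "\<And>x y. \<delta> \<le> infdist x (- \<Omega>) \<Longrightarrow> \<delta> \<le> infdist y (- \<Omega>) \<Longrightarrow>
     \<bar>\<psi> x - \<psi> y\<bar> \<le> L * min 1 (norm (x - y) / \<delta>)"
proof -
  obtain g H where gH: "\<And>x. x \<in> \<Omega> \<Longrightarrow> GDERIV \<psi> x :> g x"
     "\<And>x. x \<in> \<Omega> \<Longrightarrow> (g has_derivative blinfun_apply (H x)) (at x)"
    using \<psi> by (auto simp: C2_on_def C2_with_derivs_def)
  define K where "K = {x. \<delta> / 2 \<le> infdist x (- \<Omega>)}"
  have K: "compact K" "K \<subseteq> \<Omega>"
    unfolding K_def using compact_inner_parallel_set[OF \<Omega>(2), of "\<delta> / 2"] \<delta> by auto
  have "continuous_on K g"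
    using gH(2) K(2) by (intro continuous_at_imp_continuous_on ballI has_derivative_continuous) blast
  then have "bounded (g ` K)" by (intro compact_imp_bounded compact_continuous_image K(1))
  then obtain G where G: "0 < G" "\<And>x. x \<in> K \<Longrightarrow> norm (g x) \<le> G"
    unfolding bounded_pos by blast
  define L where "L = max (G * \<delta>) (4 * \<bar>P\<bar>)"
  have L: "G * \<delta> \<le> L" "4 * \<bar>P\<bar> \<le> L" "0 \<le> L" by (auto simp: L_def)
  show thesis
  proof (rule that[of L])
    fix x y assume xy: "\<delta> \<le> infdist x (- \<Omega>)" "\<delta> \<le> infdist y (- \<Omega>)"
    then have in\<Omega>: "x \<in> \<Omega>" "y \<in> \<Omega>" using compact_inner_parallel_set(2)[OF \<Omega>(2) \<delta>] by auto
    show "\<bar>\<psi> x - \<psi> y\<bar> \<le> L * min 1 (norm (x - y) / \<delta>)"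
    proof (cases "norm (x - y) < \<delta> / 2")
      case True
      have seg: "z \<in> K" if "z \<in> closed_segment x y" for z
      proof -
        have "dist x z \<le> norm (x - y)"
          using segment_bound(1)[OF that] by (simp add: dist_norm norm_minus_commute)
        then show ?thesis
          using xy(1) True infdist_triangle[of x "- \<Omega>" z] by (simp add: K_def)
      qed
      have "norm (\<psi> x - \<psi> y) \<le> G * norm (x - y)"
      proof (rule differentiable_bound[where S="closed_segment x y" and f'="\<lambda>z v. v \<bullet> g z"])
        fix z assume z: "z \<in> closed_segment x y"
        have "(\<psi> has_derivative (\<lambda>v. v \<bullet> g z)) (at z)"
          using gH(1)[of z] seg[OF z] K(2) by (auto simp: gderiv_def)
        then show "(\<psi> has_derivative (\<lambda>v. v \<bullet> g z)) (at z within closed_segment x y)"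
          by (rule has_derivative_at_withinI)
        show "onorm (\<lambda>v. v \<bullet> g z) \<le> G"
        proof (rule onorm_bound)
          show "norm (v \<bullet> g z) \<le> G * norm v" for v
            using Cauchy_Schwarz_ineq2[of v "g z"] mult_right_mono[OF G(2)[OF seg[OF z]] norm_ge_zero[of v]]
            by (simp add: mult.commute)
        qed (use G in simp)
      qed auto
      also have "\<dots> = (G * \<delta>) * (norm (x - y) / \<delta>)" using \<delta> by simp
      also have "\<dots> \<le> L * (norm (x - y) / \<delta>)" using L \<delta> by (intro mult_right_mono) auto
      also have "norm (x - y) / \<delta> = min 1 (norm (x - y) / \<delta>)" using True \<delta> by (simp add: min_def field_simps)
      finally show ?thesis by simp
    next
      case False
      have "\<bar>\<psi> x - \<psi> y\<bar> \<le> 2 * \<bar>P\<bar>" using P[OF in\<Omega>(1)] P[OF in\<Omega>(2)] by linarith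
      also have "\<dots> \<le> L * (1 / 2)" using L by simp
      also have "\<dots> \<le> L * min 1 (norm (x - y) / \<delta>)"
        using False \<delta> L by (intro mult_left_mono) (auto simp: field_simps)
      finally show ?thesis .
    qed
  qed
qed

text \<open>It vanishes where the distance to the complement is at most \<open>\<delta>\<close> and is 1 where it is at least \<open>2 \<delta>\<close>.\<close>
definition cutoff :: "'a::euclidean_space set \<Rightarrow> real \<Rightarrow> 'a \<Rightarrow> real" where
  "cutoff \<Omega> \<delta> x = min 1 (max 0 (infdist x (- \<Omega>) / \<delta> - 1))"

lemma cutoff_bounds: "0 \<le> cutoff \<Omega> \<delta> x" "cutoff \<Omega> \<delta> x \<le> 1"
  by (auto simp: cutoff_def)

lemma cutoff_outside: "x \<notin> \<Omega> \<Longrightarrow> cutoff \<Omega> \<delta> x = 0"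
  by (simp add: cutoff_def infdist_zero)

lemma cutoff_nonzero: "0 < \<delta> \<Longrightarrow> cutoff \<Omega> \<delta> x \<noteq> 0 \<Longrightarrow> \<delta> \<le> infdist x (- \<Omega>)"
  by (auto simp: cutoff_def max_def min_def field_simps split: if_splits)

lemma cutoff_measurable [measurable]: "cutoff \<Omega> \<delta> \<in> borel_measurable borel"
proof -
  have [measurable]: "(\<lambda>x. infdist x (- \<Omega>)) \<in> borel_measurable borel"
    by (intro borel_measurable_continuous_onI continuous_intros)
  show ?thesis unfolding cutoff_def by measurable
qed

lemma cutoff_lipschitz:
  assumes "0 < \<delta>"
  shows "\<bar>cutoff \<Omega> \<delta> x - cutoff \<Omega> \<delta> y\<bar> \<le> min 1 (norm (x - y) / \<delta>)"
proof -
  have "infdist x (- \<Omega>) \<le> infdist y (- \<Omega>) + norm (x - y)" "infdist y (- \<Omega>) \<le> infdist x (- \<Omega>) + norm (x - y)"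
    using infdist_triangle[of x "- \<Omega>" y] infdist_triangle[of y "- \<Omega>" x] by (simp_all add: dist_norm norm_minus_commute)
  then have "infdist x (- \<Omega>) / \<delta> \<le> infdist y (- \<Omega>) / \<delta> + norm (x - y) / \<delta>"
     "infdist y (- \<Omega>) / \<delta> \<le> infdist x (- \<Omega>) / \<delta> + norm (x - y) / \<delta>"
    using assms by (simp_all add: add_divide_distrib[symmetric] divide_right_mono)
  then show ?thesis by (auto simp: cutoff_def min_def max_def abs_if)
qed

lemma cutoff_antimono:
  assumes "0 < \<delta>" "\<delta> \<le> \<delta>'"
  shows "cutoff \<Omega> \<delta>' x \<le> cutoff \<Omega> \<delta> x"
proof -
  have "infdist x (- \<Omega>) / \<delta>' \<le> infdist x (- \<Omega>) / \<delta>"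
    using assms by (intro divide_left_mono infdist_nonneg) auto
  then show ?thesis by (auto simp: cutoff_def)
qed

text \<open>
  The truncated gap \<open>\<zeta>\<close> increases as \<open>\<delta>\<close> decreases, whereas the bound on its integral tends to 0. So
  its integral vanishes for every \<open>\<delta>\<close>, and every point of \<open>\<Omega>\<close> is in the support of some cutoff.
\<close>
lemma coincidence_of_positive_curvature:
  fixes \<Omega> :: "'a::euclidean_space set" and w \<phi> \<psi> u :: "'a \<Rightarrow> real"
  assumes \<Omega>: "open \<Omega>" "bounded \<Omega>" "C2_boundary \<Omega>" and s: "0 < s" "s < 1"
    and sol: "solves_obstacle s \<Omega> \<Omega> \<phi> \<psi> u"
    and \<psi>: "C2_on \<Omega> \<psi>" "\<And>x. x \<in> \<Omega> \<Longrightarrow> \<bar>\<psi> x\<bar> \<le> P"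
    and w: "w \<in> borel_measurable borel"
    and w\<psi>: "\<And>x. x \<in> \<Omega> \<Longrightarrow> w x = \<psi> x" and w\<phi>: "AE x in lborel. x \<notin> \<Omega> \<longrightarrow> \<phi> x = w x"
    and r: "0 < r"
    and curv: "\<And>x \<epsilon>. x \<in> \<Omega> \<Longrightarrow> 0 < \<epsilon> \<Longrightarrow> 1 - cyl_tail s TYPE('a) r \<epsilon> \<le> 2 * curv s w \<epsilon> x"
  shows "AE x in lebesgue. x \<in> \<Omega> \<longrightarrow> u x = \<psi> x"
proof -
  have "u \<in> W_obst s \<Omega> \<Omega> \<phi> \<psi>" using sol by (simp add: solves_obstacle_def)
  then obtain U where U: "U \<in> borel_measurable borel" "AE x in lborel. u x = U x"
    "\<And>x. w x \<le> U x" "\<And>x. x \<notin> \<Omega> \<Longrightarrow> U x = w x"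
    using obstacle_borel_version[OF \<Omega>(1) w _ w\<psi> w\<phi>] by metis
  define \<zeta> where "\<zeta> \<delta> x = min (U x - w x) (cutoff \<Omega> \<delta> x)" for \<delta> x
  have \<zeta>0: "0 \<le> \<zeta> \<delta> x" for \<delta> x using U(3)[of x] cutoff_bounds(1)[of \<Omega> \<delta> x] by (simp add: \<zeta>_def)
  obtain C \<delta>\<^sub>0 where C: "0 \<le> C" "0 < \<delta>\<^sub>0"
    "\<And>\<delta>. 0 < \<delta> \<Longrightarrow> \<delta> < \<delta>\<^sub>0 \<Longrightarrow> measure lborel {x \<in> \<Omega>. infdist x (- \<Omega>) < \<delta>} \<le> C * \<delta>"
    using boundary_layer_measure[OF \<Omega>] by metis
  define A where "A = 8 * G_bound DIM('a) s * C * (omega DIM('a) * (1 / (1 - s) + 1 / s))"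
  have est: "integrable lborel (\<zeta> \<delta>)" "2 * \<delta> < \<delta>\<^sub>0 \<Longrightarrow> (LBINT x. \<zeta> \<delta> x) \<le> A * \<delta> powr (1 - s)"
    if \<delta>: "0 < \<delta>" for \<delta>
  proof -
    obtain L where L: "\<And>x y. \<delta> \<le> infdist x (- \<Omega>) \<Longrightarrow> \<delta> \<le> infdist y (- \<Omega>) \<Longrightarrow>
     \<bar>\<psi> x - \<psi> y\<bar> \<le> L * min 1 (norm (x - y) / \<delta>)"
      using C2_lipschitz_inside[OF \<Omega>(1,2) \<psi> \<delta>] by metis
    have w_lip: "\<bar>w x - w y\<bar> \<le> L * min 1 (norm (x - y) / \<delta>)"
      if "cutoff \<Omega> \<delta> x \<noteq> 0" "cutoff \<Omega> \<delta> y \<noteq> 0" for x y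
    proof -
      have "x \<in> \<Omega>" "y \<in> \<Omega>" using that cutoff_outside by blast+
      then show ?thesis
        using L[OF cutoff_nonzero[OF \<delta> that(1)] cutoff_nonzero[OF \<delta> that(2)]] w\<psi> by simp
    qed
    note gap = obstacle_gap_estimate[OF \<Omega>(1,2) s sol w w\<psi> w\<phi> U cutoff_measurable[of \<Omega> \<delta>] \<delta>
       cutoff_bounds[of \<Omega> \<delta>] cutoff_outside[of _ \<Omega> \<delta>] cutoff_lipschitz[OF \<delta>, of \<Omega>] w_lip r curv]
    show "integrable lborel (\<zeta> \<delta>)" using gap(1) by (simp add: \<zeta>_def[abs_def])
    assume small: "2 * \<delta> < \<delta>\<^sub>0"
    have layer: "{x \<in> \<Omega>. cutoff \<Omega> \<delta> x < 1} = {x \<in> \<Omega>. infdist x (- \<Omega>) < 2 * \<delta>}"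
      using \<delta> by (auto simp: cutoff_def min_def max_def field_simps split: if_splits)
    have "(LBINT x. \<zeta> \<delta> x) \<le> 4 * G_bound DIM('a) s * measure lborel {x \<in> \<Omega>. infdist x (- \<Omega>) < 2 * \<delta>} * lip_mass DIM('a) s \<delta>"
      using gap(2) unfolding layer by (simp add: \<zeta>_def)
    also have "\<dots> \<le> 4 * G_bound DIM('a) s * (C * (2 * \<delta>)) * lip_mass DIM('a) s \<delta>"
      using C(3)[of "2 * \<delta>"] small \<delta> G_bound_nonneg[of "DIM('a)" s] s omega_pos[of "DIM('a)"]
      by (intro mult_right_mono mult_left_mono) (auto simp: lip_mass_def)
    also have "\<dots> = A * (\<delta> * \<delta> powr (- s))"
      by (simp add: A_def lip_mass_def)
    also have "\<delta> * \<delta> powr (- s) = \<delta> powr (1 - s)"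
      using \<delta> powr_add[of \<delta> 1 "- s"] by simp
    finally show "(LBINT x. \<zeta> \<delta> x) \<le> A * \<delta> powr (1 - s)" .
  qed
  have "AE x in lborel. \<zeta> \<delta> x = 0" if \<delta>: "0 < \<delta>" for \<delta>
  proof -
    have lim: "(\<lambda>k. A * (1 / real (Suc k)) powr (1 - s)) \<longlonglongrightarrow> A * 0"
      using s by (intro tendsto_mult tendsto_const tendsto_zero_powrI[where b="1 - s"]) (real_asymp, auto)
    have "(\<lambda>k. 1 / real (Suc k)) \<longlonglongrightarrow> 0" by real_asymp
    moreover have "0 < min \<delta> (\<delta>\<^sub>0 / 2)" using \<delta> C(2) by simp
    ultimately have "eventually (\<lambda>k. 1 / real (Suc k) < min \<delta> (\<delta>\<^sub>0 / 2)) sequentially"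
      by (intro order_tendstoD)
    then have "eventually (\<lambda>k. (LBINT x. \<zeta> \<delta> x) \<le> A * (1 / real (Suc k)) powr (1 - s)) sequentially"
    proof eventually_elim
      case (elim k)
      have k: "0 < 1 / real (Suc k)" "2 * (1 / real (Suc k)) < \<delta>\<^sub>0" "1 / real (Suc k) \<le> \<delta>"
        using elim by auto
      have "(LBINT x. \<zeta> \<delta> x) \<le> (LBINT x. \<zeta> (1 / real (Suc k)) x)"
        using cutoff_antimono[OF k(1,3)] by (intro integral_mono est(1) \<delta> k(1)) (auto simp: \<zeta>_def intro: min.coboundedI2)
      also have "\<dots> \<le> A * (1 / real (Suc k)) powr (1 - s)" using est(2)[OF k(1,2)] .
      finally show ?case .
    qed
    then have "(LBINT x. \<zeta> \<delta> x) \<le> A * 0"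
      by (intro tendsto_le[OF sequentially_bot lim tendsto_const])
    moreover have "0 \<le> (LBINT x. \<zeta> \<delta> x)" using \<zeta>0 by (intro Bochner_Integration.integral_nonneg)
    ultimately have "(LBINT x. \<zeta> \<delta> x) = 0" by simp
    then show ?thesis
      using integral_nonneg_eq_0_iff_AE[OF est(1)[OF \<delta>]] \<zeta>0 by simp
  qed
  then have "AE x in lborel. \<forall>k::nat. \<zeta> (1 / real (Suc k)) x = 0"
    unfolding AE_all_countable by auto
  then have "AE x in lborel. x \<in> \<Omega> \<longrightarrow> u x = \<psi> x"
    using U(2)
  proof eventually_elim
    case (elim x)
    show ?case
    proof
      assume x: "x \<in> \<Omega>"
      have ne: "- \<Omega> \<noteq> {}"
      proof
        assume "- \<Omega> = {}"
        then have "\<Omega> = UNIV" by auto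
        then show False using \<Omega>(2) not_bounded_UNIV[where 'a='a] by simp
      qed
      have "0 < infdist x (- \<Omega>)"
        using x \<Omega>(1) ne by (intro infdist_pos_not_in_closed) auto
      then obtain k where k: "1 / real (Suc k) < infdist x (- \<Omega>)"
        using reals_Archimedean[of "infdist x (- \<Omega>)"] by (auto simp: inverse_eq_divide)
      then have "0 < cutoff \<Omega> (1 / real (Suc k)) x" by (simp add: cutoff_def field_simps)
      moreover have "\<zeta> (1 / real (Suc k)) x = 0" using elim by blast
      ultimately have "U x = w x" by (simp add: \<zeta>_def min_def split: if_splits)
      then show "u x = \<psi> x" using elim w\<psi>[OF x] by simp
    qed
  qed
  then show ?thesis by (simp add: AE_completion_iff)
qed

text \<open>
  Both alternatives on the obstacle lead to touching balls, even if \<open>\<phi>\<close> is changed to a suitably low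
  value \<open>m\<close> on an arbitrary set.
\<close>
lemma uniformly_tangent_data:
  fixes \<Omega> :: "'a::euclidean_space set" and \<phi> \<psi> :: "'a \<Rightarrow> real"
  assumes \<Omega>: "open \<Omega>" "bounded \<Omega>" "C2_boundary \<Omega>"
    and \<psi>: "(\<exists>g. C2_closure_with_grad \<Omega> \<psi> g \<and>
            (\<exists>\<rho>>0. \<exists>a>0. continuous_on (nbhd \<Omega> (2 * \<rho>) - \<Omega>) \<phi> \<and>
              (\<forall>x0 \<in> frontier \<Omega>. \<forall>x \<in> ball x0 \<rho> - \<Omega>.
                 \<phi> x \<le> \<psi> x0 + g x0 \<bullet> (x - x0) + a / 2 * (norm (x - x0))\<^sup>2)))
         \<or> (continuous_on (closure \<Omega>) \<psi> \<and> C2_on \<Omega> \<psi> \<and>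
            open {(x, t). x \<in> \<Omega> \<and> t > \<psi> x} \<and>
            C2_boundary {(x, t). x \<in> \<Omega> \<and> t > \<psi> x})" (is "?touch \<or> ?epigraph")
  shows "continuous_on (closure \<Omega>) \<psi> \<and> C2_on \<Omega> \<psi> \<and> (\<exists>m. \<forall>w. (\<forall>x\<in>\<Omega>. w x = \<psi> x) \<longrightarrow>
    (\<forall>x. x \<notin> \<Omega> \<longrightarrow> w x = \<phi> x \<or> w x = m) \<longrightarrow> uniformly_tangent \<Omega> w)"
  using \<psi>
proof
  assume ?touch
  then obtain g \<rho> a where g: "C2_closure_with_grad \<Omega> \<psi> g" and \<rho>: "0 < \<rho>" and a: "0 < a"
    and ext: "\<forall>x0 \<in> frontier \<Omega>. \<forall>x \<in> ball x0 \<rho> - \<Omega>.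
                 \<phi> x \<le> \<psi> x0 + g x0 \<bullet> (x - x0) + a / 2 * (norm (x - x0))\<^sup>2"
    by (elim exE conjE)
  have cont: "continuous_on (closure \<Omega>) \<psi>" "continuous_on (closure \<Omega>) g"
    using g by (simp_all add: C2_closure_with_grad_def)
  have C2: "C2_on \<Omega> \<psi>"
    using g by (auto simp: C2_closure_with_grad_def C2_on_def)
  have "compact (closure \<Omega>)" using \<Omega>(2) by (simp add: compact_closure)
  then have "bounded ((\<lambda>x. \<psi> x - norm (g x)) ` closure \<Omega>)"
    using cont by (intro compact_imp_bounded compact_continuous_image continuous_intros)
  then obtain B where B: "\<forall>y\<in>(\<lambda>x. \<psi> x - norm (g x)) ` closure \<Omega>. norm y \<le> B"
    unfolding bounded_iff by blast
  have m: "- B \<le> \<psi> x - norm (g x)" if "x \<in> \<Omega>" for x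
  proof -
    have "x \<in> closure \<Omega>" using that closure_subset by blast
    then have "norm (\<psi> x - norm (g x)) \<le> B" using B by blast
    then show ?thesis by (simp only: real_norm_def abs_le_iff) linarith
  qed
  have "uniformly_tangent \<Omega> w" if w: "\<forall>x\<in>\<Omega>. w x = \<psi> x" "\<forall>x. x \<notin> \<Omega> \<longrightarrow> w x = \<phi> x \<or> w x = - B" for w
  proof (rule uniformly_tangent_C2_closure[OF \<Omega> g \<rho> a])
    show "\<phi> x \<le> \<psi> x0 + g x0 \<bullet> (x - x0) + a / 2 * (norm (x - x0))\<^sup>2"
      if "x0 \<in> frontier \<Omega>" "x \<in> ball x0 \<rho> - \<Omega>" for x0 x
      using bspec[OF bspec[OF ext that(1)] that(2)] .
    show "w x = \<psi> x" if "x \<in> \<Omega>" for x using w(1) that by blast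
    show "w x = \<phi> x \<or> w x = - B" if "x \<notin> \<Omega>" for x using w(2) that by blast
  qed (rule m)
  then show ?thesis using cont(1) C2 by (intro conjI exI[of _ "- B"] allI impI)
next
  assume ?epigraph
  then have cont: "continuous_on (closure \<Omega>) \<psi>" and C2: "C2_on \<Omega> \<psi>"
    and O: "open {(x, t). x \<in> \<Omega> \<and> t > \<psi> x}" "C2_boundary {(x, t). x \<in> \<Omega> \<and> t > \<psi> x}"
    by blast+
  have "uniformly_tangent \<Omega> w" if w: "\<forall>x\<in>\<Omega>. w x = \<psi> x" for w
    by (rule uniformly_tangent_C2_epigraph[OF \<Omega>(2) cont O]) (use w in blast)
  then show ?thesis using cont C2 by (intro conjI exI[of _ 0] allI impI)
qed

theorem theorem4p3:
  fixes \<Omega> :: "(real ^ 'n) set"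
    and \<phi> \<psi> :: "real ^ 'n \<Rightarrow> real"
    and u :: "real \<Rightarrow> real ^ 'n \<Rightarrow> real"
  assumes "open \<Omega>" and "bounded \<Omega>" and "connected \<Omega>" and "C2_boundary \<Omega>"
    and "Linf_loc \<phi>"
    and "alpha_bar (subgraph \<phi>) < ereal (omega (CARD('n) + 1) / 2)"
    and "(\<exists>grad_psi. C2_closure_with_grad \<Omega> \<psi> grad_psi \<and>
            (\<exists>\<rho>>0. \<exists>a>0. continuous_on (nbhd \<Omega> (2 * \<rho>) - \<Omega>) \<phi> \<and>
              (\<forall>x0 \<in> frontier \<Omega>. \<forall>x \<in> ball x0 \<rho> - \<Omega>.
                 \<phi> x \<le> \<psi> x0 + grad_psi x0 \<bullet> (x - x0) + a / 2 * (norm (x - x0))\<^sup>2)))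
         \<or> (continuous_on (closure \<Omega>) \<psi> \<and> C2_on \<Omega> \<psi> \<and>
            open {(x, t). x \<in> \<Omega> \<and> t > \<psi> x} \<and>
            C2_boundary {(x, t). x \<in> \<Omega> \<and> t > \<psi> x})"
    and "\<forall>s \<in> {0<..<1}. solves_obstacle s \<Omega> \<Omega> \<phi> \<psi> (u s)"
  shows "\<exists>s0 \<in> {0<..<1}. \<forall>s \<in> {0<..<s0}. AE x in lebesgue. x \<in> \<Omega> \<longrightarrow> u s x = \<psi> x"
proof -
  note \<Omega> = assms(1,2,4)
  from uniformly_tangent_data[OF \<Omega> assms(7)]
  obtain m where cont: "continuous_on (closure \<Omega>) \<psi>" and C2: "C2_on \<Omega> \<psi>"
    and tan: "\<forall>w. (\<forall>x\<in>\<Omega>. w x = \<psi> x) \<longrightarrow> (\<forall>x. x \<notin> \<Omega> \<longrightarrow> w x = \<phi> x \<or> w x = m) \<longrightarrow> uniformly_tangent \<Omega> w"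
    by (elim conjE exE)
  have cl: "compact (closure \<Omega>)" using \<Omega>(2) by (simp add: compact_closure)
  have \<Omega>cl: "x \<in> closure \<Omega>" if "x \<in> \<Omega>" for x using that closure_subset by blast
  from Linf_loc_borel_version[OF assms(5) cl, of m]
  obtain \<phi>\<^sub>0 M where \<phi>\<^sub>0[measurable]: "\<phi>\<^sub>0 \<in> borel_measurable borel" and \<phi>eq: "AE x in lebesgue. \<phi> x = \<phi>\<^sub>0 x"
    and \<phi>m: "\<forall>x. \<phi>\<^sub>0 x = \<phi> x \<or> \<phi>\<^sub>0 x = m" and M: "0 \<le> M" "\<forall>x\<in>closure \<Omega>. \<bar>\<phi>\<^sub>0 x\<bar> \<le> M"
    by (elim conjE exE)
  have "bounded (\<psi> ` closure \<Omega>)" by (intro compact_imp_bounded compact_continuous_image cont cl)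
  then obtain P where P: "0 < P" "\<And>x. x \<in> closure \<Omega> \<Longrightarrow> \<bar>\<psi> x\<bar> \<le> P"
    unfolding bounded_pos by auto
  obtain B where B: "0 < B" "\<And>x. x \<in> \<Omega> \<Longrightarrow> norm x \<le> B"
    using \<Omega>(2) unfolding bounded_pos by blast
  define w where "w x = (if x \<in> \<Omega> then \<psi> x else \<phi>\<^sub>0 x)" for x
  have \<Omega>m[measurable]: "\<Omega> \<in> sets borel" using \<Omega>(1) by simp
  have wm: "w \<in> borel_measurable borel"
  proof -
    have [measurable]: "(\<lambda>x. indicator \<Omega> x *\<^sub>R \<psi> x) \<in> borel_measurable borel"
      using continuous_on_subset[OF cont closure_subset] by (intro borel_measurable_continuous_on_indicator) auto
    have "w = (\<lambda>x. if x \<in> \<Omega> then indicator \<Omega> x *\<^sub>R \<psi> x else \<phi>\<^sub>0 x)" by (auto simp: w_def)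
    then show ?thesis by simp
  qed
  have "\<forall>x\<in>\<Omega>. w x = \<psi> x" "\<forall>x. x \<notin> \<Omega> \<longrightarrow> w x = \<phi> x \<or> w x = m"
    using \<phi>m by (simp_all add: w_def)
  then have "uniformly_tangent \<Omega> w" using tan by blast
  moreover have "Limsup (at_right 0) (\<lambda>s. ereal (s * far_mass s (subgraph \<phi>\<^sub>0))) < ereal (omega DIM((real ^ 'n) \<times> real) / 2)"
    using assms(6) alpha_bar_eq_far_mass[OF \<phi>\<^sub>0 \<phi>eq] by simp
  moreover have "norm (x, w x) \<le> B + P" if "x \<in> \<Omega>" for x
    using norm_Pair_le[of x "w x"] B(2)[OF that] P(2)[OF \<Omega>cl[OF that]] that by (simp add: w_def)
  moreover have "Y \<in> subgraph \<phi>\<^sub>0" if Y: "Y \<in> subgraph w" "B + P + M + 1 \<le> norm Y" for Y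
  proof -
    obtain y t where yt: "Y = (y, t)" by (cases Y)
    show ?thesis
    proof (cases "y \<in> \<Omega>")
      case True
      have "t < \<psi> y" using Y(1) True by (simp add: yt subgraph_def w_def)
      moreover have "\<bar>\<psi> y\<bar> \<le> P" "\<bar>\<phi>\<^sub>0 y\<bar> \<le> M" using P(2) M(2) \<Omega>cl[OF True] by blast+
      moreover have "norm Y \<le> norm y + \<bar>t\<bar>" using norm_Pair_le[of y t] by (simp add: yt)
      ultimately have "t < \<phi>\<^sub>0 y" using Y(2) B(2)[OF True] P(1) M(1) by linarith
      then show ?thesis by (simp add: yt subgraph_def)
    next
      case False
      then show ?thesis using Y(1) by (simp add: yt subgraph_def w_def)
    qed
  qed
  ultimately have "\<exists>r>0. \<exists>s\<^sub>0. 0 < s\<^sub>0 \<and> s\<^sub>0 < 1 \<and> (\<forall>s x \<epsilon>. 0 < s \<longrightarrow> s < s\<^sub>0 \<longrightarrow> x \<in> \<Omega> \<longrightarrow> 0 < \<epsilon> \<longrightarrow>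
      1 - cyl_tail s TYPE(real ^ 'n) r \<epsilon> \<le> 2 * curv s w \<epsilon> x)"
    by (intro curv_eventually_ge_1[OF wm \<phi>\<^sub>0])
  then obtain r s\<^sub>0 where r: "0 < r" and s0: "0 < s\<^sub>0" "s\<^sub>0 < 1"
    and curv: "\<forall>s x \<epsilon>. 0 < s \<longrightarrow> s < s\<^sub>0 \<longrightarrow> x \<in> \<Omega> \<longrightarrow> 0 < \<epsilon> \<longrightarrow>
      1 - cyl_tail s TYPE(real ^ 'n) r \<epsilon> \<le> 2 * curv s w \<epsilon> x"
    by (elim conjE exE)
  have w\<phi>: "AE x in lborel. x \<notin> \<Omega> \<longrightarrow> \<phi> x = w x"
    using \<phi>eq unfolding AE_completion_iff by eventually_elim (simp add: w_def)
  have "AE x in lebesgue. x \<in> \<Omega> \<longrightarrow> u s x = \<psi> x" if s: "0 < s" "s < s\<^sub>0" for s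
  proof (rule coincidence_of_positive_curvature[OF \<Omega> s(1) _ _ C2 _ wm _ w\<phi> r])
    show "s < 1" using s s0 by linarith
    then show "solves_obstacle s \<Omega> \<Omega> \<phi> \<psi> (u s)" using assms(8) s by simp
    show "\<bar>\<psi> x\<bar> \<le> P" if "x \<in> \<Omega>" for x using P(2) \<Omega>cl that by blast
    show "w x = \<psi> x" if "x \<in> \<Omega>" for x using that by (simp add: w_def)
    show "1 - cyl_tail s TYPE(real ^ 'n) r \<epsilon> \<le> 2 * curv s w \<epsilon> x" if "x \<in> \<Omega>" "0 < \<epsilon>" for x \<epsilon>
      using curv s that by blast
  qed
  then show ?thesis using s0 by (intro bexI[of _ s\<^sub>0]) auto
qed

end
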